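(* Let $\mathbb{A}$ be a finite skeletal category containing no endomorphisms except identities. Then the (topological) Euler characteristic $\chi(B\mathbb{A})$ of the classifying space $B\mathbb{A}$ is defined and equal to the Euler characteristic $\chi(\mathbb{A})$ of the category $\mathbb{A}$.
   Context: The classifying space $B\mathbb{A}$ is the geometric realization of the nerve $N\mathbb{A}$, the simplicial set whose $n$-simplices are the strings $a_0 \to a_1 \to \cdots \to a_n$ of composable arrows in $\mathbb{A}$. When $N\mathbb{A}$ has only finitely many nondegenerate simplices, $B\mathbb{A}$ is a finite CW-complex and its topological Euler characteristic is defined and equals $\sum_{n \geq 0} (-1)^n |\{\text{nondegenerate } n\text{-simplices of } N\mathbb{A}\}|$. A category is skeletal if isomorphic objects are equal. For a finite category $\mathbb{A}$, a weighting on $\mathbb{A}$ is a function $k^\bullet: \mathrm{ob}\,\mathbb{A} \to \mathbb{Q}$ such that $\sum_{b} |\mathbb{A}(a,b)|\, k^b = 1$ for all $a \in \mathbb{A}$. A coweighting $k_\bullet$ on $\mathbb{A}$ is a weighting on $\mathbb{A}^{\mathrm{op}}$. A finite category $\mathbb{A}$ has Euler characteristic if it admits both a weighting and a coweighting; then $\chi(\mathbb{A}) = \sum_a k^a = \sum_a k_a \in \mathbb{Q}$ for any weighting $k^\bullet$ and coweighting $k_\bullet$ (the two sums agree and do not depend on the choices). *)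

theory Defs
  imports "HOL-Homology.Homology"
begin

section \<open>Categories\<close>

record ('o, 'a) category_data =
  Ob :: "'o set"
  Arr :: "'a set"
  Dom :: "'a \<Rightarrow> 'o"
  Cod :: "'a \<Rightarrow> 'o"
  Ident :: "'o \<Rightarrow> 'a"
  Comp :: "'a \<Rightarrow> 'a \<Rightarrow> 'a"

text \<open>\<open>Comp C g f\<close> is the composite of \<open>f\<close> followed by \<open>g\<close>; it is meaningful only if
  \<open>Cod C f = Dom C g\<close>.\<close>

definition Hom :: "('o, 'a) category_data \<Rightarrow> 'o \<Rightarrow> 'o \<Rightarrow> 'a set" where
  "Hom C a b = {f \<in> Arr C. Dom C f = a \<and> Cod C f = b}"

locale category =
  fixes C :: "('o, 'a) category_data"
  assumes Dom_in: "f \<in> Arr C \<Longrightarrow> Dom C f \<in> Ob C"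
    and Cod_in: "f \<in> Arr C \<Longrightarrow> Cod C f \<in> Ob C"
    and Ident_in: "a \<in> Ob C \<Longrightarrow> Ident C a \<in> Hom C a a"
    and Comp_in: "f \<in> Hom C a b \<Longrightarrow> g \<in> Hom C b c \<Longrightarrow> Comp C g f \<in> Hom C a c"
    and Comp_Ident: "f \<in> Hom C a b \<Longrightarrow> Comp C f (Ident C a) = f"
    and Ident_Comp: "f \<in> Hom C a b \<Longrightarrow> Comp C (Ident C b) f = f"
    and Comp_assoc: "f \<in> Hom C a b \<Longrightarrow> g \<in> Hom C b c \<Longrightarrow> h \<in> Hom C c d \<Longrightarrow>
           Comp C h (Comp C g f) = Comp C (Comp C h g) f"

definition finite_category :: "('o, 'a) category_data \<Rightarrow> bool" where
  "finite_category C \<longleftrightarrow> category C \<and> finite (Ob C) \<and> finite (Arr C)"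

definition isomorphic_obs :: "('o, 'a) category_data \<Rightarrow> 'o \<Rightarrow> 'o \<Rightarrow> bool" where
  "isomorphic_obs C a b \<longleftrightarrow>
     (\<exists>f \<in> Hom C a b. \<exists>g \<in> Hom C b a. Comp C g f = Ident C a \<and> Comp C f g = Ident C b)"

definition skeletal :: "('o, 'a) category_data \<Rightarrow> bool" where
  "skeletal C \<longleftrightarrow> (\<forall>a \<in> Ob C. \<forall>b \<in> Ob C. isomorphic_obs C a b \<longrightarrow> a = b)"

definition only_identity_endos :: "('o, 'a) category_data \<Rightarrow> bool" where
  "only_identity_endos C \<longleftrightarrow> (\<forall>a \<in> Ob C. \<forall>f \<in> Hom C a a. f = Ident C a)"

definition opposite :: "('o, 'a) category_data \<Rightarrow> ('o, 'a) category_data" where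
  "opposite C = \<lparr>Ob = Ob C, Arr = Arr C, Dom = Cod C, Cod = Dom C,
                 Ident = Ident C, Comp = (\<lambda>g f. Comp C f g)\<rparr>"


section \<open>The Euler characteristic of a finite category\<close>

definition weighting :: "('o, 'a) category_data \<Rightarrow> ('o \<Rightarrow> rat) \<Rightarrow> bool" where
  "weighting C k \<longleftrightarrow> (\<forall>a \<in> Ob C. (\<Sum>b\<in>Ob C. of_nat (card (Hom C a b)) * k b) = 1)"

definition coweighting :: "('o, 'a) category_data \<Rightarrow> ('o \<Rightarrow> rat) \<Rightarrow> bool" where
  "coweighting C k \<longleftrightarrow> weighting (opposite C) k"

definition has_cat_euler_char :: "('o, 'a) category_data \<Rightarrow> bool" where
  "has_cat_euler_char C \<longleftrightarrow> finite_category C \<and> (\<exists>k. weighting C k) \<and> (\<exists>k. coweighting C k)"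

text \<open>The common total of all weightings and all coweightings; only meaningful if
  \<open>has_cat_euler_char C\<close>.\<close>

definition cat_euler_char :: "('o, 'a) category_data \<Rightarrow> rat" where
  "cat_euler_char C = (THE q. (\<forall>k. weighting C k \<longrightarrow> (\<Sum>a\<in>Ob C. k a) = q) \<and>
                              (\<forall>k. coweighting C k \<longrightarrow> (\<Sum>a\<in>Ob C. k a) = q))"

lemma cat_euler_char_eq:
  assumes "has_cat_euler_char C"
  shows "weighting C k \<Longrightarrow> cat_euler_char C = (\<Sum>a\<in>Ob C. k a)"
    and "coweighting C l \<Longrightarrow> cat_euler_char C = (\<Sum>a\<in>Ob C. l a)"
proof -
  have Hop: "Hom (opposite C) a b = Hom C b a" for a b
    by (auto simp: Hom_def opposite_def)
  have eq: "(\<Sum>a\<in>Ob C. k a) = (\<Sum>a\<in>Ob C. l a)" if k: "weighting C k" and l: "coweighting C l" for k l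
  proof -
    have l': "(\<Sum>a\<in>Ob C. of_nat (card (Hom C a b)) * l a) = 1" if "b \<in> Ob C" for b
      using l that unfolding coweighting_def weighting_def Hop by (simp add: opposite_def)
    have "(\<Sum>a\<in>Ob C. k a) = (\<Sum>b\<in>Ob C. (\<Sum>a\<in>Ob C. of_nat (card (Hom C a b)) * l a) * k b)"
      by (simp add: l')
    also have "\<dots> = (\<Sum>a\<in>Ob C. \<Sum>b\<in>Ob C. of_nat (card (Hom C a b)) * l a * k b)"
      by (simp add: sum_distrib_right) (rule sum.swap)
    also have "\<dots> = (\<Sum>a\<in>Ob C. l a * (\<Sum>b\<in>Ob C. of_nat (card (Hom C a b)) * k b))"
      by (simp add: sum_distrib_left mult_ac)
    also have "\<dots> = (\<Sum>a\<in>Ob C. l a)"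
      using k by (simp add: weighting_def)
    finally show ?thesis .
  qed
  obtain k0 l0 where kl: "weighting C k0" "coweighting C l0"
    using assms by (auto simp: has_cat_euler_char_def)
  have *: "cat_euler_char C = (\<Sum>a\<in>Ob C. k0 a)"
    unfolding cat_euler_char_def
  proof (rule the_equality)
    show "(\<forall>k. weighting C k \<longrightarrow> (\<Sum>a\<in>Ob C. k a) = (\<Sum>a\<in>Ob C. k0 a)) \<and>
          (\<forall>k. coweighting C k \<longrightarrow> (\<Sum>a\<in>Ob C. k a) = (\<Sum>a\<in>Ob C. k0 a))"
      using eq kl by metis
  qed (use kl in metis)
  show "weighting C k \<Longrightarrow> cat_euler_char C = (\<Sum>a\<in>Ob C. k a)"
    using * eq kl by metis
  show "coweighting C l \<Longrightarrow> cat_euler_char C = (\<Sum>a\<in>Ob C. l a)"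
    using * eq kl by metis
qed


section \<open>Simplicial sets and geometric realization\<close>

text \<open>A monotone map \<open>\<theta> : [m] \<rightarrow> [n]\<close> is represented by any function that agrees with it on
  \<open>{0..m}\<close>; \<open>action X m n \<theta>\<close> is the induced map from the \<open>n\<close>-simplices to the
  \<open>m\<close>-simplices of \<open>X\<close>.\<close>

record 'x sset =
  simplices :: "nat \<Rightarrow> 'x set"
  action :: "nat \<Rightarrow> nat \<Rightarrow> (nat \<Rightarrow> nat) \<Rightarrow> 'x \<Rightarrow> 'x"

definition ord_map :: "nat \<Rightarrow> nat \<Rightarrow> (nat \<Rightarrow> nat) \<Rightarrow> bool" where
  "ord_map m n \<theta> \<longleftrightarrow> (\<forall>i\<le>m. \<theta> i \<le> n) \<and> (\<forall>i j. i \<le> j \<and> j \<le> m \<longrightarrow> \<theta> i \<le> \<theta> j)"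

locale simplicial_set =
  fixes X :: "'x sset"
  assumes action_in: "ord_map m n \<theta> \<Longrightarrow> x \<in> simplices X n \<Longrightarrow> action X m n \<theta> x \<in> simplices X m"
    and action_id: "x \<in> simplices X n \<Longrightarrow> action X n n id x = x"
    and action_comp: "ord_map l m \<eta> \<Longrightarrow> ord_map m n \<theta> \<Longrightarrow> x \<in> simplices X n \<Longrightarrow>
           action X l m \<eta> (action X m n \<theta> x) = action X l n (\<theta> \<circ> \<eta>) x"
    and action_cong: "(\<And>i. i \<le> m \<Longrightarrow> \<theta> i = \<theta>' i) \<Longrightarrow> x \<in> simplices X n \<Longrightarrow>
           action X m n \<theta> x = action X m n \<theta>' x"

text \<open>The surjection \<open>[n] \<rightarrow> [n - 1]\<close> that takes the value \<open>i\<close> twice; it induces the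
  degeneracy operator \<open>s\<^sub>i\<close>.\<close>

definition codegeneracy :: "nat \<Rightarrow> nat \<Rightarrow> nat" where
  "codegeneracy i = (\<lambda>j. if j \<le> i then j else j - 1)"

definition degenerate :: "'x sset \<Rightarrow> nat \<Rightarrow> 'x \<Rightarrow> bool" where
  "degenerate X n x \<longleftrightarrow>
     (\<exists>i<n. \<exists>y \<in> simplices X (n - 1). x = action X n (n - 1) (codegeneracy i) y)"

definition nondegenerate_simplices :: "'x sset \<Rightarrow> (nat \<times> 'x) set" where
  "nondegenerate_simplices X = {(n, x). x \<in> simplices X n \<and> \<not> degenerate X n x}"

text \<open>The affine map of standard simplices \<open>\<Delta>\<^sup>m \<rightarrow> \<Delta>\<^sup>n\<close> induced by \<open>\<theta> : [m] \<rightarrow> [n]\<close>, in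
  barycentric coordinates.\<close>

definition simplex_push :: "nat \<Rightarrow> (nat \<Rightarrow> nat) \<Rightarrow> (nat \<Rightarrow> real) \<Rightarrow> (nat \<Rightarrow> real)" where
  "simplex_push m \<theta> t = (\<lambda>j. \<Sum>i | i \<le> m \<and> \<theta> i = j. t i)"

definition quotient_topology :: "'a topology \<Rightarrow> ('a \<Rightarrow> 'b) \<Rightarrow> 'b topology" where
  "quotient_topology X q =
     topology (\<lambda>U. U \<subseteq> q ` topspace X \<and> openin X {x \<in> topspace X. q x \<in> U})"

lemma openin_quotient_topology:
  "openin (quotient_topology X q) U \<longleftrightarrow>
     U \<subseteq> q ` topspace X \<and> openin X {x \<in> topspace X. q x \<in> U}"
proof -
  have "istopology (\<lambda>U. U \<subseteq> q ` topspace X \<and> openin X {x \<in> topspace X. q x \<in> U})"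
    unfolding istopology_def
  proof (rule conjI; intro allI impI)
    fix S T
    assume S: "S \<subseteq> q ` topspace X \<and> openin X {x \<in> topspace X. q x \<in> S}"
      and T: "T \<subseteq> q ` topspace X \<and> openin X {x \<in> topspace X. q x \<in> T}"
    have "{x \<in> topspace X. q x \<in> S \<inter> T} =
          {x \<in> topspace X. q x \<in> S} \<inter> {x \<in> topspace X. q x \<in> T}" by auto
    then show "S \<inter> T \<subseteq> q ` topspace X \<and> openin X {x \<in> topspace X. q x \<in> S \<inter> T}"
      using S T by auto
  next
    fix K
    assume K: "\<forall>S\<in>K. S \<subseteq> q ` topspace X \<and> openin X {x \<in> topspace X. q x \<in> S}"
    have "{x \<in> topspace X. q x \<in> \<Union>K} = (\<Union>S\<in>K. {x \<in> topspace X. q x \<in> S})" by auto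
    then show "\<Union>K \<subseteq> q ` topspace X \<and> openin X {x \<in> topspace X. q x \<in> \<Union>K}"
      using K by auto
  qed
  then show ?thesis
    by (simp add: quotient_topology_def)
qed

lemma topspace_quotient_topology [simp]: "topspace (quotient_topology X q) = q ` topspace X"
proof -
  have "{x \<in> topspace X. q x \<in> q ` topspace X} = topspace X" by auto
  then show ?thesis
    by (metis openin_quotient_topology openin_subset openin_topspace subset_antisym subset_refl)
qed

lemma quotient_map_quotient_topology: "quotient_map X (quotient_topology X q) q"
  by (auto simp: quotient_map_def openin_quotient_topology)

text \<open>A point \<open>((n, x), t)\<close> of the disjoint union lies in the copy of \<open>\<Delta>\<^sup>n\<close> that is indexed by
  the \<open>n\<close>-simplex \<open>x\<close>.\<close>

definition simplex_union :: "'x sset \<Rightarrow> ((nat \<times> 'x) \<times> (nat \<Rightarrow> real)) topology" where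
  "simplex_union X =
     sum_topology (\<lambda>(n, x). subtopology (powertop_real UNIV) (standard_simplex n))
                  {(n, x). x \<in> simplices X n}"

inductive realization_gen ::
    "'x sset \<Rightarrow> (nat \<times> 'x) \<times> (nat \<Rightarrow> real) \<Rightarrow> (nat \<times> 'x) \<times> (nat \<Rightarrow> real) \<Rightarrow> bool"
  for X where
  "ord_map m n \<theta> \<Longrightarrow> x \<in> simplices X n \<Longrightarrow> t \<in> standard_simplex m \<Longrightarrow>
     realization_gen X ((m, action X m n \<theta> x), t) ((n, x), simplex_push m \<theta> t)"

definition realization_class ::
    "'x sset \<Rightarrow> (nat \<times> 'x) \<times> (nat \<Rightarrow> real) \<Rightarrow> ((nat \<times> 'x) \<times> (nat \<Rightarrow> real)) set" where
  "realization_class X p = {q \<in> topspace (simplex_union X). equivclp (realization_gen X) p q}"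

definition geometric_realization :: "'x sset \<Rightarrow> ((nat \<times> 'x) \<times> (nat \<Rightarrow> real)) set topology" where
  "geometric_realization X = quotient_topology (simplex_union X) (realization_class X)"


section \<open>The nerve and the classifying space\<close>

text \<open>The string \<open>a\<^sub>0 \<rightarrow> \<dots> \<rightarrow> a\<^sub>n\<close> with arrows \<open>f\<^sub>1, \<dots>, f\<^sub>n\<close> is represented by \<open>(a\<^sub>0, [f\<^sub>1, \<dots>, f\<^sub>n])\<close>,
  so that the arrow from the \<open>i\<close>-th to the \<open>(i+1)\<close>-st object is the list element number \<open>i\<close>.\<close>

fun composable :: "('o, 'a) category_data \<Rightarrow> 'o \<Rightarrow> 'a list \<Rightarrow> bool" where
  "composable C a [] \<longleftrightarrow> a \<in> Ob C"
| "composable C a (f # fs) \<longleftrightarrow> a \<in> Ob C \<and> f \<in> Arr C \<and> Dom C f = a \<and> composable C (Cod C f) fs"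

fun composite :: "('o, 'a) category_data \<Rightarrow> 'o \<Rightarrow> 'a list \<Rightarrow> 'a" where
  "composite C a [] = Ident C a"
| "composite C a (f # fs) = Comp C (composite C (Cod C f) fs) f"

fun vertex :: "('o, 'a) category_data \<Rightarrow> 'o \<times> 'a list \<Rightarrow> nat \<Rightarrow> 'o" where
  "vertex C (a, fs) i = (if i = 0 then a else Cod C (fs ! (i - 1)))"

text \<open>The composite arrow from the \<open>i\<close>-th to the \<open>j\<close>-th object of a string, for \<open>i \<le> j\<close>.\<close>

definition segment :: "('o, 'a) category_data \<Rightarrow> 'o \<times> 'a list \<Rightarrow> nat \<Rightarrow> nat \<Rightarrow> 'a" where
  "segment C \<sigma> i j = composite C (vertex C \<sigma> i) (take (j - i) (drop i (snd \<sigma>)))"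

definition nerve :: "('o, 'a) category_data \<Rightarrow> ('o \<times> 'a list) sset" where
  "nerve C = \<lparr>simplices = (\<lambda>n. {(a, fs). length fs = n \<and> composable C a fs}),
              action = (\<lambda>m n \<theta> \<sigma>. (vertex C \<sigma> (\<theta> 0),
                                  map (\<lambda>i. segment C \<sigma> (\<theta> i) (\<theta> (Suc i))) [0..<m]))\<rparr>"

lemma (in category) simplicial_set_nerve: "simplicial_set (nerve C)"
proof -
  define trg where "trg a fs = (if fs = [] then a else Cod C (last fs))" for a fs
  have trg_Cons: "trg a (f # fs) = trg (Cod C f) fs" for a f fs
    by (simp add: trg_def)
  have comp_app: "composable C a (fs @ gs) \<longleftrightarrow> composable C a fs \<and> composable C (trg a fs) gs" for a fs gs
  proof (induction fs arbitrary: a)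
    case Nil
    then show ?case by (cases gs) (auto simp: trg_def)
  qed (auto simp: trg_Cons)
  have composite_Hom: "composable C a fs \<Longrightarrow> composite C a fs \<in> Hom C a (trg a fs)" for a fs
  proof (induction fs arbitrary: a)
    case Nil
    then show ?case by (simp add: trg_def Ident_in)
  next
    case (Cons f fs)
    then show ?case using Comp_in[of f a "Cod C f"] by (simp add: trg_Cons Hom_def)
  qed
  have composite_app: "composable C a (fs @ gs) \<Longrightarrow>
      composite C a (fs @ gs) = Comp C (composite C (trg a fs) gs) (composite C a fs)" for a fs gs
  proof (induction fs arbitrary: a)
    case Nil
    then show ?case using Comp_Ident composite_Hom[of a gs] by (simp add: trg_def)
  next
    case (Cons f fs)
    have f: "f \<in> Hom C a (Cod C f)" and c: "composable C (Cod C f) (fs @ gs)"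
      using Cons.prems by (auto simp: Hom_def)
    show ?case
      using Cons.IH[OF c] c Comp_assoc[OF f composite_Hom composite_Hom, of fs gs]
      by (simp add: comp_app trg_Cons)
  qed
  have trg_take: "i \<le> length fs \<Longrightarrow> trg a (take i fs) = vertex C (a, fs) i" for a fs i
    by (auto simp: trg_def last_conv_nth)
  have drop_ok: "composable C (vertex C (a, fs) i) (drop i fs)"
    if "composable C a fs" "i \<le> length fs" for a fs i
    using comp_app[of a "take i fs" "drop i fs"] that trg_take[of i fs a] by simp
  have vertex_drop: "vertex C (vertex C (a, fs) i, drop i fs) j = vertex C (a, fs) (i + j)"
    if "i + j \<le> length fs" for a fs i j
    using that by (auto simp: nth_append)
  have piece: "composable C (vertex C (a, fs) i) (take (j - i) (drop i fs)) \<and>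
       trg (vertex C (a, fs) i) (take (j - i) (drop i fs)) = vertex C (a, fs) j"
    if "composable C a fs" "i \<le> j" "j \<le> length fs" for a fs i j
  proof -
    have "composable C (vertex C (a, fs) i) (take (j - i) (drop i fs) @ drop (j - i) (drop i fs))"
      using drop_ok[of a fs i] that by (simp del: drop_drop)
    moreover have "trg (vertex C (a, fs) i) (take (j - i) (drop i fs)) = vertex C (a, fs) j"
      using trg_take[of "j - i" "drop i fs" "vertex C (a, fs) i"] vertex_drop[of i "j - i" fs a] that
      by simp
    ultimately show ?thesis using comp_app by blast
  qed
  have seg_Hom: "segment C (a, fs) i j \<in> Hom C (vertex C (a, fs) i) (vertex C (a, fs) j)"
    if "composable C a fs" "i \<le> j" "j \<le> length fs" for a fs i j
    using piece[OF that] composite_Hom unfolding segment_def snd_conv by metis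
  have seg_Comp: "Comp C (segment C (a, fs) j k) (segment C (a, fs) i j) = segment C (a, fs) i k"
    if "composable C a fs" "i \<le> j" "j \<le> k" "k \<le> length fs" for a fs i j k
  proof -
    have eq: "take (k - i) (drop i fs) = take (j - i) (drop i fs) @ take (k - j) (drop j fs)"
      using that take_add[of "j - i" "k - j" "drop i fs"] by simp
    show ?thesis
      using piece[of a fs i k] piece[of a fs i j] that
        composite_app[of "vertex C (a, fs) i" "take (j - i) (drop i fs)" "take (k - j) (drop j fs)"]
      unfolding segment_def snd_conv eq by simp
  qed
  have seg_self: "segment C (a, fs) i i = Ident C (vertex C (a, fs) i)" for a fs i
    by (simp add: segment_def)
  have vert_Ob: "vertex C (a, fs) i \<in> Ob C" if "composable C a fs" "i \<le> length fs" for a fs i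
    using drop_ok[OF that] by (cases "drop i fs") auto
  have chain: "composable C (v 0) (map h [0..<m])"
    if "\<And>i. i \<le> m \<Longrightarrow> v i \<in> Ob C" "\<And>i. i < m \<Longrightarrow> h i \<in> Hom C (v i) (v (Suc i))" for v h m
    using that
  proof (induction m arbitrary: v h)
    case 0
    then show ?case by simp
  next
    case (Suc m)
    have "composable C (v (Suc 0)) (map (h \<circ> Suc) [0..<m])"
      using Suc.IH[of "v \<circ> Suc" "h \<circ> Suc"] Suc.prems by (simp add: comp_def)
    then show ?case
      using Suc.prems(1)[of 0] Suc.prems(2)[of 0]
      by (simp add: upt_conv_Cons Hom_def map_Suc_upt[symmetric] del: upt_Suc)
  qed
  have act: "action (nerve C) m n \<theta> \<sigma> =
      (vertex C \<sigma> (\<theta> 0), map (\<lambda>i. segment C \<sigma> (\<theta> i) (\<theta> (Suc i))) [0..<m])" for m n \<theta> \<sigma>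
    by (simp add: nerve_def)
  have sim: "x \<in> simplices (nerve C) n \<longleftrightarrow> (\<exists>a fs. x = (a, fs) \<and> length fs = n \<and> composable C a fs)" for x n
    by (auto simp: nerve_def)
  have vert_act: "vertex C (action (nerve C) m n \<theta> (a, fs)) i = vertex C (a, fs) (\<theta> i)"
    if "ord_map m n \<theta>" "composable C a fs" "length fs = n" "i \<le> m" for m n \<theta> a fs i
  proof (cases i)
    case (Suc i')
    then show ?thesis
      using seg_Hom[of a fs "\<theta> i'" "\<theta> i"] that unfolding act
      by (simp add: Hom_def ord_map_def del: vertex.simps) (simp add: Hom_def)
  qed (simp add: act)
  have act_in: "action (nerve C) m n \<theta> x \<in> simplices (nerve C) m"
    if t: "ord_map m n \<theta>" and x: "x \<in> simplices (nerve C) n" for m n \<theta> x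
  proof -
    obtain a fs where x: "x = (a, fs)" "length fs = n" "composable C a fs"
      using x sim by auto
    have "composable C (vertex C (a, fs) (\<theta> 0))
        (map (\<lambda>i. segment C (a, fs) (\<theta> i) (\<theta> (Suc i))) [0..<m])"
      using t x by (intro chain[of m "\<lambda>i. vertex C (a, fs) (\<theta> i)"] vert_Ob seg_Hom)
        (auto simp: ord_map_def)
    then show ?thesis unfolding sim act x by simp
  qed
  have seg_act: "segment C (action (nerve C) m n \<theta> (a, fs)) i j = segment C (a, fs) (\<theta> i) (\<theta> j)"
    if t: "ord_map m n \<theta>" "composable C a fs" "length fs = n" and ij: "i \<le> j" "j \<le> m"
    for m n \<theta> a fs i j
    using ij
  proof (induction j rule: dec_induct)
    case base
    then show ?case using vert_act[OF t, of i]
      by (metis seg_self prod.collapse)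
  next
    case (step j)
    obtain b gs where bgs: "action (nerve C) m n \<theta> (a, fs) = (b, gs)" by fastforce
    have bgs': "length gs = m" "composable C b gs"
      using act_in[OF t(1), of "(a, fs)"] t bgs by (auto simp: sim)
    have "gs ! j = segment C (a, fs) (\<theta> j) (\<theta> (Suc j))"
      using bgs step by (auto simp: act)
    moreover have gs: "take (Suc j - j) (drop j gs) = [gs ! j]"
      using bgs' step by (simp add: take_Suc_conv_app_nth Suc_diff_le)
    moreover have "gs ! j \<in> Hom C (vertex C (b, gs) j) (Cod C (gs ! j))"
      using piece[of b gs j "Suc j"] bgs' step unfolding gs by (simp add: Hom_def del: vertex.simps)
    then have "segment C (b, gs) j (Suc j) = gs ! j"
      unfolding segment_def snd_conv gs by (simp add: Ident_Comp del: vertex.simps)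
    ultimately show ?case
      using seg_Comp[of b gs i j "Suc j"] seg_Comp[of a fs "\<theta> i" "\<theta> j" "\<theta> (Suc j)"] bgs bgs' step t
      by (simp add: ord_map_def)
  qed
  show ?thesis
  proof
    show "action (nerve C) m n \<theta> x \<in> simplices (nerve C) m"
      if "ord_map m n \<theta>" "x \<in> simplices (nerve C) n" for m n \<theta> x
      using act_in that .
    show "action (nerve C) n n id x = x" if x: "x \<in> simplices (nerve C) n" for x n
    proof -
      obtain a fs where x: "x = (a, fs)" "length fs = n" "composable C a fs"
        using x sim by auto
      have "segment C (a, fs) i (Suc i) = fs ! i" if i: "i < n" for i
      proof -
        have gs: "take (Suc i - i) (drop i fs) = [fs ! i]"
          using x i by (simp add: take_Suc_conv_app_nth Suc_diff_le)
        have "fs ! i \<in> Hom C (vertex C (a, fs) i) (Cod C (fs ! i))"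
          using piece[of a fs i "Suc i"] x i unfolding gs by (simp add: Hom_def del: vertex.simps)
        then show ?thesis
          unfolding segment_def snd_conv gs by (simp add: Ident_Comp del: vertex.simps)
      qed
      then show ?thesis using x by (auto simp: act intro!: nth_equalityI)
    qed
    show "action (nerve C) l m \<eta> (action (nerve C) m n \<theta> x) = action (nerve C) l n (\<theta> \<circ> \<eta>) x"
      if e: "ord_map l m \<eta>" and t: "ord_map m n \<theta>" and xin: "x \<in> simplices (nerve C) n" for l m n \<eta> \<theta> x
    proof -
      obtain a fs where x: "x = (a, fs)" "length fs = n" "composable C a fs"
        using xin sim by auto
      show ?thesis
        unfolding act[of l] x(1)
        using vert_act[OF t x(3,2), of "\<eta> 0"] seg_act[OF t x(3,2)] e
        by (auto simp: ord_map_def simp del: vertex.simps)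
    qed
    show "action (nerve C) m n \<theta> x = action (nerve C) m n \<theta>' x"
      if "\<And>i. i \<le> m \<Longrightarrow> \<theta> i = \<theta>' i" for m n \<theta> \<theta>' x
      using that by (simp add: act)
  qed
qed

definition classifying_space ::
    "('o, 'a) category_data \<Rightarrow> ((nat \<times> ('o \<times> 'a list)) \<times> (nat \<Rightarrow> real)) set topology" where
  "classifying_space C = geometric_realization (nerve C)"


section \<open>The Euler characteristic of a topological space\<close>

text \<open>The rank of an abelian group (written multiplicatively, as in HOL-Algebra): the maximal size
  of a \<open>\<int>\<close>-linearly independent subset.\<close>

definition int_independent :: "('g, 'b) monoid_scheme \<Rightarrow> 'g set \<Rightarrow> bool" where
  "int_independent G S \<longleftrightarrow> finite S \<and> S \<subseteq> carrier G \<and>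
     (\<forall>c :: 'g \<Rightarrow> int. (\<Otimes>\<^bsub>G\<^esub>x\<in>S. x [^]\<^bsub>G\<^esub> c x) = \<one>\<^bsub>G\<^esub> \<longrightarrow> (\<forall>x\<in>S. c x = 0))"

definition has_finite_rank :: "('g, 'b) monoid_scheme \<Rightarrow> bool" where
  "has_finite_rank G \<longleftrightarrow> bdd_above (card ` {S. int_independent G S})"

definition group_rank :: "('g, 'b) monoid_scheme \<Rightarrow> nat" where
  "group_rank G = Sup (card ` {S. int_independent G S})"

definition betti_number :: "nat \<Rightarrow> 'p topology \<Rightarrow> nat" where
  "betti_number n T = group_rank (homology_group (int n) T)"

definition has_top_euler_char :: "'p topology \<Rightarrow> bool" where
  "has_top_euler_char T \<longleftrightarrow>
     (\<forall>n. has_finite_rank (homology_group (int n) T)) \<and> finite {n. betti_number n T \<noteq> 0}"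

text \<open>The homology of \<open>T\<close> is singular homology with integer coefficients.\<close>

definition top_euler_char :: "'p topology \<Rightarrow> int" where
  "top_euler_char T = (\<Sum>n | betti_number n T \<noteq> 0. (-1) ^ n * int (betti_number n T))"

end

theory Submission
  imports Defs "HOL-Analysis.Abstract_Topological_Spaces"
begin

text \<open>
  The Euler characteristic of \<open>B\<A>\<close> is computed without choosing a cell structure, from open sets
  and the coweighting alone.

  For a nondegenerate string \<open>\<sigma>\<close> let \<open>star \<sigma>\<close> be the union of the open simplices of \<open>B\<A>\<close> that have
  \<open>\<sigma>\<close> as a face. Because endomorphisms are identities and isomorphic objects are equal, the
  objects carry a strict order in which arrows go up, a simplex has at most one arrow between two
  given objects, and \<open>star \<sigma>\<close> is open and contracts to the barycentre of \<open>\<sigma>\<close>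
  (\<open>openin_star\<close>, \<open>contractible_star\<close>).

  Adjoin the objects in increasing order, and let \<open>W\<^sub>D\<close> be the set of points with a vertex in the
  initial segment \<open>D\<close>. Let \<open>\<sigma>\<close> start at \<open>a\<close> and let \<open>b\<close> be the next object after \<open>D\<close>. If \<open>b\<close> comes
  before \<open>a\<close>, then \<open>star \<sigma> \<inter> W\<^bsub>D \<union> {b}\<^esub>\<close> is the union of \<open>star \<sigma> \<inter> W\<^sub>D\<close> and of the disjoint sets
  \<open>star (g \<sigma>)\<close> for \<open>g : b \<rightarrow> a\<close>, and \<open>star (g \<sigma>)\<close> meets \<open>star \<sigma> \<inter> W\<^sub>D\<close> in \<open>star (g \<sigma>) \<inter> W\<^sub>D\<close>.
  By additivity of \<open>\<chi>\<close> for open unions (\<open>euler_char_attach_contractible\<close>), each \<open>g\<close> contributes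
  \<open>1 - \<chi>(star (g \<sigma>) \<inter> W\<^sub>D)\<close>. Hence, for a coweighting \<open>k\<close>, induction on \<open>D\<close> gives
  \<open>\<chi>(star \<sigma> \<inter> W\<^sub>D) = (\<Sum>c\<in>D. |\<A>(c, a)| k\<^sub>c)\<close>: the coweighting equation at \<open>b\<close> says exactly that the
  contribution of one \<open>g\<close> is \<open>k\<^sub>b\<close>; and once \<open>a\<close> belongs to \<open>D\<close>, the intersection is the
  contractible \<open>star \<sigma>\<close>, while the sum is \<open>1\<close> by the coweighting equation at \<open>a\<close>. In the same way
  \<open>\<chi>(W\<^sub>D) = (\<Sum>c\<in>D. k\<^sub>c)\<close>, and the case where \<open>D\<close> contains all objects is the claim.

  Three ingredients are independent of one another: ranks of abelian groups are additive in exact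
  sequences (\<open>rank_nullity\<close>), which with the exact sequence of a pair and excision gives the
  additivity of \<open>\<chi>\<close>; points of the realization are classified by their set of arrows and their vertex
  weights (\<open>equivclp_iff_invariants\<close>), which makes it possible to define maps on \<open>B\<A>\<close> on
  representatives; and weightings and coweightings exist since the matrix of hom-set sizes is
  unitriangular (\<open>triangular_weighting_exists\<close>).
\<close>

section \<open>The rank of an abelian group\<close>

text \<open>
  Elimination over the integers, with cross-multiplication instead of division. It is what bounds the
  size of independent sets: torsion prevents an appeal to bases, so the rank theory below rests
  directly on linear systems.
\<close>
lemma integer_homogeneous_system_nontrivial_solution:
  fixes A :: "'s \<Rightarrow> 't \<Rightarrow> int"
  assumes "finite T" "finite S" "card T < card S"
  shows "\<exists>c. (\<exists>s\<in>S. c s \<noteq> 0) \<and> (\<forall>t\<in>T. (\<Sum>s\<in>S. c s * A s t) = 0)"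
  using assms
proof (induction T arbitrary: S A rule: finite_induct)
  case empty
  then obtain s where "s \<in> S" by (metis card_gt_0_iff card.empty ex_in_conv)
  then show ?case by (intro exI[of _ "\<lambda>_. 1"]) auto
next
  case (insert t T)
  show ?case
  proof (cases "\<exists>s\<in>S. A s t \<noteq> 0")
    case False
    have "card T < card S" using insert by simp
    from insert.IH[OF insert.prems(1) this, of A] False show ?thesis by fastforce
  next
    case True
    then obtain s0 where s0: "s0 \<in> S" "A s0 t \<noteq> 0" by blast
    define S' where "S' = S - {s0}"
    have S': "finite S'" "card T < card S'" "s0 \<notin> S'" "S = insert s0 S'"
      using insert s0 by (auto simp: S'_def)
    obtain c where c: "\<exists>s\<in>S'. c s \<noteq> 0"
      "\<And>u. u \<in> T \<Longrightarrow> (\<Sum>s\<in>S'. c s * (A s0 t * A s u - A s t * A s0 u)) = 0"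
      using insert.IH[OF S'(1,2), of "\<lambda>s u. A s0 t * A s u - A s t * A s0 u"] by blast
    \<comment> \<open>The coefficient of \<open>s0\<close> is chosen so that the equation for \<open>t\<close> holds; the factor \<open>A s0 t\<close>
      avoids the division.\<close>
    define d where "d s = (if s = s0 then - (\<Sum>s\<in>S'. c s * A s t) else A s0 t * c s)" for s
    have sumd: "(\<Sum>s\<in>S. d s * A s u) =
        A s0 t * (\<Sum>s\<in>S'. c s * A s u) - (\<Sum>s\<in>S'. c s * A s t) * A s0 u" for u
    proof -
      have "(\<Sum>s\<in>S'. d s * A s u) = A s0 t * (\<Sum>s\<in>S'. c s * A s u)"
        using S'(3) by (auto simp: d_def sum_distrib_left mult_ac intro!: sum.cong)
      then show ?thesis using S' by (simp add: d_def)
    qed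
    have "(\<Sum>s\<in>S. d s * A s u) = 0" if "u \<in> insert t T" for u
    proof (cases "u = t")
      case False
      then have "(\<Sum>s\<in>S'. c s * (A s0 t * A s u - A s t * A s0 u)) = 0" using c that by auto
      then show ?thesis unfolding sumd
        by (simp add: right_diff_distrib sum_subtractf sum_distrib_left sum_distrib_right mult_ac)
    qed (simp add: sumd mult_ac)
    moreover have "\<exists>s\<in>S. d s \<noteq> 0"
      using c(1) s0 S' by (auto simp: d_def)
    ultimately show ?thesis by blast
  qed
qed

definition int_comb :: "('g, 'b) monoid_scheme \<Rightarrow> 'g set \<Rightarrow> ('g \<Rightarrow> int) \<Rightarrow> 'g" where
  "int_comb G S c = (\<Otimes>\<^bsub>G\<^esub>x\<in>S. x [^]\<^bsub>G\<^esub> c x)"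

context comm_group
begin

lemma int_comb_closed: "S \<subseteq> carrier G \<Longrightarrow> int_comb G S c \<in> carrier G"
  unfolding int_comb_def by (rule finprod_closed) (auto simp: Pi_def)

lemma int_comb_insert:
  "finite S \<Longrightarrow> x \<notin> S \<Longrightarrow> insert x S \<subseteq> carrier G \<Longrightarrow>
    int_comb G (insert x S) c = x [^] c x \<otimes> int_comb G S c"
  unfolding int_comb_def by (rule finprod_insert) auto

lemma int_comb_cong: "S \<subseteq> carrier G \<Longrightarrow> (\<And>x. x \<in> S \<Longrightarrow> c x = d x) \<Longrightarrow> int_comb G S c = int_comb G S d"
  unfolding int_comb_def by (rule finprod_cong') (auto simp: Pi_def)

lemma int_comb_add:
  "S \<subseteq> carrier G \<Longrightarrow> int_comb G S (\<lambda>x. c x + d x) = int_comb G S c \<otimes> int_comb G S d"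
  unfolding int_comb_def
  by (subst finprod_multf[symmetric]) (auto simp: Pi_def int_pow_mult intro!: finprod_cong')

lemma int_comb_scale:
  "finite S \<Longrightarrow> S \<subseteq> carrier G \<Longrightarrow> int_comb G S (\<lambda>x. m * c x) = int_comb G S c [^] m"
proof (induction S rule: finite_induct)
  case (insert x S)
  have cl: "(\<lambda>x. x [^] c x) \<in> S \<rightarrow> carrier G" "x [^] c x \<in> carrier G"
    "(\<lambda>x. x [^] (m * c x)) \<in> S \<rightarrow> carrier G" "x [^] (m * c x) \<in> carrier G"
    using insert by auto
  have "finprod G (\<lambda>x. x [^] c x) S \<in> carrier G" using cl by simp
  then show ?case
    using insert cl
    by (simp add: int_comb_def int_pow_distrib int_pow_pow mult.commute)
qed (simp add: int_comb_def)

lemma int_comb_uminus: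
  "finite S \<Longrightarrow> S \<subseteq> carrier G \<Longrightarrow> int_comb G S (\<lambda>x. - c x) = inv (int_comb G S c)"
  using int_comb_scale[of S "-1" c] int_comb_closed[of S c] by (simp add: int_pow_neg)

lemma int_comb_extend:
  assumes "finite T" "T \<subseteq> carrier G" "S \<subseteq> T"
  shows "int_comb G S c = int_comb G T (\<lambda>x. if x \<in> S then c x else 0)"
  unfolding int_comb_def
  by (rule finprod_mono_neutral_cong_left) (use assms in \<open>auto simp: Pi_def\<close>)

lemma int_comb_single:
  assumes "finite T" "T \<subseteq> carrier G" "g \<in> T"
  shows "int_comb G T (\<lambda>x. if x = g then m else 0) = g [^] m"
  using int_comb_extend[OF assms(1,2), of "{g}" "\<lambda>_. m"] assms by (auto simp: int_comb_def)

lemma int_comb_substitute: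
  assumes "finite S" "finite T" "S \<subseteq> carrier G" "T \<subseteq> carrier G"
    and "\<And>s. s \<in> S \<Longrightarrow> s [^] m s = int_comb G T (A s)"
  shows "int_comb G S (\<lambda>s. m s * c s) = int_comb G T (\<lambda>t. \<Sum>s\<in>S. c s * A s t)"
  using assms(1,3,5)
proof (induction S rule: finite_induct)
  case empty
  then show ?case by (simp add: int_comb_def)
next
  case (insert x S)
  have "x [^] (m x * c x) = int_comb G T (\<lambda>t. c x * A x t)"
  proof -
    have "x [^] (m x * c x) = int_comb G T (A x) [^] c x"
      using insert.prems by (metis insertI1 insert_subset int_pow_pow)
    then show ?thesis using assms by (simp add: int_comb_scale)
  qed
  then show ?case
    using insert assms by (simp add: int_comb_insert int_comb_add)
qed

lemma int_independent_comb:
  "int_independent G S \<longleftrightarrow> finite S \<and> S \<subseteq> carrier G \<and>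
     (\<forall>c. int_comb G S c = \<one> \<longrightarrow> (\<forall>x\<in>S. c x = 0))"
  by (simp add: int_independent_def int_comb_def)

text \<open>
  Some nonzero multiple of \<open>g\<close> lies in the subgroup that \<open>T\<close> generates; equivalently, \<open>g\<close> lies in the
  span of \<open>T\<close> after tensoring with the rationals.
\<close>
definition int_dependent_on :: "'a set \<Rightarrow> 'a \<Rightarrow> bool" where
  "int_dependent_on T g \<longleftrightarrow> (\<exists>m c. m \<noteq> 0 \<and> g [^] (m::int) = int_comb G T c)"

text \<open>
  Steinitz exchange in rational form: if \<open>S\<close> were larger than \<open>T\<close>, then the relations that express
  multiples of the elements of \<open>S\<close> through \<open>T\<close> would admit a nontrivial combination that vanishes on
  every element of \<open>T\<close>, hence a nontrivial relation in \<open>S\<close>.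
\<close>
lemma card_independent_le_spanning:
  assumes S: "int_independent G S" and T: "finite T" "T \<subseteq> carrier G"
    and dep: "\<And>s. s \<in> S \<Longrightarrow> int_dependent_on T s"
  shows "card S \<le> card T"
proof (rule ccontr)
  assume "\<not> card S \<le> card T"
  have fS: "finite S" "S \<subseteq> carrier G" using S by (auto simp: int_independent_comb)
  obtain m A where mA: "\<And>s. s \<in> S \<Longrightarrow> m s \<noteq> 0" "\<And>s. s \<in> S \<Longrightarrow> s [^] (m s :: int) = int_comb G T (A s)"
    using dep unfolding int_dependent_on_def by metis
  obtain c where c: "\<exists>s\<in>S. c s \<noteq> 0" "\<And>t. t \<in> T \<Longrightarrow> (\<Sum>s\<in>S. c s * A s t) = 0"
    using integer_homogeneous_system_nontrivial_solution[OF T(1) fS(1), of A]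
      \<open>\<not> card S \<le> card T\<close> by auto
  have "int_comb G S (\<lambda>s. m s * c s) = int_comb G T (\<lambda>t. 0)"
    using int_comb_substitute[OF fS(1) T(1) fS(2) T(2) mA(2)] int_comb_cong[OF T(2) c(2)] by simp
  also have "\<dots> = \<one>" by (simp add: int_comb_def)
  finally have "\<forall>s\<in>S. m s * c s = 0"
    using S unfolding int_independent_comb by (elim conjE allE[of _ "\<lambda>s. m s * c s"]) simp
  then show False using c(1) mA(1) by auto
qed

text \<open>
  Ranks of subsets serve for kernels and images. Independence only refers to the operations of the
  ambient group, so exactness can be used as an equality of subsets, without passing to subgroup
  records.
\<close>
definition finite_subset_rank :: "'a set \<Rightarrow> bool" where
  "finite_subset_rank A \<longleftrightarrow> bdd_above (card ` {S. int_independent G S \<and> S \<subseteq> A})"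

definition subset_rank :: "'a set \<Rightarrow> nat" where
  "subset_rank A = Sup (card ` {S. int_independent G S \<and> S \<subseteq> A})"

lemma has_finite_rank_subset: "has_finite_rank G \<longleftrightarrow> finite_subset_rank (carrier G)"
proof -
  have "{S. int_independent G S} = {S. int_independent G S \<and> S \<subseteq> carrier G}"
    by (auto simp: int_independent_def)
  then show ?thesis by (simp add: has_finite_rank_def finite_subset_rank_def)
qed

lemma group_rank_subset: "group_rank G = subset_rank (carrier G)"
proof -
  have "{S. int_independent G S} = {S. int_independent G S \<and> S \<subseteq> carrier G}"
    by (auto simp: int_independent_def)
  then show ?thesis by (simp add: group_rank_def subset_rank_def)
qed

lemma int_independent_empty: "int_independent G {}"
  by (simp add: int_independent_def)

lemma card_le_subset_rank:
  assumes "finite_subset_rank A" "int_independent G S" "S \<subseteq> A"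
  shows "card S \<le> subset_rank A"
  using assms unfolding finite_subset_rank_def subset_rank_def by (intro cSup_upper) auto

lemma subset_rank_leI:
  assumes "\<And>S. int_independent G S \<Longrightarrow> S \<subseteq> A \<Longrightarrow> card S \<le> n"
  shows "finite_subset_rank A" "subset_rank A \<le> n"
  using assms int_independent_empty unfolding finite_subset_rank_def subset_rank_def
  by (auto intro!: bdd_aboveI[of _ n] cSup_least)

text \<open>
  An independent set of maximal size cannot be enlarged, and the relation that obstructs adding \<open>g\<close>
  must involve \<open>g\<close>.
\<close>
lemma maximal_independent_subset:
  assumes A: "finite_subset_rank A" "A \<subseteq> carrier G"
  obtains S where "int_independent G S" "S \<subseteq> A" "card S = subset_rank A"
    "\<And>g. g \<in> A \<Longrightarrow> int_dependent_on S g"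
proof -
  let ?K = "card ` {S. int_independent G S \<and> S \<subseteq> A}"
  have "finite ?K" "?K \<noteq> {}"
    using A int_independent_empty by (auto simp: finite_subset_rank_def bdd_above_nat)
  then have "Sup ?K \<in> ?K"
    using Max_in[of ?K] unfolding Sup_nat_def by presburger
  then obtain S where S: "int_independent G S" "S \<subseteq> A" "card S = subset_rank A"
    by (auto simp: subset_rank_def)
  have fS: "finite S" "S \<subseteq> carrier G" using S by (auto simp: int_independent_comb)
  have "int_dependent_on S g" if g: "g \<in> A" for g
  proof (cases "g \<in> S")
    case True
    then have "g [^] (1::int) = int_comb G S (\<lambda>x. if x = g then 1 else 0)"
      using int_comb_single[OF fS] by simp
    then show ?thesis unfolding int_dependent_on_def by (metis zero_neq_one)
  next
    case False
    have gc: "g \<in> carrier G" using g A by auto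
    have "\<not> int_independent G (insert g S)"
      using card_le_subset_rank[OF A(1), of "insert g S"] S g fS False by auto
    then obtain c where c: "int_comb G (insert g S) c = \<one>" "\<exists>x\<in>insert g S. c x \<noteq> 0"
      using fS gc by (auto simp: int_independent_comb)
    have "int_comb G (insert g S) c = g [^] c g \<otimes> int_comb G S c"
      using False fS gc by (intro int_comb_insert) auto
    then have eq: "g [^] c g \<otimes> int_comb G S c = \<one>" using c by simp
    have "c g \<noteq> 0"
    proof
      assume "c g = 0"
      then have "int_comb G S c = \<one>" using eq int_comb_closed[OF fS(2)] by simp
      then show False using S c(2) \<open>c g = 0\<close> by (auto simp: int_independent_comb)
    qed
    moreover have "g [^] c g = int_comb G S (\<lambda>x. - c x)"
      using eq int_comb_uminus[OF fS] int_comb_closed[OF fS(2), of c] gc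
      by (metis int_pow_closed inv_equality inv_inv)
    ultimately show ?thesis unfolding int_dependent_on_def by blast
  qed
  with S show ?thesis using that by blast
qed

end
context
  fixes G :: "('g, 'b) monoid_scheme" and H :: "('h, 'c) monoid_scheme" and f :: "'g \<Rightarrow> 'h"
  assumes G: "comm_group G" and H: "comm_group H" and f: "f \<in> hom G H"
begin

interpretation G: comm_group G by (rule G)
interpretation H: comm_group H by (rule H)
interpretation f: group_hom G H f
  using f G.is_group H.is_group by (simp add: group_hom_def group_hom_axioms_def)

lemma hom_int_comb:
  "finite S \<Longrightarrow> S \<subseteq> carrier G \<Longrightarrow> f (int_comb G S c) = (\<Otimes>\<^bsub>H\<^esub>x\<in>S. f x [^]\<^bsub>H\<^esub> c x)"
proof (induction S rule: finite_induct)
  case (insert x S)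
  have 1: "int_comb G (insert x S) c = x [^]\<^bsub>G\<^esub> c x \<otimes>\<^bsub>G\<^esub> int_comb G S c"
    using insert by (intro G.int_comb_insert) auto
  have "(\<Otimes>\<^bsub>H\<^esub>x\<in>insert x S. f x [^]\<^bsub>H\<^esub> c x) = f x [^]\<^bsub>H\<^esub> c x \<otimes>\<^bsub>H\<^esub> (\<Otimes>\<^bsub>H\<^esub>x\<in>S. f x [^]\<^bsub>H\<^esub> c x)"
    using insert by (intro H.finprod_insert) (auto simp: Pi_def)
  then show ?case
    using insert G.int_comb_closed[of S c] by (simp add: 1 f.hom_int_pow)
qed (simp add: int_comb_def)

lemma int_comb_hom_image:
  assumes "finite S" "S \<subseteq> carrier G" "inj_on f S"
  shows "int_comb H (f ` S) c = f (int_comb G S (c \<circ> f))"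
proof -
  have "int_comb H (f ` S) c = (\<Otimes>\<^bsub>H\<^esub>x\<in>S. f x [^]\<^bsub>H\<^esub> c (f x))"
    unfolding int_comb_def by (rule H.finprod_reindex) (use assms in \<open>auto simp: Pi_def\<close>)
  then show ?thesis using hom_int_comb[OF assms(1,2)] by simp
qed

lemma kernel_subset: "kernel G H f \<subseteq> carrier G"
  by (auto simp: kernel_def)

lemma image_subset: "f ` carrier G \<subseteq> carrier H"
  by auto

lemma lift_of_independent:
  assumes "int_independent H S" "S \<subseteq> f ` carrier G"
  obtains L where "L \<subseteq> carrier G" "finite L" "inj_on f L" "f ` L = S" "card L = card S"
proof -
  obtain L where "L \<subseteq> carrier G" "inj_on f L" "f ` L = S"
    using assms(2) subset_image_inj by metis
  moreover from this have "finite L" "card L = card S"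
    using assms(1) by (auto simp: int_independent_def finite_image_iff card_image)
  ultimately show ?thesis using that by blast
qed

text \<open>
  Applying \<open>f\<close> to a relation kills the part in the kernel, so the coefficients on the lifts vanish
  first; what remains is a relation in \<open>K\<close>.
\<close>
lemma independent_Un_lift:
  assumes K: "int_independent G K" "K \<subseteq> kernel G H f"
    and S: "int_independent H (f ` L)" and L: "L \<subseteq> carrier G" "finite L" "inj_on f L"
  shows "int_independent G (K \<union> L)" "K \<inter> L = {}"
proof -
  have fK: "finite K" "K \<subseteq> carrier G" using K by (auto simp: int_independent_def)
  show disj: "K \<inter> L = {}"
  proof (rule ccontr)
    assume "K \<inter> L \<noteq> {}"
    then obtain x where x: "x \<in> K" "x \<in> L" by blast
    have "int_comb H (f ` L) (\<lambda>y. if y = f x then 1 else 0) = f x [^]\<^bsub>H\<^esub> (1::int)"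
      using L x by (intro H.int_comb_single) auto
    also have "\<dots> = \<one>\<^bsub>H\<^esub>" using x K by (auto simp: kernel_def)
    finally have "\<forall>y\<in>f ` L. (if y = f x then 1 else 0) = (0::int)"
      using S unfolding H.int_independent_comb by blast
    with x show False by auto
  qed
  show "int_independent G (K \<union> L)"
    unfolding G.int_independent_comb
  proof (intro conjI allI impI)
    fix c assume c: "int_comb G (K \<union> L) c = \<one>\<^bsub>G\<^esub>"
    have KL: "int_comb G (K \<union> L) c = int_comb G K c \<otimes>\<^bsub>G\<^esub> int_comb G L c"
      unfolding int_comb_def
      by (rule G.finprod_Un_disjoint) (use fK L disj in \<open>auto simp: Pi_def\<close>)
    have clK: "int_comb G K c \<in> carrier G" and clL: "int_comb G L c \<in> carrier G"
      using G.int_comb_closed fK L by auto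
    have "f (int_comb G K c) = \<one>\<^bsub>H\<^esub>"
      unfolding hom_int_comb[OF fK]
      by (rule H.finprod_one_eqI) (use K in \<open>auto simp: kernel_def\<close>)
    then have "f (int_comb G L c) = \<one>\<^bsub>H\<^esub>"
      using c KL clK clL f.hom_mult[OF clK clL] f.hom_one by simp
    moreover have "int_comb H (f ` L) (c \<circ> the_inv_into L f) = f (int_comb G L c)"
      using L by (subst int_comb_hom_image) (auto simp: the_inv_into_f_f intro!: arg_cong[of _ _ f] G.int_comb_cong)
    ultimately have "\<forall>y\<in>f ` L. (c \<circ> the_inv_into L f) y = 0"
      using S unfolding H.int_independent_comb by metis
    then have cL: "\<forall>x\<in>L. c x = 0" using L by (simp add: the_inv_into_f_f)
    then have "int_comb G L c = int_comb G L (\<lambda>_. 0)" using L by (intro G.int_comb_cong) auto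
    then have "int_comb G K c = \<one>\<^bsub>G\<^esub>" using c KL clK by (simp add: int_comb_def)
    then have "\<forall>x\<in>K. c x = 0" using K unfolding G.int_independent_comb by blast
    with cL show "\<forall>x\<in>K \<union> L. c x = 0" by blast
  qed (use fK L in auto)
qed

lemma finite_rank_kernel_image:
  assumes "has_finite_rank G"
  shows "G.finite_subset_rank (kernel G H f)" "H.finite_subset_rank (f ` carrier G)"
proof -
  have fin: "G.finite_subset_rank (carrier G)" using assms G.has_finite_rank_subset by simp
  show "G.finite_subset_rank (kernel G H f)"
    using fin kernel_subset G.card_le_subset_rank[OF fin] by (meson G.subset_rank_leI(1) subset_trans)
  show "H.finite_subset_rank (f ` carrier G)"
  proof (rule H.subset_rank_leI(1))
    fix S assume S: "int_independent H S" "S \<subseteq> f ` carrier G"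
    then obtain L where L: "L \<subseteq> carrier G" "finite L" "inj_on f L" "f ` L = S" "card L = card S"
      using lift_of_independent by blast
    then show "card S \<le> G.subset_rank (carrier G)"
      using independent_Un_lift(1)[OF G.int_independent_empty _ _ L(1-3)] S
        G.card_le_subset_rank[OF fin, of L] by simp
  qed
qed

text \<open>
  A multiple of \<open>f g\<close> is a combination of the images of \<open>L\<close>; subtracting the corresponding combination
  of \<open>L\<close> from that multiple of \<open>g\<close> leaves an element of the kernel.
\<close>
lemma dependent_on_kernel_and_lift:
  assumes K: "finite K" "K \<subseteq> carrier G" and L: "L \<subseteq> carrier G" "finite L" "inj_on f L"
    and disj: "K \<inter> L = {}"
    and depK: "\<And>g. g \<in> kernel G H f \<Longrightarrow> G.int_dependent_on K g"
    and depL: "H.int_dependent_on (f ` L) (f g)" and g: "g \<in> carrier G"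
  shows "G.int_dependent_on (K \<union> L) g"
proof -
  obtain m c where m: "m \<noteq> 0" "f g [^]\<^bsub>H\<^esub> (m::int) = int_comb H (f ` L) c"
    using depL unfolding H.int_dependent_on_def by blast
  define l where "l = int_comb G L (c \<circ> f)"
  have l: "l \<in> carrier G" using L G.int_comb_closed by (simp add: l_def)
  have "f (g [^]\<^bsub>G\<^esub> m) = f l"
    using m g int_comb_hom_image[OF L(2,1,3), of c] by (simp add: f.hom_int_pow l_def)
  then have "g [^]\<^bsub>G\<^esub> m \<otimes>\<^bsub>G\<^esub> inv\<^bsub>G\<^esub> l \<in> kernel G H f"
    using g l by (simp add: kernel_def)
  then obtain n d where n: "n \<noteq> 0"
      "(g [^]\<^bsub>G\<^esub> m \<otimes>\<^bsub>G\<^esub> inv\<^bsub>G\<^esub> l) [^]\<^bsub>G\<^esub> (n::int) = int_comb G K d"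
    using depK unfolding G.int_dependent_on_def by blast
  have "g [^]\<^bsub>G\<^esub> (m * n) = int_comb G K d \<otimes>\<^bsub>G\<^esub> int_comb G L (\<lambda>x. n * c (f x))"
  proof -
    have "int_comb G L (\<lambda>x. n * c (f x)) = l [^]\<^bsub>G\<^esub> n"
      using G.int_comb_scale[OF L(2,1)] by (simp add: l_def comp_def)
    moreover have "(g [^]\<^bsub>G\<^esub> m \<otimes>\<^bsub>G\<^esub> inv\<^bsub>G\<^esub> l) [^]\<^bsub>G\<^esub> n \<otimes>\<^bsub>G\<^esub> l [^]\<^bsub>G\<^esub> n
        = (g [^]\<^bsub>G\<^esub> m) [^]\<^bsub>G\<^esub> n"
      using g l by (simp add: G.int_pow_distrib[symmetric] G.m_assoc)
    ultimately show ?thesis using n g by (simp add: G.int_pow_pow)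
  qed
  also have "\<dots> = int_comb G (K \<union> L) (\<lambda>x. if x \<in> K then d x else n * c (f x))"
  proof -
    have "int_comb G (K \<union> L) (\<lambda>x. if x \<in> K then d x else n * c (f x)) =
        int_comb G K (\<lambda>x. if x \<in> K then d x else n * c (f x)) \<otimes>\<^bsub>G\<^esub>
        int_comb G L (\<lambda>x. if x \<in> K then d x else n * c (f x))"
      unfolding int_comb_def
      by (rule G.finprod_Un_disjoint) (use K L disj in \<open>auto simp: Pi_def\<close>)
    moreover have "int_comb G L (\<lambda>x. if x \<in> K then d x else n * c (f x)) = int_comb G L (\<lambda>x. n * c (f x))"
      using L disj by (intro G.int_comb_cong) auto
    moreover have "int_comb G K (\<lambda>x. if x \<in> K then d x else n * c (f x)) = int_comb G K d"
      using K by (intro G.int_comb_cong) auto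
    ultimately show ?thesis by simp
  qed
  finally show ?thesis unfolding G.int_dependent_on_def using m n by (metis mult_eq_0_iff)
qed

text \<open>
  A maximal independent set of the kernel together with lifts of one of the image is independent, and
  every element depends on it.
\<close>
theorem rank_nullity:
  assumes "G.finite_subset_rank (kernel G H f)" "H.finite_subset_rank (f ` carrier G)"
  shows "has_finite_rank G"
    and "group_rank G = G.subset_rank (kernel G H f) + H.subset_rank (f ` carrier G)"
proof -
  obtain K where K: "int_independent G K" "K \<subseteq> kernel G H f" "card K = G.subset_rank (kernel G H f)"
      "\<And>g. g \<in> kernel G H f \<Longrightarrow> G.int_dependent_on K g"
    using G.maximal_independent_subset[OF assms(1) kernel_subset] by blast
  obtain S where S: "int_independent H S" "S \<subseteq> f ` carrier G" "card S = H.subset_rank (f ` carrier G)"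
      "\<And>g. g \<in> f ` carrier G \<Longrightarrow> H.int_dependent_on S g"
    using H.maximal_independent_subset[OF assms(2) image_subset] by blast
  obtain L where L: "L \<subseteq> carrier G" "finite L" "inj_on f L" "f ` L = S" "card L = card S"
    using lift_of_independent[OF S(1,2)] by blast
  have fK: "finite K" "K \<subseteq> carrier G" using K(1) by (auto simp: int_independent_def)
  have ind: "int_independent G (K \<union> L)" and disj: "K \<inter> L = {}"
    using independent_Un_lift[OF K(1,2) _ L(1-3)] S(1) L(4) by auto
  have card: "card (K \<union> L) = G.subset_rank (kernel G H f) + H.subset_rank (f ` carrier G)"
    using card_Un_disjoint[OF fK(1) L(2) disj] K L S by simp
  have dep: "G.int_dependent_on (K \<union> L) g" if "g \<in> carrier G" for g
    using dependent_on_kernel_and_lift[OF fK L(1-3) disj K(4)] S(4) L(4) that by blast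
  have le: "card T \<le> card (K \<union> L)" if "int_independent G T" "T \<subseteq> carrier G" for T
    using G.card_independent_le_spanning[OF that(1), of "K \<union> L"] fK L dep that by auto
  show fin: "has_finite_rank G"
    unfolding G.has_finite_rank_subset by (rule G.subset_rank_leI(1)[OF le])
  have "group_rank G \<le> card (K \<union> L)"
    unfolding G.group_rank_subset by (rule G.subset_rank_leI(2)[OF le])
  moreover have "card (K \<union> L) \<le> group_rank G"
    using G.card_le_subset_rank[OF _ ind] fin fK L
    unfolding G.group_rank_subset G.has_finite_rank_subset by auto
  ultimately show "group_rank G = G.subset_rank (kernel G H f) + H.subset_rank (f ` carrier G)"
    using card by simp
qed

end

section \<open>Additivity of the Euler characteristic of spaces\<close>

lemma subset_rank_one:
  assumes "comm_group G"
  shows "comm_group.finite_subset_rank G {\<one>\<^bsub>G\<^esub>}" "comm_group.subset_rank G {\<one>\<^bsub>G\<^esub>} = 0"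
proof -
  interpret comm_group G by (rule assms)
  have "card S \<le> 0" if S: "int_independent G S" "S \<subseteq> {\<one>\<^bsub>G\<^esub>}" for S
  proof -
    have "int_comb G S (\<lambda>_. 1) = \<one>\<^bsub>G\<^esub>"
      unfolding int_comb_def by (rule finprod_one_eqI) (use S in auto)
    then show ?thesis using S unfolding int_independent_comb by (metis all_not_in_conv card.empty le_refl zero_neq_one)
  qed
  from subset_rank_leI[OF this]
  show "finite_subset_rank {\<one>\<^bsub>G\<^esub>}" "subset_rank {\<one>\<^bsub>G\<^esub>} = 0" by auto
qed

lemma rank_exact:
  assumes K: "comm_group K" and H: "comm_group H" and G: "comm_group G"
    and f: "f \<in> hom K H" and g: "g \<in> hom H G" and ex: "f ` carrier K = kernel H G g"
  shows "has_finite_rank H \<longleftrightarrow>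
      comm_group.finite_subset_rank H (f ` carrier K) \<and> comm_group.finite_subset_rank G (g ` carrier H)"
    and "has_finite_rank H \<Longrightarrow>
      group_rank H = comm_group.subset_rank H (f ` carrier K) + comm_group.subset_rank G (g ` carrier H)"
  unfolding ex
  using finite_rank_kernel_image[OF H G g] rank_nullity[OF H G g] by blast+

lemma rank_trivial:
  assumes "trivial_group G"
  shows "has_finite_rank G" "group_rank G = 0"
proof -
  interpret comm_group G
    using assms by (auto simp: trivial_group_def intro!: group.group_comm_groupI)
  have "carrier G = {\<one>\<^bsub>G\<^esub>}" using assms by (simp add: trivial_group_def)
  then show "has_finite_rank G" "group_rank G = 0"
    using subset_rank_one[OF comm_group_axioms] has_finite_rank_subset group_rank_subset by auto
qed

lemma rank_isomorphic:
  assumes G: "comm_group G" and H: "comm_group H" and iso: "G \<cong> H" and fin: "has_finite_rank G"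
  shows "has_finite_rank H" "group_rank H = group_rank G"
proof -
  interpret H: comm_group H by (rule H)
  obtain h where h: "h \<in> iso G H" using iso by (auto simp: is_iso_def)
  have hom: "h \<in> hom G H" and im: "h ` carrier G = carrier H" and inj: "inj_on h (carrier G)"
    using h by (auto simp: iso_def bij_betw_def)
  interpret h: group_hom G H h
    using G H hom by (simp add: comm_group_def group_hom_def group_hom_axioms_def)
  have "kernel G H h = {\<one>\<^bsub>G\<^esub>}" using inj h.inj_iff_trivial_ker by blast
  with rank_nullity[OF G H hom] finite_rank_kernel_image[OF G H hom fin] subset_rank_one[OF G]
  show "has_finite_rank H" "group_rank H = group_rank G"
    using im by (auto simp: H.has_finite_rank_subset H.group_rank_subset)
qed

lemma rank_integer_group: "has_finite_rank integer_group" "group_rank integer_group = 1"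
proof -
  interpret comm_group integer_group by (rule abelian_integer_group)
  have comb: "int_comb integer_group {1} c = c 1" for c
    using int_comb_single[of "{1}" 1 "c 1"] int_comb_cong[of "{1}" c "\<lambda>x. if x = 1 then c 1 else 0"] by simp
  have ind: "int_independent integer_group {1}"
    by (auto simp: int_independent_comb comb)
  have le: "card S \<le> card {1::int}" if "int_independent integer_group S" for S
  proof (rule card_independent_le_spanning[OF that])
    show "int_dependent_on {1} s" for s
      unfolding int_dependent_on_def comb by (intro exI[of _ 1] exI[of _ "\<lambda>_. s"]) simp
  qed auto
  show fin: "has_finite_rank integer_group"
    unfolding has_finite_rank_subset by (rule subset_rank_leI(1)[OF le])
  have "group_rank integer_group \<le> card {1::int}"
    unfolding group_rank_subset by (rule subset_rank_leI(2)[OF le])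
  moreover have "card {1::int} \<le> group_rank integer_group"
    using card_le_subset_rank[OF _ ind] fin unfolding group_rank_subset has_finite_rank_subset by simp
  ultimately show "group_rank integer_group = 1" by simp
qed

definition alternating_sum :: "(nat \<Rightarrow> nat) \<Rightarrow> int" where
  "alternating_sum b = (\<Sum>n | b n \<noteq> 0. (-1) ^ n * int (b n))"

lemma alternating_sum_bounded:
  assumes "{n. b n \<noteq> 0} \<subseteq> {..<N}"
  shows "alternating_sum b = (\<Sum>n<N. (-1) ^ n * int (b n))"
  unfolding alternating_sum_def using assms by (intro sum.mono_neutral_left) auto

lemma alternating_sum_telescope:
  fixes x :: "nat \<Rightarrow> int"
  shows "(\<Sum>n<N. (-1) ^ n * (x (Suc n) + x n)) = x 0 - (-1) ^ N * x N"
  by (induction N) (auto simp: algebra_simps)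

text \<open>
  The numerical content of a long exact sequence: \<open>u\<close>, \<open>v\<close> and \<open>w\<close> are the ranks of the images of
  its three kinds of maps. In the alternating sum, \<open>u\<close> and \<open>v\<close> cancel and \<open>w\<close> telescopes.
\<close>
lemma alternating_sum_exact:
  fixes a b c u v w :: "nat \<Rightarrow> nat"
  assumes a: "\<And>n. a n = w (Suc n) + u n" and b: "\<And>n. b n = u n + v n"
    and c: "\<And>n. c n = v n + w n" and w0: "w 0 = 0"
    and fa: "finite {n. a n \<noteq> 0}" and fc: "finite {n. c n \<noteq> 0}"
  shows "alternating_sum b = alternating_sum a + alternating_sum c"
proof -
  have "finite ({n. a n \<noteq> 0} \<union> {n. c n \<noteq> 0})" using fa fc by simp
  then obtain N where N: "{n. a n \<noteq> 0} \<union> {n. c n \<noteq> 0} \<subseteq> {..<N}"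
    by (metis finite_nat_iff_bounded)
  have Nb: "{n. b n \<noteq> 0} \<subseteq> {..<N}" using N a b c by auto
  have "c N = 0" using N by auto
  then have "w N = 0" using c by auto
  have "(\<Sum>n<N. (-1) ^ n * int (a n)) + (\<Sum>n<N. (-1) ^ n * int (c n)) - (\<Sum>n<N. (-1) ^ n * int (b n))
      = (\<Sum>n<N. (-1) ^ n * (int (w (Suc n)) + int (w n)))"
    by (simp add: a b c sum.distrib distrib_left)
  also have "\<dots> = 0"
    using alternating_sum_telescope[of "\<lambda>n. int (w n)" N] w0 \<open>w N = 0\<close> by simp
  finally show ?thesis
    using alternating_sum_bounded[of a N] alternating_sum_bounded[of b N]
      alternating_sum_bounded[of c N] N Nb by auto
qed

definition rel_betti :: "'p topology \<Rightarrow> 'p set \<Rightarrow> nat \<Rightarrow> nat" where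
  "rel_betti X S n = group_rank (relative_homology_group (int n) X S)"

definition rel_has_euler_char :: "'p topology \<Rightarrow> 'p set \<Rightarrow> bool" where
  "rel_has_euler_char X S \<longleftrightarrow>
     (\<forall>n. has_finite_rank (relative_homology_group (int n) X S)) \<and> finite {n. rel_betti X S n \<noteq> 0}"

definition rel_euler_char :: "'p topology \<Rightarrow> 'p set \<Rightarrow> int" where
  "rel_euler_char X S = alternating_sum (rel_betti X S)"

lemma betti_number_rel: "betti_number n X = rel_betti X {} n"
  by (simp add: betti_number_def rel_betti_def)

lemma has_top_euler_char_rel: "has_top_euler_char X \<longleftrightarrow> rel_has_euler_char X {}"
  by (simp add: has_top_euler_char_def rel_has_euler_char_def betti_number_rel)

lemma top_euler_char_rel: "top_euler_char X = rel_euler_char X {}"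
  by (simp add: top_euler_char_def rel_euler_char_def betti_number_rel alternating_sum_def)

text \<open>
  The long exact sequence of \<open>(X, S)\<close>, reduced to the ranks of the images of its maps: \<open>u\<close> for the
  inclusion of \<open>S\<close>, \<open>v\<close> for the passage to relative homology and \<open>w\<close> for the boundary map. The
  predicates record finiteness of these ranks, so that one statement serves both deductions below:
  from the subspace and the pair to the space, and from the subspace and the space to the pair.
\<close>
lemma pair_rank_decomposition:
  fixes X :: "'p topology"
  obtains u v w :: "nat \<Rightarrow> nat" and fu fv fw :: "nat \<Rightarrow> bool"
  where "\<forall>n. has_finite_rank (homology_group (int n) (subtopology X S)) \<longleftrightarrow> fw (Suc n) \<and> fu n"
    and "\<forall>n. has_finite_rank (homology_group (int n) X) \<longleftrightarrow> fu n \<and> fv n"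
    and "\<forall>n. has_finite_rank (relative_homology_group (int n) X S) \<longleftrightarrow> fv n \<and> fw n"
    and "\<forall>n. fw (Suc n) \<and> fu n \<longrightarrow> rel_betti (subtopology X S) {} n = w (Suc n) + u n"
    and "\<forall>n. fu n \<and> fv n \<longrightarrow> rel_betti X {} n = u n + v n"
    and "\<forall>n. fv n \<and> fw n \<longrightarrow> rel_betti X S n = v n + w n"
    and "fw 0" "w 0 = 0"
proof -
  define A where "A p = homology_group p (subtopology X S)" for p
  define B where "B p = homology_group p X" for p
  define C where "C p = relative_homology_group p X S" for p
  define i where "i p = hom_induced p (subtopology X S) {} X {} id" for p
  define j where "j p = hom_induced p X {} X S id" for p
  define d where "d p = hom_boundary p X S" for p
  have comm: "comm_group (A p)" "comm_group (B p)" "comm_group (C p)" for p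
    by (simp_all add: A_def B_def C_def abelian_relative_homology_group)
  have hom: "i p \<in> hom (A p) (B p)" "j p \<in> hom (B p) (C p)" "d p \<in> hom (C p) (A (p - 1))" for p
    by (simp_all add: A_def B_def C_def i_def j_def d_def hom_induced_hom hom_boundary_hom)
  have exB: "i p ` carrier (A p) = kernel (B p) (C p) (j p)" for p
    using homology_exactness_axiom_3[of p X S] by (simp add: A_def B_def C_def i_def j_def)
  have exC: "j p ` carrier (B p) = kernel (C p) (A (p - 1)) (d p)" for p
    using homology_exactness_axiom_1[of p X S] by (simp add: A_def B_def C_def j_def d_def)
  \<comment> \<open>The boundary map lowers the degree, so exactness at the subspace involves the next degree up.\<close>
  have exA: "d (p + 1) ` carrier (C (p + 1)) = kernel (A p) (B p) (i p)" for p
    using homology_exactness_axiom_2[of "p + 1" X S] by (simp add: A_def B_def C_def i_def d_def)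
  have hom': "d (p + 1) \<in> hom (C (p + 1)) (A p)" for p using hom(3)[of "p + 1"] by simp
  have triv: "d 0 ` carrier (C 0) = {\<one>\<^bsub>A (-1)\<^esub>}"
  proof -
    have "trivial_group (A (-1))" by (simp add: A_def trivial_homology_group)
    moreover have "d 0 ` carrier (C 0) \<subseteq> carrier (A (-1))"
      using hom(3)[of 0] by (auto simp: hom_def)
    moreover have "carrier (C 0) \<noteq> {}"
      using comm(3)[of 0] by (metis comm_group_def empty_iff group.is_monoid monoid.one_closed)
    ultimately show ?thesis by (auto simp: trivial_group_def)
  qed
  note rA = rank_exact[OF comm(3) comm(1) comm(2) hom' hom(1) exA]
  note rB = rank_exact[OF comm(1) comm(2) comm(3) hom(1,2) exB]
  note rC = rank_exact[OF comm(2) comm(3) comm(1) hom(2,3) exC]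
  define U where "U p = comm_group.subset_rank (B p) (i p ` carrier (A p))" for p
  define V where "V p = comm_group.subset_rank (C p) (j p ` carrier (B p))" for p
  define W where "W p = comm_group.subset_rank (A (p - 1)) (d p ` carrier (C p))" for p
  define fU where "fU p = comm_group.finite_subset_rank (B p) (i p ` carrier (A p))" for p
  define fV where "fV p = comm_group.finite_subset_rank (C p) (j p ` carrier (B p))" for p
  define fW where "fW p = comm_group.finite_subset_rank (A (p - 1)) (d p ` carrier (C p))" for p
  have W1: "W (p + 1) = comm_group.subset_rank (A p) (d (p + 1) ` carrier (C (p + 1)))"
    "fW (p + 1) = comm_group.finite_subset_rank (A p) (d (p + 1) ` carrier (C (p + 1)))" for p
    by (simp_all add: W_def fW_def)
  have suc: "int (Suc n) = int n + 1" for n by simp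
  show ?thesis
  proof (rule that[of "\<lambda>n. fW (int n)" "\<lambda>n. fU (int n)" "\<lambda>n. fV (int n)"
        "\<lambda>n. W (int n)" "\<lambda>n. U (int n)" "\<lambda>n. V (int n)"])
    show "\<forall>n. has_finite_rank (homology_group (int n) (subtopology X S)) \<longleftrightarrow> fW (int (Suc n)) \<and> fU (int n)"
      using rA(1) unfolding suc W1 fU_def A_def[symmetric] by blast
    show "\<forall>n. has_finite_rank (homology_group (int n) X) \<longleftrightarrow> fU (int n) \<and> fV (int n)"
      using rB(1) unfolding fU_def fV_def B_def[symmetric] by blast
    show "\<forall>n. has_finite_rank (relative_homology_group (int n) X S) \<longleftrightarrow> fV (int n) \<and> fW (int n)"
      using rC(1) unfolding fV_def fW_def C_def[symmetric] by blast
    show "\<forall>n. fW (int (Suc n)) \<and> fU (int n) \<longrightarrow>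
        rel_betti (subtopology X S) {} n = W (int (Suc n)) + U (int n)"
      using rA unfolding suc W1 fU_def U_def rel_betti_def A_def[symmetric] by blast
    show "\<forall>n. fU (int n) \<and> fV (int n) \<longrightarrow> rel_betti X {} n = U (int n) + V (int n)"
      using rB unfolding fU_def U_def fV_def V_def rel_betti_def B_def[symmetric] by blast
    show "\<forall>n. fV (int n) \<and> fW (int n) \<longrightarrow> rel_betti X S n = V (int n) + W (int n)"
      using rC unfolding fV_def V_def fW_def W_def rel_betti_def C_def[symmetric] by blast
    show "fW (int 0)" "W (int 0) = 0"
      using subset_rank_one[OF comm(1)] triv by (simp_all add: fW_def W_def)
  qed
qed

lemma euler_char_of_pair_imp_space:
  assumes A: "rel_has_euler_char (subtopology X S) {}" and C: "rel_has_euler_char X S"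
  shows "rel_has_euler_char X {}"
    and "rel_euler_char X {} = rel_euler_char (subtopology X S) {} + rel_euler_char X S"
proof -
  obtain u v w fu fv fw where *:
    "\<forall>n. has_finite_rank (homology_group (int n) (subtopology X S)) \<longleftrightarrow> fw (Suc n) \<and> fu n"
    "\<forall>n. has_finite_rank (homology_group (int n) X) \<longleftrightarrow> fu n \<and> fv n"
    "\<forall>n. has_finite_rank (relative_homology_group (int n) X S) \<longleftrightarrow> fv n \<and> fw n"
    "\<forall>n. fw (Suc n) \<and> fu n \<longrightarrow> rel_betti (subtopology X S) {} n = w (Suc n) + u n"
    "\<forall>n. fu n \<and> fv n \<longrightarrow> rel_betti X {} n = u n + v n"
    "\<forall>n. fv n \<and> fw n \<longrightarrow> rel_betti X S n = v n + w n" "fw 0" "w 0 = 0"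
    by (rule pair_rank_decomposition[of X S]) (rule that)
  have f: "fu n" "fv n" "fw n" for n
    using A C by (simp_all add: rel_has_euler_char_def *)
  have r: "rel_betti (subtopology X S) {} n = w (Suc n) + u n" "rel_betti X {} n = u n + v n"
    "rel_betti X S n = v n + w n" for n
    using * f by auto
  have fin: "finite {n. rel_betti (subtopology X S) {} n \<noteq> 0}" "finite {n. rel_betti X S n \<noteq> 0}"
    using A C by (simp_all add: rel_has_euler_char_def)
  have "{n. rel_betti X {} n \<noteq> 0} \<subseteq> {n. rel_betti (subtopology X S) {} n \<noteq> 0} \<union> {n. rel_betti X S n \<noteq> 0}"
    by (auto simp: r)
  then have "finite {n. rel_betti X {} n \<noteq> 0}" using fin by (meson finite_Un finite_subset)
  moreover have "\<forall>n. has_finite_rank (homology_group (int n) X)" using *(2) f by blast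
  ultimately show "rel_has_euler_char X {}"
    unfolding rel_has_euler_char_def by blast
  show "rel_euler_char X {} = rel_euler_char (subtopology X S) {} + rel_euler_char X S"
    unfolding rel_euler_char_def by (rule alternating_sum_exact[OF r \<open>w 0 = 0\<close> fin])
qed

lemma euler_char_of_spaces_imp_pair:
  assumes A: "rel_has_euler_char (subtopology X S) {}" and B: "rel_has_euler_char X {}"
  shows "rel_has_euler_char X S"
    and "rel_euler_char X S = rel_euler_char X {} - rel_euler_char (subtopology X S) {}"
proof -
  obtain u v w fu fv fw where *:
    "\<forall>n. has_finite_rank (homology_group (int n) (subtopology X S)) \<longleftrightarrow> fw (Suc n) \<and> fu n"
    "\<forall>n. has_finite_rank (homology_group (int n) X) \<longleftrightarrow> fu n \<and> fv n"
    "\<forall>n. has_finite_rank (relative_homology_group (int n) X S) \<longleftrightarrow> fv n \<and> fw n"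
    "\<forall>n. fw (Suc n) \<and> fu n \<longrightarrow> rel_betti (subtopology X S) {} n = w (Suc n) + u n"
    "\<forall>n. fu n \<and> fv n \<longrightarrow> rel_betti X {} n = u n + v n"
    "\<forall>n. fv n \<and> fw n \<longrightarrow> rel_betti X S n = v n + w n" "fw 0" "w 0 = 0"
    by (rule pair_rank_decomposition[of X S]) (rule that)
  have f: "fu n" "fv n" "fw (Suc n)" for n
    using A B by (simp_all add: rel_has_euler_char_def *)
  then have fw: "fw n" for n using \<open>fw 0\<close> by (cases n) auto
  have r: "rel_betti (subtopology X S) {} n = w (Suc n) + u n" "rel_betti X {} n = u n + v n"
    "rel_betti X S n = v n + w n" for n
    using * f fw by auto
  have fin: "finite {n. rel_betti (subtopology X S) {} n \<noteq> 0}" "finite {n. rel_betti X {} n \<noteq> 0}"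
    using A B by (simp_all add: rel_has_euler_char_def)
  have "{n. rel_betti X S n \<noteq> 0} \<subseteq> Suc ` {n. rel_betti (subtopology X S) {} n \<noteq> 0} \<union> {n. rel_betti X {} n \<noteq> 0}"
  proof
    fix n assume "n \<in> {n. rel_betti X S n \<noteq> 0}"
    then have "v n \<noteq> 0 \<or> w n \<noteq> 0" by (simp add: r)
    then show "n \<in> Suc ` {n. rel_betti (subtopology X S) {} n \<noteq> 0} \<union> {n. rel_betti X {} n \<noteq> 0}"
      using \<open>w 0 = 0\<close> by (cases n) (auto simp: r)
  qed
  then have finC: "finite {n. rel_betti X S n \<noteq> 0}"
    using fin by (meson finite_Un finite_imageI finite_subset)
  moreover have "\<forall>n. has_finite_rank (relative_homology_group (int n) X S)" using *(3) f fw by blast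
  ultimately show "rel_has_euler_char X S"
    unfolding rel_has_euler_char_def by blast
  show "rel_euler_char X S = rel_euler_char X {} - rel_euler_char (subtopology X S) {}"
    unfolding rel_euler_char_def
    using alternating_sum_exact[OF r \<open>w 0 = 0\<close> fin(1) finC] by simp
qed

lemma rel_euler_char_isomorphic:
  assumes iso: "\<And>n. relative_homology_group (int n) X S \<cong> relative_homology_group (int n) Y T"
    and X: "rel_has_euler_char X S"
  shows "rel_has_euler_char Y T" "rel_euler_char Y T = rel_euler_char X S"
proof -
  have r: "has_finite_rank (relative_homology_group (int n) Y T)" "rel_betti Y T n = rel_betti X S n" for n
    using rank_isomorphic[OF abelian_relative_homology_group abelian_relative_homology_group iso] X
    by (auto simp: rel_has_euler_char_def rel_betti_def)
  then have "rel_betti Y T = rel_betti X S" by blast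
  then show "rel_has_euler_char Y T" "rel_euler_char Y T = rel_euler_char X S"
    using X r(1) by (simp_all add: rel_has_euler_char_def rel_euler_char_def)
qed

text \<open>
  Excising the closed set \<open>X - V\<close>, which lies in the open set \<open>U\<close>, identifies the homology of \<open>(X, U)\<close>
  with that of \<open>(V, U \<inter> V)\<close>. The two exact sequences of pairs then give the Euler characteristic.
\<close>
lemma euler_char_open_union:
  assumes U: "openin X U" and V: "openin X V" and UV: "U \<union> V = topspace X"
    and cU: "has_top_euler_char (subtopology X U)" and cV: "has_top_euler_char (subtopology X V)"
    and cUV: "has_top_euler_char (subtopology X (U \<inter> V))"
  shows "has_top_euler_char X"
    and "top_euler_char X = top_euler_char (subtopology X U) + top_euler_char (subtopology X V)
           - top_euler_char (subtopology X (U \<inter> V))"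
proof -
  have sub: "subtopology (subtopology X V) (U \<inter> V) = subtopology X (U \<inter> V)"
    unfolding subtopology_subtopology by (rule arg_cong[of _ _ "subtopology X"]) blast
  have pairV: "rel_has_euler_char (subtopology X V) (U \<inter> V)"
    "rel_euler_char (subtopology X V) (U \<inter> V) = rel_euler_char (subtopology X V) {} - rel_euler_char (subtopology X (U \<inter> V)) {}"
    using euler_char_of_spaces_imp_pair[of "subtopology X V" "U \<inter> V"] cV cUV
    by (simp_all add: sub has_top_euler_char_rel)
  have excision: "relative_homology_group (int n) (subtopology X V) (U \<inter> V) \<cong> relative_homology_group (int n) X U" for n
  proof -
    have "closedin X (topspace X - V)" using V by blast
    then have "X closure_of (topspace X - V) \<subseteq> X interior_of U"
      using U UV by (auto simp: closure_of_closedin interior_of_openin)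
    moreover have "U \<subseteq> topspace X" using U openin_subset by blast
    moreover have "topspace X - (topspace X - V) = V" "U - (topspace X - V) = U \<inter> V"
      using UV by auto
    ultimately show ?thesis
      using homology_excision_axiom[of X "topspace X - V" U "topspace X" "int n"]
      by (auto intro: is_isoI)
  qed
  have pairX: "rel_has_euler_char X U" "rel_euler_char X U = rel_euler_char (subtopology X V) (U \<inter> V)"
    using rel_euler_char_isomorphic[OF excision pairV(1)] by auto
  show "has_top_euler_char X" "top_euler_char X = top_euler_char (subtopology X U) + top_euler_char (subtopology X V)
           - top_euler_char (subtopology X (U \<inter> V))"
    using euler_char_of_pair_imp_space[OF _ pairX(1)] cU pairX(2) pairV(2)
    by (simp_all add: has_top_euler_char_rel top_euler_char_rel)
qed

lemma euler_char_empty: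
  assumes "topspace X = {}"
  shows "has_top_euler_char X" "top_euler_char X = 0"
proof -
  have b: "has_finite_rank (homology_group (int n) X)" "betti_number n X = 0" for n
    using rank_trivial[OF trivial_homology_group_empty[OF assms]] by (simp_all add: betti_number_def)
  then show "has_top_euler_char X" "top_euler_char X = 0"
    by (simp_all add: has_top_euler_char_def top_euler_char_def)
qed

lemma euler_char_contractible:
  fixes X :: "'p topology"
  assumes "contractible_space X" "topspace X \<noteq> {}"
  shows "has_top_euler_char X" "top_euler_char X = 1"
proof -
  have "X \<noteq> trivial_topology" using assms(2) by auto
  then obtain a where a: "a \<in> topspace X" "X homotopy_equivalent_space (subtopology X {a})"
    using assms(1) contractible_eq_homotopy_equivalent_singleton_subtopology by blast
  then have pt: "topspace (subtopology X {a}) = {a}" by auto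
  have iso: "homology_group p (subtopology X {a}) \<cong> homology_group p X" for p
    using homotopy_equivalent_space_imp_isomorphic_homology_groups a(2) homotopy_equivalent_space_sym by blast
  have b0: "has_finite_rank (homology_group 0 X)" "betti_number 0 X = 1"
  proof -
    have "integer_group \<cong> homology_group 0 (subtopology X {a})"
      using homology_coefficients[OF pt] group.iso_sym
        group_relative_homology_group by blast
    then have "integer_group \<cong> homology_group 0 X" using iso iso_trans by blast
    from rank_isomorphic[OF abelian_integer_group abelian_relative_homology_group this rank_integer_group(1)]
    show "has_finite_rank (homology_group 0 X)" "betti_number 0 X = 1"
      by (simp_all add: betti_number_def rank_integer_group)
  qed
  have b: "has_finite_rank (homology_group (int n) X)" "betti_number n X = 0" if "n \<noteq> 0" for n
  proof -
    have "trivial_group (homology_group (int n) (subtopology X {a}))"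
      using homology_dimension_axiom[OF pt] that by simp
    then have "trivial_group (homology_group (int n) X)"
      using iso isomorphic_group_triviality by (metis group_relative_homology_group)
    from rank_trivial[OF this]
    show "has_finite_rank (homology_group (int n) X)" "betti_number n X = 0"
      by (simp_all add: betti_number_def)
  qed
  have "{n. betti_number n X \<noteq> 0} = {0}" using b b0 by fastforce
  moreover have "has_finite_rank (homology_group (int n) X)" for n
    using b b0 by (cases "n = 0") auto
  ultimately show "has_top_euler_char X" "top_euler_char X = 1"
    using b0 by (simp_all add: has_top_euler_char_def top_euler_char_def)
qed

text \<open>
  Disjointness makes each new piece meet the part that is already present only inside \<open>Y\<close>, so the
  pieces can be added one by one by \<open>euler_char_open_union\<close>; a contractible piece counts \<open>1\<close>.
\<close>
lemma euler_char_attach_contractible: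
  assumes "finite I" and Y: "openin X Y" "has_top_euler_char (subtopology X Y)"
    and S: "\<And>i. i \<in> I \<Longrightarrow> openin X (S i)" "\<And>i. i \<in> I \<Longrightarrow> contractible_space (subtopology X (S i))"
      "\<And>i. i \<in> I \<Longrightarrow> S i \<noteq> {}"
    and disj: "disjoint_family_on S I"
    and c: "\<And>i. i \<in> I \<Longrightarrow> has_top_euler_char (subtopology X (Y \<inter> S i))"
  shows "has_top_euler_char (subtopology X (Y \<union> (\<Union>i\<in>I. S i))) \<and>
         top_euler_char (subtopology X (Y \<union> (\<Union>i\<in>I. S i))) =
         top_euler_char (subtopology X Y) + (\<Sum>i\<in>I. 1 - top_euler_char (subtopology X (Y \<inter> S i)))"
  using assms(1) S disj c
proof (induction I rule: finite_induct)
  case empty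
  then show ?case using Y by simp
next
  case (insert i I)
  let ?U = "Y \<union> (\<Union>j\<in>I. S j)" and ?V = "S i"
  let ?X = "subtopology X (?U \<union> ?V)"
  have IH: "has_top_euler_char (subtopology X ?U)" "top_euler_char (subtopology X ?U) =
         top_euler_char (subtopology X Y) + (\<Sum>j\<in>I. 1 - top_euler_char (subtopology X (Y \<inter> S j)))"
    using insert.IH insert.prems by (auto simp: disjoint_family_on_def)
  have oU: "openin X ?U" and oV: "openin X ?V" using Y insert.prems by auto
  have ts: "?U \<union> ?V \<subseteq> topspace X" using oU oV openin_subset by blast
  have int: "?U \<inter> ?V = Y \<inter> S i"
    using insert.prems(4) insert.hyps by (auto simp: disjoint_family_on_def)
  have sU: "subtopology ?X ?U = subtopology X ?U" and sV: "subtopology ?X ?V = subtopology X ?V"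
    and sUV: "subtopology ?X (?U \<inter> ?V) = subtopology X (Y \<inter> S i)"
    unfolding int[symmetric] subtopology_subtopology by (rule arg_cong[of _ _ "subtopology X"]; blast)+
  have top: "topspace ?X = ?U \<union> ?V" using ts by (simp add: Int_absorb1 topspace_subtopology_subset)
  have cV: "has_top_euler_char (subtopology X ?V)" "top_euler_char (subtopology X ?V) = 1"
  proof -
    have "topspace (subtopology X ?V) \<noteq> {}"
      using topspace_subtopology_subset[OF openin_subset[OF oV]] insert.prems(3) by simp
    moreover have "contractible_space (subtopology X ?V)" using insert.prems(2) by simp
    ultimately show "has_top_euler_char (subtopology X ?V)" "top_euler_char (subtopology X ?V) = 1"
      using euler_char_contractible by blast+
  qed
  have open': "openin ?X ?U" "openin ?X ?V"
    using oU oV openin_Un[OF oU oV] by (simp_all add: openin_open_subtopology)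
  have eq: "Y \<union> (\<Union>j\<in>insert i I. S j) = ?U \<union> ?V" by auto
  have has: "has_top_euler_char (subtopology ?X ?U)" "has_top_euler_char (subtopology ?X ?V)"
      "has_top_euler_char (subtopology ?X (?U \<inter> ?V))"
    unfolding sU sV sUV using IH(1) cV(1) insert.prems(5)[of i] by blast+
  have "top_euler_char ?X = top_euler_char (subtopology X ?U) + 1 - top_euler_char (subtopology X (Y \<inter> S i))"
    using euler_char_open_union(2)[OF open' top[symmetric] has] unfolding sU sV sUV cV(2) .
  moreover have "(\<Sum>j\<in>insert i I. 1 - top_euler_char (subtopology X (Y \<inter> S j))) =
      1 - top_euler_char (subtopology X (Y \<inter> S i)) + (\<Sum>j\<in>I. 1 - top_euler_char (subtopology X (Y \<inter> S j)))"
    using insert.hyps by simp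
  ultimately show ?case
    unfolding eq using euler_char_open_union(1)[OF open' top[symmetric] has] IH(2) by linarith
qed

section \<open>Nerves of categories in which arrows strictly increase a rank\<close>

text \<open>
  The hypotheses on the category in the form in which they are used: a numbering of the objects along
  which every arrow other than an identity goes strictly up. Injectivity allows objects to be
  adjoined one at a time, and lets the number of an object serve as its position in a simplex.
\<close>
locale ranked_category = category C for C :: "('o, 'a) category_data" +
  fixes r :: "'o \<Rightarrow> nat" and N :: nat
  assumes endo: "f \<in> Hom C a a \<Longrightarrow> f = Ident C a"
    and rank_less: "f \<in> Hom C a b \<Longrightarrow> a \<noteq> b \<Longrightarrow> r a < r b"
    and rank_inj: "inj_on r (Ob C)"
    and rank_bound: "a \<in> Ob C \<Longrightarrow> r a \<le> N"

text \<open>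
  An arrow \<open>a \<rightarrow> b\<close> between different objects has no arrow back, since both composites would be
  identities and \<open>a\<close>, \<open>b\<close> isomorphic. Counting the objects that map to \<open>a\<close> is therefore strictly
  monotone; a numbering of the objects is added as a less significant digit to break ties.
\<close>
lemma finite_category_rankable:
  assumes "finite_category C" "skeletal C" "only_identity_endos C"
  obtains r N where "ranked_category C r N"
proof -
  interpret category C using assms by (simp add: finite_category_def)
  have fin: "finite (Ob C)" using assms by (simp add: finite_category_def)
  obtain f :: "'a \<Rightarrow> nat" and n where f: "f ` Ob C = {i. i < n}" "inj_on f (Ob C)"
    using finite_imp_inj_to_nat_seg[OF fin] by blast
  define below where "below a = {c \<in> Ob C. Hom C c a \<noteq> {}}" for a
  define r where "r a = card (below a) * n + f a" for a
  have fn: "f a < n" if "a \<in> Ob C" for a using f that by blast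
  have HomOb: "a \<in> Ob C \<and> b \<in> Ob C" if "g \<in> Hom C a b" for g a b
    using that Dom_in Cod_in by (auto simp: Hom_def)
  have less: "r a < r b" if g: "g \<in> Hom C a b" and ne: "a \<noteq> b" for g a b
  proof -
    have "below a \<subseteq> below b" using Comp_in g by (fastforce simp: below_def)
    moreover have "b \<in> below b" using Ident_in HomOb[OF g] by (auto simp: below_def)
    moreover have "b \<notin> below a"
    proof
      assume "b \<in> below a"
      then obtain h where h: "h \<in> Hom C b a" by (auto simp: below_def)
      have "Comp C h g = Ident C a" "Comp C g h = Ident C b"
        using assms(3) Comp_in[OF g h] Comp_in[OF h g] HomOb[OF g] by (auto simp: only_identity_endos_def)
      then have "isomorphic_obs C a b" using g h by (auto simp: isomorphic_obs_def)
      then show False using assms(2) HomOb[OF g] ne by (auto simp: skeletal_def)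
    qed
    ultimately have "card (below a) < card (below b)"
      using fin by (intro psubset_card_mono) (auto simp: below_def)
    then have "card (below a) * n + n \<le> card (below b) * n"
      by (metis Suc_leI add.commute mult_Suc mult_le_mono1)
    then show ?thesis using fn[of a] HomOb[OF g] by (simp add: r_def)
  qed
  have "ranked_category C r (Max (r ` Ob C))"
  proof
    show "f \<in> Hom C a a \<Longrightarrow> f = Ident C a" for f a
      using assms(3) HomOb by (auto simp: only_identity_endos_def)
    show "inj_on r (Ob C)"
    proof (rule inj_onI)
      fix a b assume ab: "a \<in> Ob C" "b \<in> Ob C" "r a = r b"
      have "f a = r a mod n" "f b = r b mod n" using fn ab(1,2) by (simp_all add: r_def)
      then have "f a = f b" using ab(3) by simp
      then show "a = b" using inj_onD[OF f(2)] ab by blast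
    qed
  qed (use less fin in auto)
  then show ?thesis using that by blast
qed

sublocale category \<subseteq> N: simplicial_set "nerve C" by (rule simplicial_set_nerve)

context category
begin

lemma Hom_objects: "f \<in> Hom C a b \<Longrightarrow> a \<in> Ob C \<and> b \<in> Ob C"
  using Dom_in Cod_in by (auto simp: Hom_def)

lemma simplices_nerve: "x \<in> simplices (nerve C) n \<longleftrightarrow> length (snd x) = n \<and> composable C (fst x) (snd x)"
  by (auto simp: nerve_def)

lemma action_nerve:
  "action (nerve C) m n \<theta> x = (vertex C x (\<theta> 0), map (\<lambda>i. segment C x (\<theta> i) (\<theta> (Suc i))) [0..<m])"
  by (simp add: nerve_def)

text \<open>
  Restricting an \<open>m\<close>-simplex to a single vertex, to an edge or to a triangle gives simplices whose
  entries are vertices, segments and composites. Functoriality of the nerve applied to these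
  restrictions yields the rules for \<open>vertex\<close> and \<open>segment\<close> that follow.
\<close>
lemma vertex_action:
  assumes "ord_map m n \<theta>" "x \<in> simplices (nerve C) n" "i \<le> m"
  shows "vertex C (action (nerve C) m n \<theta> x) i = vertex C x (\<theta> i)"
  using N.action_comp[of 0 m "\<lambda>_. i" n \<theta> x] assms by (simp add: action_nerve ord_map_def)

lemma segment_action:
  assumes "ord_map m n \<theta>" "x \<in> simplices (nerve C) n" "i \<le> j" "j \<le> m"
  shows "segment C (action (nerve C) m n \<theta> x) i j = segment C x (\<theta> i) (\<theta> j)"
  using N.action_comp[of 1 m "\<lambda>k. if k = 0 then i else j" n \<theta> x] assms
  by (simp add: action_nerve ord_map_def)

lemma segment_Hom:
  assumes x: "x \<in> simplices (nerve C) n" and ij: "i \<le> j" "j \<le> n"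
  shows "segment C x i j \<in> Hom C (vertex C x i) (vertex C x j)"
proof -
  let ?\<theta> = "\<lambda>k::nat. if k = 0 then i else j"
  have \<theta>: "ord_map 1 n ?\<theta>" using ij by (auto simp: ord_map_def)
  have "vertex C (action (nerve C) 1 n ?\<theta> x) 1 = vertex C x j"
    using vertex_action[OF \<theta> x, of 1] by simp
  then have "Cod C (segment C x i j) = vertex C x j"
    by (simp add: action_nerve)
  then show ?thesis
    using N.action_in[OF \<theta> x] by (simp add: action_nerve simplices_nerve Hom_def)
qed

lemma vertex_in: "x \<in> simplices (nerve C) n \<Longrightarrow> i \<le> n \<Longrightarrow> vertex C x i \<in> Ob C"
  using segment_Hom[of x n i i] Hom_objects by blast

lemma segment_self: "segment C x i i = Ident C (vertex C x i)"
  by (simp add: segment_def)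

lemma segment_Comp:
  assumes x: "x \<in> simplices (nerve C) n" and ij: "i \<le> j" "j \<le> k" "k \<le> n"
  shows "Comp C (segment C x j k) (segment C x i j) = segment C x i k"
proof -
  let ?\<theta> = "\<lambda>l::nat. if l = 0 then i else if l = 1 then j else k"
  have \<theta>: "ord_map 2 n ?\<theta>" using ij by (auto simp: ord_map_def)
  have y: "action (nerve C) 2 n ?\<theta> x = (vertex C x i, [segment C x i j, segment C x j k])"
    by (simp add: action_nerve numeral_2_eq_2)
  have "segment C (action (nerve C) 2 n ?\<theta> x) 0 2 = segment C x i k"
    using segment_action[OF \<theta> x, of 0 2] by simp
  moreover have "segment C (action (nerve C) 2 n ?\<theta> x) 0 2 = Comp C (segment C x j k) (segment C x i j)"
    using segment_Hom[OF x, of j k] ij Ident_Comp[of "segment C x j k"]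
    unfolding y by (simp add: segment_def Hom_def)
  ultimately show ?thesis by simp
qed

lemma segment_Suc:
  assumes "x \<in> simplices (nerve C) n" "i < n"
  shows "segment C x i (Suc i) = snd x ! i"
proof -
  have "map (\<lambda>i. segment C x i (Suc i)) [0..<n] = snd x"
    using N.action_id[OF assms(1)] by (simp add: action_nerve prod_eq_iff)
  then have "map (\<lambda>i. segment C x i (Suc i)) [0..<n] ! i = snd x ! i" by simp
  then show ?thesis using assms by simp
qed

end

context ranked_category
begin

lemma rank_le: "f \<in> Hom C a b \<Longrightarrow> r a \<le> r b"
  using rank_less[of f a b] by (cases "a = b") auto

lemma vertex_rank_mono:
  "x \<in> simplices (nerve C) n \<Longrightarrow> i \<le> j \<Longrightarrow> j \<le> n \<Longrightarrow> r (vertex C x i) \<le> r (vertex C x j)"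
  using rank_le segment_Hom by blast

text \<open>
  Equal vertices can only be repeated consecutively, and the segments between repetitions are
  endomorphisms, hence identities. So a segment depends on its end objects only, not on the positions
  at which they occur.
\<close>
lemma segment_unique:
  assumes x: "x \<in> simplices (nerve C) n"
    and i: "i \<le> j" "j \<le> n" and i': "i' \<le> j'" "j' \<le> n"
    and v: "vertex C x i = vertex C x i'" "vertex C x j = vertex C x j'"
  shows "segment C x i j = segment C x i' j'"
proof (cases "vertex C x i = vertex C x j")
  case True
  then show ?thesis
    using endo segment_Hom[OF x i] segment_Hom[OF x i'] v by metis
next
  case False
  have less: "r (vertex C x i) < r (vertex C x j)"
    using rank_less[OF segment_Hom[OF x i] False] .
  have i'j: "i' \<le> j" using vertex_rank_mono[OF x, of j i'] i' less v by force
  have *: "segment C x k j = segment C x k' j"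
    if "k \<le> k'" "k' \<le> j" "vertex C x k = vertex C x k'" for k k'
  proof -
    have "segment C x k k' = Ident C (vertex C x k)"
      using endo segment_Hom[OF x, of k k'] that i by simp
    then have "segment C x k j = Comp C (segment C x k' j) (Ident C (vertex C x k'))"
      using segment_Comp[OF x, of k k' j] that i by simp
    then show ?thesis
      using Comp_Ident[OF segment_Hom[OF x, of k' j]] that i by simp
  qed
  have 1: "segment C x i j = segment C x i' j"
    using *[of i i'] *[of i' i] i i'j v by (metis nat_le_linear)
  have **: "segment C x i' k = segment C x i' k'"
    if "k \<le> k'" "i' \<le> k" "k' \<le> n" "vertex C x k = vertex C x k'" for k k'
  proof -
    have "segment C x k k' = Ident C (vertex C x k)"
      using endo segment_Hom[OF x, of k k'] that by simp
    then have "segment C x i' k' = Comp C (Ident C (vertex C x k)) (segment C x i' k)"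
      using segment_Comp[OF x, of i' k k'] that by simp
    then show ?thesis
      using Ident_Comp[OF segment_Hom[OF x, of i' k]] that by simp
  qed
  have "segment C x i' j = segment C x i' j'"
    using **[of j j'] **[of j' j] i i' i'j v by (metis nat_le_linear)
  with 1 show ?thesis by simp
qed

text \<open>
  Consequently two faces or degeneracies of one simplex coincide as soon as they have the same
  vertices.
\<close>
lemma action_eqI:
  assumes x: "x \<in> simplices (nerve C) n" and \<theta>: "ord_map m n \<theta>" "ord_map m n \<theta>'"
    and v: "\<And>i. i \<le> m \<Longrightarrow> vertex C x (\<theta> i) = vertex C x (\<theta>' i)"
  shows "action (nerve C) m n \<theta> x = action (nerve C) m n \<theta>' x"
  unfolding action_nerve
  using \<theta> v by (auto simp: ord_map_def intro!: segment_unique[OF x] simp del: vertex.simps)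

text \<open>
  A simplex with two equal consecutive vertices is degenerate, by \<open>action_eqI\<close>; so along a nondegenerate
  simplex the rank increases strictly.
\<close>
lemma nondegenerate_length:
  assumes "(n, x) \<in> nondegenerate_simplices (nerve C)"
  shows "x \<in> simplices (nerve C) n" "n \<le> N"
proof -
  show x: "x \<in> simplices (nerve C) n" using assms by (simp add: nondegenerate_simplices_def)
  have nd: "\<not> degenerate (nerve C) n x" using assms by (simp add: nondegenerate_simplices_def)
  have "vertex C x i \<noteq> vertex C x (Suc i)" if i: "i < n" for i
  proof
    assume eq: "vertex C x i = vertex C x (Suc i)"
    \<comment> \<open>The coface that omits the repeated vertex \<open>Suc i\<close>.\<close>
    let ?\<delta> = "\<lambda>j. if j \<le> i then j else Suc j"
    have \<delta>: "ord_map (n - 1) n ?\<delta>" and s: "ord_map n (n - 1) (codegeneracy i)"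
      using i by (auto simp: ord_map_def codegeneracy_def)
    have "action (nerve C) n (n - 1) (codegeneracy i) (action (nerve C) (n - 1) n ?\<delta> x) =
        action (nerve C) n n (?\<delta> \<circ> codegeneracy i) x"
      using N.action_comp[OF s \<delta> x] .
    also have "\<dots> = action (nerve C) n n id x"
    proof (rule action_eqI[OF x])
      fix j assume "j \<le> n"
      show "vertex C x ((?\<delta> \<circ> codegeneracy i) j) = vertex C x (id j)"
      proof (cases "j = Suc i")
        case True
        then show ?thesis using eq by (simp add: codegeneracy_def del: vertex.simps)
      qed (auto simp: codegeneracy_def simp del: vertex.simps)
    qed (use i in \<open>auto simp: ord_map_def codegeneracy_def\<close>)
    also have "\<dots> = x" using N.action_id[OF x] .
    finally have "degenerate (nerve C) n x"
      using i N.action_in[OF \<delta> x] unfolding degenerate_def by metis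
    with nd show False ..
  qed
  then have less: "r (vertex C x i) < r (vertex C x (Suc i))" if "i < n" for i
    using rank_less segment_Hom[OF x, of i "Suc i"] that by auto
  have "i \<le> n \<Longrightarrow> i \<le> r (vertex C x i)" for i
  proof (induction i)
    case (Suc i)
    then show ?case using less[of i] by simp
  qed simp
  then show "n \<le> N" using rank_bound[OF vertex_in[OF x, of n]] by (meson le_refl le_trans)
qed

lemma finite_nondegenerate_simplices:
  assumes "finite (Ob C)" "finite (Arr C)"
  shows "finite (nondegenerate_simplices (nerve C))"
proof (rule finite_subset)
  have comp: "composable C a fs \<Longrightarrow> set fs \<subseteq> Arr C" for a fs
    by (induction fs arbitrary: a) auto
  have comp': "composable C a fs \<Longrightarrow> a \<in> Ob C" for a fs by (cases fs) auto
  show "nondegenerate_simplices (nerve C) \<subseteq> {..N} \<times> (Ob C \<times> {fs. set fs \<subseteq> Arr C \<and> length fs \<le> N})"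
  proof
    fix p assume p: "p \<in> nondegenerate_simplices (nerve C)"
    obtain n a fs where eq: "p = (n, (a, fs))" by (metis prod.collapse)
    show "p \<in> {..N} \<times> (Ob C \<times> {fs. set fs \<subseteq> Arr C \<and> length fs \<le> N})"
      using nondegenerate_length[of n "(a, fs)"] p comp comp' by (auto simp: eq simplices_nerve)
  qed
  show "finite ({..N} \<times> (Ob C \<times> {fs. set fs \<subseteq> Arr C \<and> length fs \<le> N}))"
    using assms finite_lists_length_le by blast
qed

end


section \<open>Existence of weightings and coweightings\<close>

text \<open>
  Forward substitution: adding an object of largest rank does not disturb the equations that are
  already solved, and its own equation determines the new value.
\<close>
lemma triangular_weighting_exists:
  fixes z :: "'o \<Rightarrow> 'o \<Rightarrow> rat" and r :: "'o \<Rightarrow> nat"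
  assumes "finite A" and "\<And>a. a \<in> A \<Longrightarrow> z a a = 1"
    and "\<And>a b. a \<in> A \<Longrightarrow> b \<in> A \<Longrightarrow> a \<noteq> b \<Longrightarrow> r b \<le> r a \<Longrightarrow> z a b = 0"
  shows "\<exists>k. \<forall>b\<in>A. (\<Sum>a\<in>A. z a b * k a) = 1"
  using assms
proof (induction A rule: finite_ranking_induct[where f = r])
  case empty
  then show ?case by simp
next
  case (insert b A)
  obtain k where k: "\<forall>c\<in>A. (\<Sum>a\<in>A. z a c * k a) = 1"
    using insert by (auto)
  show ?case
  proof (cases "b \<in> A")
    case True
    then show ?thesis using k by (auto simp: insert_absorb)
  next
    case False
    define k' where "k' = k(b := 1 - (\<Sum>a\<in>A. z a b * k a))"
    have k': "(\<Sum>a\<in>A. z a c * k' a) = (\<Sum>a\<in>A. z a c * k a)" for c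
      using False by (intro sum.cong) (auto simp: k'_def)
    have "(\<Sum>a\<in>insert b A. z a c * k' a) = z b c * k' b + (\<Sum>a\<in>A. z a c * k a)" for c
      using insert.hyps False by (simp add: k')
    moreover have "z b c = 0" if "c \<in> A" for c
      using insert.prems(2)[of b c] insert.hyps(2)[of c] that False by auto
    moreover have "z b b = 1" using insert.prems by auto
    ultimately have "\<forall>c\<in>insert b A. (\<Sum>a\<in>insert b A. z a c * k' a) = 1"
      using k False by (auto simp: k'_def)
    then show ?thesis by blast
  qed
qed

lemma Hom_opposite: "Hom (opposite C) a b = Hom C b a"
  by (auto simp: Hom_def opposite_def)

lemma coweighting_iff:
  "coweighting C k \<longleftrightarrow> (\<forall>b\<in>Ob C. (\<Sum>a\<in>Ob C. of_nat (card (Hom C a b)) * k a) = 1)"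
  by (simp add: coweighting_def weighting_def Hom_opposite) (simp add: opposite_def)

lemma (in ranked_category) has_cat_euler_char:
  assumes "finite (Ob C)" "finite (Arr C)"
  shows "has_cat_euler_char C"
proof -
  have one: "(of_nat (card (Hom C a a)) :: rat) = 1" if "a \<in> Ob C" for a
  proof -
    have "Hom C a a = {Ident C a}" using endo Ident_in that by blast
    then show ?thesis by simp
  qed
  have zero: "(of_nat (card (Hom C a b)) :: rat) = 0" if "a \<noteq> b" "r b \<le> r a" for a b
  proof -
    have "Hom C a b = {}" using rank_less that by fastforce
    then show ?thesis by simp
  qed
  obtain k where "coweighting C k"
    using triangular_weighting_exists[OF assms(1), of "\<lambda>a b. of_nat (card (Hom C a b))" r] one zero
    unfolding coweighting_iff by blast
  moreover have "\<exists>l. \<forall>b\<in>Ob C. (\<Sum>a\<in>Ob C. (of_nat (card (Hom C b a)) :: rat) * l a) = 1"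
  \<comment> \<open>A weighting is solved for from the top, hence the reversed numbering.\<close>
  proof (rule triangular_weighting_exists[OF assms(1), where r = "\<lambda>a. N - r a"])
    fix a b assume that: "a \<in> Ob C" "b \<in> Ob C" "a \<noteq> b" "N - r b \<le> N - r a"
    have "r a \<le> r b" using rank_bound[OF that(1)] rank_bound[OF that(2)] that(4) by linarith
    then show "(of_nat (card (Hom C b a)) :: rat) = 0" using zero[of b a] that(3) by simp
  qed (rule one)
  then have "\<exists>l. weighting C l" by (simp add: weighting_def)
  ultimately show ?thesis
    using assms category_axioms by (auto simp: has_cat_euler_char_def finite_category_def)
qed

section \<open>Invariants that classify the points of the realization\<close>

type_synonym ('o, 'a) realization_point = "(nat \<times> ('o \<times> 'a list)) \<times> (nat \<Rightarrow> real)"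

definition realization_points :: "'x sset \<Rightarrow> ((nat \<times> 'x) \<times> (nat \<Rightarrow> real)) set" where
  "realization_points X = {((n, x), t) | n x t. x \<in> simplices X n \<and> t \<in> standard_simplex n}"

lemma topspace_simplex_union: "topspace (simplex_union X) = realization_points X"
  by (auto simp: simplex_union_def realization_points_def)

lemma simplex_push_in:
  assumes \<theta>: "ord_map m n \<theta>" and t: "t \<in> standard_simplex m"
  shows "simplex_push m \<theta> t \<in> standard_simplex n"
proof -
  have nonneg: "0 \<le> t i" for i using t by (simp add: standard_simplex_def)
  have total: "(\<Sum>i\<le>m. t i) = 1" using t by (simp add: standard_simplex_def)
  have "simplex_push m \<theta> t j \<le> (\<Sum>i\<le>m. t i)" for j
    unfolding simplex_push_def using nonneg by (intro sum_mono2) auto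
  moreover have "(\<Sum>j\<le>n. simplex_push m \<theta> t j) = (\<Sum>j\<le>n. \<Sum>i | i \<in> {..m} \<and> \<theta> i = j. t i)"
    by (simp add: simplex_push_def)
  moreover have "\<dots> = (\<Sum>i\<le>m. t i)"
    using \<theta> by (intro sum.group) (auto simp: ord_map_def)
  moreover have "simplex_push m \<theta> t j = 0" if "j > n" for j
  proof -
    have empty: "{i. i \<le> m \<and> \<theta> i = j} = {}" using \<theta> that by (auto simp: ord_map_def)
    show ?thesis unfolding simplex_push_def empty by simp
  qed
  moreover have "0 \<le> simplex_push m \<theta> t j" for j
    unfolding simplex_push_def using nonneg by (intro sum_nonneg) auto
  ultimately show ?thesis using total by (simp add: standard_simplex_def)
qed

lemma simplex_push_pos:
  assumes t: "t \<in> standard_simplex m"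
  shows "0 < simplex_push m \<theta> t j \<longleftrightarrow> (\<exists>i\<le>m. \<theta> i = j \<and> 0 < t i)"
proof -
  have nonneg: "0 \<le> t i" for i using t by (simp add: standard_simplex_def)
  show ?thesis
  proof
    assume "0 < simplex_push m \<theta> t j"
    then show "\<exists>i\<le>m. \<theta> i = j \<and> 0 < t i"
      unfolding simplex_push_def using nonneg
      by (metis (mono_tags, lifting) leD mem_Collect_eq not_le_imp_less sum_nonpos)
  next
    assume "\<exists>i\<le>m. \<theta> i = j \<and> 0 < t i"
    then obtain i where i: "i \<le> m" "\<theta> i = j" "0 < t i" by blast
    then show "0 < simplex_push m \<theta> t j"
      unfolding simplex_push_def using nonneg by (intro sum_pos2[of _ i]) auto
  qed
qed

text \<open>
  A representative \<open>((n, x), t)\<close> may be degenerate and may have vanishing coordinates. The arrows between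
  vertices with positive coordinate, and the total coordinate over each object, do not depend on the
  representative.
\<close>
definition carrier_arrows :: "('o, 'a) category_data \<Rightarrow> ('o, 'a) realization_point \<Rightarrow> 'a set" where
  "carrier_arrows C p = (case p of ((n, x), t) \<Rightarrow>
     {segment C x i j | i j. i \<le> j \<and> j \<le> n \<and> 0 < t i \<and> 0 < t j})"

definition vertex_weight :: "('o, 'a) category_data \<Rightarrow> ('o, 'a) realization_point \<Rightarrow> 'o \<Rightarrow> real" where
  "vertex_weight C p a = (case p of ((n, x), t) \<Rightarrow> \<Sum>i | i \<le> n \<and> vertex C x i = a. t i)"

text \<open>
  With a monotone key \<open>\<kappa>\<close>, this is a monotone choice of an element of \<open>J\<close> for each threshold \<open>l\<close>; with
  \<open>\<kappa> = id\<close> it is a retraction onto \<open>J\<close>. The value below all keys is the minimum of \<open>J\<close>, which keeps the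
  function monotone.
\<close>
definition clamp_below :: "nat set \<Rightarrow> (nat \<Rightarrow> nat) \<Rightarrow> nat \<Rightarrow> nat" where
  "clamp_below J \<kappa> l = (if \<exists>j\<in>J. \<kappa> j \<le> l then Max {j \<in> J. \<kappa> j \<le> l} else Min J)"

lemma clamp_below:
  assumes J: "finite J" "J \<noteq> {}"
  shows clamp_below_in: "clamp_below J \<kappa> l \<in> J"
    and clamp_below_mono: "l \<le> l' \<Longrightarrow> clamp_below J \<kappa> l \<le> clamp_below J \<kappa> l'"
    and clamp_below_le: "j \<in> J \<Longrightarrow> \<kappa> j \<le> l \<Longrightarrow> \<kappa> (clamp_below J \<kappa> l) \<le> l \<and> j \<le> clamp_below J \<kappa> l"
    and clamp_below_none: "(\<And>j. j \<in> J \<Longrightarrow> \<not> \<kappa> j \<le> l) \<Longrightarrow> clamp_below J \<kappa> l = Min J"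
proof -
  have fin: "finite {j \<in> J. \<kappa> j \<le> l}" for l using J by simp
  have some: "clamp_below J \<kappa> l = Max {j \<in> J. \<kappa> j \<le> l} \<and> clamp_below J \<kappa> l \<in> {j \<in> J. \<kappa> j \<le> l}"
    if "j \<in> J" "\<kappa> j \<le> l" for j l
    using Max_in[OF fin[of l]] that by (auto simp: clamp_below_def)
  show le: "\<kappa> (clamp_below J \<kappa> l) \<le> l \<and> j \<le> clamp_below J \<kappa> l" if "j \<in> J" "\<kappa> j \<le> l" for j l
    using some[OF that] Max_ge[OF fin[of l]] that by auto
  show in_J: "clamp_below J \<kappa> l \<in> J" for l
  proof (cases "\<exists>j\<in>J. \<kappa> j \<le> l")
    case True
    then show ?thesis using some by blast
  qed (use J in \<open>simp add: clamp_below_def\<close>)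
  show none: "(\<And>j. j \<in> J \<Longrightarrow> \<not> \<kappa> j \<le> l) \<Longrightarrow> clamp_below J \<kappa> l = Min J" for l
    by (auto simp: clamp_below_def)
  show "clamp_below J \<kappa> l \<le> clamp_below J \<kappa> l'" if "l \<le> l'"
  proof (cases "\<exists>j\<in>J. \<kappa> j \<le> l")
    case True
    then obtain j where "j \<in> J" "\<kappa> j \<le> l" by blast
    then have "\<kappa> (clamp_below J \<kappa> l) \<le> l'" using le that by force
    then show ?thesis using le in_J by blast
  next
    case False
    then have "clamp_below J \<kappa> l = Min J" using none by blast
    then show ?thesis using Min_le[OF J(1) in_J] by simp
  qed
qed

context ranked_category
begin

abbreviation points :: "('o, 'a) realization_point set" where
  "points \<equiv> realization_points (nerve C)"

abbreviation arrows :: "('o, 'a) realization_point \<Rightarrow> 'a set" where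
  "arrows \<equiv> carrier_arrows C"

abbreviation weight :: "('o, 'a) realization_point \<Rightarrow> 'o \<Rightarrow> real" where
  "weight \<equiv> vertex_weight C"

lemma pointE:
  assumes "p \<in> points"
  obtains n x t where "p = ((n, x), t)" "x \<in> simplices (nerve C) n" "t \<in> standard_simplex n"
  using assms by (auto simp: realization_points_def)

lemma in_arrowsE:
  assumes "f \<in> arrows ((n, x), t)"
  obtains i j where "f = segment C x i j" "i \<le> j" "j \<le> n" "0 < t i" "0 < t j"
  using assms by (auto simp: carrier_arrows_def)

lemma in_arrowsI:
  "i \<le> j \<Longrightarrow> j \<le> n \<Longrightarrow> 0 < t i \<Longrightarrow> 0 < t j \<Longrightarrow> segment C x i j \<in> arrows ((n, x), t)"
  by (auto simp: carrier_arrows_def)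

lemma arrows_Hom:
  assumes p: "p \<in> points" and f: "f \<in> arrows p"
  obtains a b where "f \<in> Hom C a b" "Ident C a \<in> arrows p" "Ident C b \<in> arrows p"
proof -
  obtain n x t where p: "p = ((n, x), t)" "x \<in> simplices (nerve C) n" "t \<in> standard_simplex n"
    using p by (rule pointE)
  obtain i j where ij: "f = segment C x i j" "i \<le> j" "j \<le> n" "0 < t i" "0 < t j"
    using f unfolding p by (rule in_arrowsE)
  show ?thesis
    using that[of "vertex C x i" "vertex C x j"] segment_Hom[OF p(2) ij(2,3)]
      in_arrowsI[of i i n t x] in_arrowsI[of j j n t x] ij
    by (simp add: p segment_self del: vertex.simps)
qed

lemma arrows_subset: "p \<in> points \<Longrightarrow> arrows p \<subseteq> Arr C"
  by (auto elim: arrows_Hom simp: Hom_def)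

lemma Ident_in_arrows:
  assumes p: "p = ((n, x), t)" "x \<in> simplices (nerve C) n" and a: "a \<in> Ob C"
  shows "Ident C a \<in> arrows p \<longleftrightarrow> (\<exists>i\<le>n. 0 < t i \<and> vertex C x i = a)"
proof
  assume "Ident C a \<in> arrows p"
  then obtain i j where ij: "Ident C a = segment C x i j" "i \<le> j" "j \<le> n" "0 < t i" "0 < t j"
    unfolding p by (rule in_arrowsE)
  then show "\<exists>i\<le>n. 0 < t i \<and> vertex C x i = a"
    using segment_Hom[OF p(2) ij(2,3)] Ident_in[OF a] by (auto simp: Hom_def simp del: vertex.simps intro!: exI[of _ i])
next
  assume "\<exists>i\<le>n. 0 < t i \<and> vertex C x i = a"
  then obtain i where "i \<le> n" "0 < t i" "vertex C x i = a" by blast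
  then show "Ident C a \<in> arrows p"
    using in_arrowsI[of i i n t x] by (simp add: p segment_self del: vertex.simps)
qed

lemma weight_pos_iff:
  assumes p: "p \<in> points" and a: "a \<in> Ob C"
  shows "0 < weight p a \<longleftrightarrow> Ident C a \<in> arrows p"
proof -
  obtain n x t where p: "p = ((n, x), t)" "x \<in> simplices (nerve C) n" "t \<in> standard_simplex n"
    using p by (rule pointE)
  have "weight p a = simplex_push n (\<lambda>i. if vertex C x i = a then 0 else 1) t 0"
    by (auto simp: p vertex_weight_def simplex_push_def intro!: sum.cong)
  then have "0 < weight p a \<longleftrightarrow> (\<exists>i\<le>n. (if vertex C x i = a then 0 else 1::nat) = 0 \<and> 0 < t i)"
    using simplex_push_pos[OF p(3)] by simp
  also have "\<dots> \<longleftrightarrow> Ident C a \<in> arrows p"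
    unfolding Ident_in_arrows[OF p(1,2) a] by (auto simp del: vertex.simps split: if_splits)
  finally show ?thesis .
qed

lemma arrows_nonempty:
  assumes "p \<in> points" shows "\<exists>a\<in>Ob C. Ident C a \<in> arrows p"
proof -
  obtain n x t where p: "p = ((n, x), t)" "x \<in> simplices (nerve C) n" "t \<in> standard_simplex n"
    using assms by (rule pointE)
  have "(\<Sum>i\<le>n. t i) = 1" using p(3) by (simp add: standard_simplex_def)
  then obtain i where "i \<le> n" "0 < t i"
    by (metis atMost_iff not_less sum_nonpos zero_less_one)
  then show ?thesis
    using Ident_in_arrows[OF p(1,2)] vertex_in[OF p(2)] by (metis)
qed

lemma arrows_total:
  assumes p: "p \<in> points" and ab: "a \<in> Ob C" "b \<in> Ob C" "Ident C a \<in> arrows p" "Ident C b \<in> arrows p"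
  shows "\<exists>f\<in>arrows p. f \<in> Hom C a b \<or> f \<in> Hom C b a"
proof -
  obtain n x t where p: "p = ((n, x), t)" "x \<in> simplices (nerve C) n" "t \<in> standard_simplex n"
    using p by (rule pointE)
  obtain i j where ij: "i \<le> n" "0 < t i" "vertex C x i = a" "j \<le> n" "0 < t j" "vertex C x j = b"
    using Ident_in_arrows[OF p(1,2)] ab by blast
  show ?thesis
  proof (cases "i \<le> j")
    case True
    then show ?thesis using segment_Hom[OF p(2), of i j] in_arrowsI[of i j n t x] ij p(1) by auto
  next
    case False
    then show ?thesis using segment_Hom[OF p(2), of j i] in_arrowsI[of j i n t x] ij p(1) by auto
  qed
qed

lemma arrows_unique:
  assumes p: "p \<in> points" and f: "f \<in> arrows p" "f \<in> Hom C a b" and g: "g \<in> arrows p" "g \<in> Hom C a b"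
  shows "f = g"
proof -
  obtain n x t where p: "p = ((n, x), t)" "x \<in> simplices (nerve C) n"
    using p by (rule pointE)
  obtain i j where ij: "f = segment C x i j" "i \<le> j" "j \<le> n"
    using f(1) unfolding p by (rule in_arrowsE)
  obtain i' j' where ij': "g = segment C x i' j'" "i' \<le> j'" "j' \<le> n"
    using g(1) unfolding p by (rule in_arrowsE)
  have "vertex C x i = vertex C x i'" "vertex C x j = vertex C x j'"
    using f g segment_Hom[OF p(2) ij(2,3)] segment_Hom[OF p(2) ij'(2,3)] ij(1) ij'(1)
    by (simp_all add: Hom_def)
  then show ?thesis
    unfolding ij ij' using segment_unique[OF p(2) ij(2,3) ij'(2,3)] by blast
qed

lemma arrows_Comp:
  assumes p: "p \<in> points" and f: "f \<in> arrows p" "f \<in> Hom C a b" and g: "g \<in> arrows p" "g \<in> Hom C b c"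
  shows "Comp C g f \<in> arrows p"
proof -
  obtain n x t where p': "p = ((n, x), t)" "x \<in> simplices (nerve C) n"
    using p by (rule pointE)
  obtain i j where ij: "f = segment C x i j" "i \<le> j" "j \<le> n" "0 < t i" "0 < t j"
    using f(1) unfolding p' by (rule in_arrowsE)
  obtain k l where kl: "g = segment C x k l" "k \<le> l" "l \<le> n" "0 < t k" "0 < t l"
    using g(1) unfolding p' by (rule in_arrowsE)
  have v: "vertex C x i = a" "vertex C x j = b" "vertex C x k = b" "vertex C x l = c"
    using f g segment_Hom[OF p'(2) ij(2,3)] segment_Hom[OF p'(2) kl(2,3)] ij(1) kl(1)
    by (simp_all add: Hom_def)
  show ?thesis
  proof (cases "j \<le> l")
    case True
    then have "g = segment C x j l"
      using segment_unique[OF p'(2), of k l j l] v kl by simp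
    then have "Comp C g f = segment C x i l"
      using segment_Comp[OF p'(2), of i j l] ij kl True by simp
    then show ?thesis using in_arrowsI[of i l n t x] ij kl True p' by simp
  next
    case False
    then have kj: "k \<le> j" using kl by simp
    have "r c \<le> r b" using vertex_rank_mono[OF p'(2), of l j] False ij v by simp
    then have "b = c" using rank_less[OF g(2)] by force
    then have "g = Ident C b" using endo g(2) by simp
    then have "Comp C g f = f" using Ident_Comp[OF f(2)] by simp
    then show ?thesis using f by simp
  qed
qed

text \<open>
  A segment between positions \<open>\<theta> i\<close> and \<open>\<theta> j\<close> of \<open>x\<close> is the segment between \<open>i\<close> and \<open>j\<close> of the pullback of \<open>x\<close>
  along \<open>\<theta>\<close>, and pushing forward only moves weight between positions of the same object.
\<close>
lemma realization_gen_invariant: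
  assumes "realization_gen (nerve C) p q"
  shows "p \<in> points" "q \<in> points" "arrows p = arrows q" "weight p = weight q"
proof -
  obtain m n \<theta> x t where \<theta>: "ord_map m n \<theta>" and x: "x \<in> simplices (nerve C) n"
    and t: "t \<in> standard_simplex m" and p: "p = ((m, action (nerve C) m n \<theta> x), t)"
    and q: "q = ((n, x), simplex_push m \<theta> t)"
    using assms by (auto elim: realization_gen.cases)
  let ?u = "simplex_push m \<theta> t"
  have u: "?u \<in> standard_simplex n" using simplex_push_in[OF \<theta> t] .
  show "p \<in> points" "q \<in> points"
    using N.action_in[OF \<theta> x] x t u unfolding realization_points_def p q by blast+
  note pos = simplex_push_pos[OF t, of \<theta>]
  have mono: "i \<le> j \<Longrightarrow> j \<le> m \<Longrightarrow> \<theta> i \<le> \<theta> j" and bound: "i \<le> m \<Longrightarrow> \<theta> i \<le> n" for i j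
    using \<theta> by (auto simp: ord_map_def)
  show "arrows p = arrows q"
  proof
    show "arrows p \<subseteq> arrows q"
    proof
      fix f assume "f \<in> arrows p"
      then obtain i j where ij: "f = segment C (action (nerve C) m n \<theta> x) i j" "i \<le> j" "j \<le> m" "0 < t i" "0 < t j"
        unfolding p by (rule in_arrowsE)
      have "f = segment C x (\<theta> i) (\<theta> j)" using segment_action[OF \<theta> x] ij by simp
      moreover have "0 < ?u (\<theta> i)" "0 < ?u (\<theta> j)" using pos[of "\<theta> i"] pos[of "\<theta> j"] ij le_trans by blast+
      ultimately show "f \<in> arrows q"
        unfolding q using in_arrowsI[of "\<theta> i" "\<theta> j" n ?u x] mono bound ij by simp
    qed
    show "arrows q \<subseteq> arrows p"
    proof
      fix f assume "f \<in> arrows q"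
      then obtain k l where kl: "f = segment C x k l" "k \<le> l" "l \<le> n" "0 < ?u k" "0 < ?u l"
        unfolding q by (rule in_arrowsE)
      obtain i j where ij: "i \<le> m" "\<theta> i = k" "0 < t i" "j \<le> m" "\<theta> j = l" "0 < t j"
        using kl pos by blast
      have "\<exists>i' j'. i' \<le> j' \<and> j' \<le> m \<and> \<theta> i' = k \<and> \<theta> j' = l \<and> 0 < t i' \<and> 0 < t j'"
      proof (cases "i \<le> j")
        case False
        then have "\<theta> j \<le> \<theta> i" using mono[of j i] ij(1) by simp
        then have "k = l" using ij kl by simp
        then show ?thesis using ij by blast
      qed (use ij in blast)
      then obtain i j where ij: "i \<le> j" "j \<le> m" "\<theta> i = k" "\<theta> j = l" "0 < t i" "0 < t j" by blast
      then show "f \<in> arrows p"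
        unfolding p using in_arrowsI[of i j m t "action (nerve C) m n \<theta> x"] segment_action[OF \<theta> x, of i j] kl by simp
    qed
  qed
  show "weight p = weight q"
  proof
    fix a
    have "weight q a = (\<Sum>j | j \<le> n \<and> vertex C x j = a. \<Sum>i | i \<in> {i. i \<le> m \<and> vertex C x (\<theta> i) = a} \<and> \<theta> i = j. t i)"
      unfolding q vertex_weight_def simplex_push_def by (auto intro!: sum.cong)
    also have "\<dots> = (\<Sum>i | i \<le> m \<and> vertex C x (\<theta> i) = a. t i)"
      using bound by (intro sum.group) auto
    also have "\<dots> = weight p a"
      unfolding p vertex_weight_def using vertex_action[OF \<theta> x] by (auto intro!: sum.cong)
    finally show "weight p a = weight q a" ..
  qed
qed

lemma equivclp_invariant:
  assumes "equivclp (realization_gen (nerve C)) p q"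
  shows "arrows p = arrows q" "weight p = weight q"
  using assms
  by (induction rule: equivclp_induct) (auto dest: realization_gen_invariant)

text \<open>
  The object at position \<open>l\<close> of the normal form: the highest object of \<open>V\<close> of rank at most \<open>l\<close>, or the
  lowest object of \<open>V\<close> if there is none. Since \<open>l\<close> runs through all ranks, every normal form is a
  simplex of the same dimension and no enumeration of \<open>V\<close> has to be chosen.
\<close>
definition top_vertex :: "'o set \<Rightarrow> nat \<Rightarrow> 'o \<Rightarrow> bool" where
  "top_vertex V l w \<longleftrightarrow> w \<in> V \<and>
     (\<forall>u\<in>V. r u \<le> l \<longrightarrow> r w \<le> l \<and> r u \<le> r w) \<and> ((\<forall>u\<in>V. \<not> r u \<le> l) \<longrightarrow> (\<forall>u\<in>V. r w \<le> r u))"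

lemma top_vertex_unique:
  assumes "V \<subseteq> Ob C" "top_vertex V l w" "top_vertex V l w'"
  shows "w = w'"
proof -
  have "r w = r w'"
    using assms(2,3) unfolding top_vertex_def by (metis le_antisym)
  then show ?thesis using rank_inj assms by (auto simp: top_vertex_def inj_on_def)
qed

text \<open>
  Every point is represented by an \<open>N\<close>-simplex in which an object of rank \<open>l\<close> that carries weight sits at
  position \<open>l\<close>, the other positions being filled by repetition. Two monotone maps lead there:
  \<open>\<rho>\<close> retracts the positions of \<open>x\<close> onto the support \<open>J\<close> of \<open>t\<close>, which does not change the point because
  \<open>\<rho>\<close> fixes \<open>J\<close>; and the restricted simplex factors as \<open>\<gamma> \<circ> \<eta>\<close> through the \<open>N\<close>-simplex \<open>y\<close>, where \<open>\<eta>\<close>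
  takes ranks and \<open>\<gamma>\<close> picks positions.
\<close>
lemma point_normal_form:
  assumes p: "p \<in> points"
  obtains y u where "equivclp (realization_gen (nerve C)) p ((N, y), u)"
    and "\<And>l. l \<le> N \<Longrightarrow> top_vertex {a\<in>Ob C. Ident C a \<in> arrows p} l (vertex C y l)"
    and "\<And>l. l < N \<Longrightarrow> snd y ! l \<in> arrows p \<inter> Hom C (vertex C y l) (vertex C y (Suc l))"
    and "y \<in> simplices (nerve C) N"
    and "\<And>l. u l = (\<Sum>a | a \<in> Ob C \<and> r a = l. weight p a)"
proof -
  obtain n x t where p': "p = ((n, x), t)" "x \<in> simplices (nerve C) n" "t \<in> standard_simplex n"
    using p by (rule pointE)
  have nonneg: "0 \<le> t i" and tz: "i > n \<Longrightarrow> t i = 0" for i using p'(3) by (auto simp: standard_simplex_def)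
  define J where "J = {i. i \<le> n \<and> 0 < t i}"
  define V where "V = {a\<in>Ob C. Ident C a \<in> arrows p}"
  have V: "V = vertex C x ` J"
    using Ident_in_arrows[OF p'(1,2)] vertex_in[OF p'(2)] by (auto simp: V_def J_def simp del: vertex.simps)
  have J: "finite J" "J \<noteq> {}" "\<And>j. j \<in> J \<Longrightarrow> j \<le> n"
    using V arrows_nonempty[OF p] by (auto simp: J_def V_def)
  define \<kappa> where "\<kappa> i = r (vertex C x i)" for i
  have \<kappa>_mono: "i \<le> j \<Longrightarrow> j \<le> n \<Longrightarrow> \<kappa> i \<le> \<kappa> j" for i j
    using vertex_rank_mono[OF p'(2)] by (simp add: \<kappa>_def)
  define \<rho> where "\<rho> = clamp_below J id"
  define \<gamma> where "\<gamma> = clamp_below J \<kappa>"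
  define \<eta> where "\<eta> i = \<kappa> (\<rho> i)" for i
  have \<rho>J: "\<rho> i \<in> J" and \<gamma>J: "\<gamma> i \<in> J" for i
    using clamp_below_in[OF J(1,2)] by (simp_all add: \<rho>_def \<gamma>_def)
  have \<rho>_fix: "\<rho> j = j" if "j \<in> J" for j
    using clamp_below_le[OF J(1,2) that, of id j] by (simp add: \<rho>_def)
  have \<rho>: "ord_map n n \<rho>"
    using clamp_below_mono[OF J(1,2)] \<rho>J J(3) by (auto simp: ord_map_def \<rho>_def)
  have \<gamma>: "ord_map N n \<gamma>"
    using clamp_below_mono[OF J(1,2)] \<gamma>J J(3) by (auto simp: ord_map_def \<gamma>_def)
  have \<eta>: "ord_map n N \<eta>"
    using \<rho> \<kappa>_mono rank_bound vertex_in[OF p'(2)] by (auto simp: ord_map_def \<eta>_def \<kappa>_def simp del: vertex.simps)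
  have \<gamma>_top: "top_vertex V l (vertex C x (\<gamma> l))" for l
  proof -
    have 1: "\<kappa> (\<gamma> l) \<le> l \<and> \<kappa> j \<le> \<kappa> (\<gamma> l)" if "j \<in> J" "\<kappa> j \<le> l" for j
      using clamp_below_le[OF J(1,2), of j \<kappa> l] that \<kappa>_mono J(3)[OF \<gamma>J[of l]] by (auto simp: \<gamma>_def)
    have 2: "\<kappa> (\<gamma> l) \<le> \<kappa> j" if "\<And>j. j \<in> J \<Longrightarrow> \<not> \<kappa> j \<le> l" "j \<in> J" for j
    proof -
      have "\<gamma> l = Min J" using clamp_below_none[OF J(1,2), of \<kappa> l] that(1) unfolding \<gamma>_def by blast
      then show ?thesis using Min_le[OF J(1) that(2)] \<kappa>_mono J(3)[OF that(2)] by simp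
    qed
    show ?thesis using 1 2 \<gamma>J unfolding top_vertex_def V \<kappa>_def by blast
  qed
  have \<gamma>\<eta>: "vertex C x (\<gamma> (\<eta> i)) = vertex C x (\<rho> i)" for i
  proof -
    have "\<kappa> (\<gamma> (\<eta> i)) = \<kappa> (\<rho> i)"
      using clamp_below_le[OF J(1,2) \<rho>J, of \<kappa> i "\<eta> i"] \<kappa>_mono J(3)[OF \<gamma>J]
      by (intro le_antisym) (auto simp: \<gamma>_def \<eta>_def)
    then show ?thesis
      using rank_inj vertex_in[OF p'(2)] J(3) \<gamma>J \<rho>J unfolding \<kappa>_def by (meson inj_onD)
  qed
  define y where "y = action (nerve C) N n \<gamma> x"
  have y: "y \<in> simplices (nerve C) N" unfolding y_def by (rule N.action_in[OF \<gamma> p'(2)])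
  have vy: "vertex C y l = vertex C x (\<gamma> l)" if "l \<le> N" for l
    unfolding y_def by (rule vertex_action[OF \<gamma> p'(2) that])
  have "action (nerve C) n n \<rho> x = action (nerve C) n n (\<gamma> \<circ> \<eta>) x"
    using \<gamma>\<eta> \<rho> \<gamma> \<eta> by (intro action_eqI[OF p'(2)]) (auto simp: ord_map_def simp del: vertex.simps)
  also have "\<dots> = action (nerve C) n N \<eta> y"
    unfolding y_def by (rule N.action_comp[OF \<eta> \<gamma> p'(2), symmetric])
  finally have x\<rho>: "action (nerve C) n n \<rho> x = action (nerve C) n N \<eta> y" .
  have "simplex_push n \<rho> t = t"
  proof
    fix j
    have "simplex_push n \<rho> t j = (\<Sum>i | i \<le> n \<and> \<rho> i = j \<and> i \<in> J. t i)"
      unfolding simplex_push_def using nonneg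
      by (intro sum.mono_neutral_right) (auto simp: J_def order.strict_iff_order)
    also have "{i. i \<le> n \<and> \<rho> i = j \<and> i \<in> J} = (if j \<in> J then {j} else {})"
      using \<rho>_fix J(3) by auto
    also have "(\<Sum>i\<in>\<dots>. t i) = t j"
      using nonneg[of j] tz[of j] by (auto simp: J_def)
    finally show "simplex_push n \<rho> t j = t j" .
  qed
  then have "realization_gen (nerve C) ((n, action (nerve C) n n \<rho> x), t) p"
    using realization_gen.intros[OF \<rho> p'(2,3)] p'(1) by simp
  moreover have "realization_gen (nerve C) ((n, action (nerve C) n n \<rho> x), t) ((N, y), simplex_push n \<eta> t)"
    unfolding x\<rho> by (rule realization_gen.intros[OF \<eta> y p'(3)])
  ultimately have eq: "equivclp (realization_gen (nerve C)) p ((N, y), simplex_push n \<eta> t)"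
    by (meson equivclp_sym equivclp_trans r_into_equivclp)
  show ?thesis
  proof (rule that[OF eq _ _ y])
    show "top_vertex {a \<in> Ob C. Ident C a \<in> arrows p} l (vertex C y l)" if "l \<le> N" for l
      using \<gamma>_top[of l] vy[OF that] by (simp add: V_def del: vertex.simps)
    show "snd y ! l \<in> arrows p \<inter> Hom C (vertex C y l) (vertex C y (Suc l))" if "l < N" for l
    proof -
      have "\<gamma> l \<le> \<gamma> (Suc l)" using \<gamma> that by (auto simp: ord_map_def)
      moreover have "segment C y l (Suc l) = segment C x (\<gamma> l) (\<gamma> (Suc l))"
        unfolding y_def by (rule segment_action[OF \<gamma> p'(2)]) (use that in auto)
      ultimately show ?thesis
        using segment_Suc[OF y that] segment_Hom[OF y, of l "Suc l"] that
          in_arrowsI[of "\<gamma> l" "\<gamma> (Suc l)" n t x] \<gamma>J[of l] \<gamma>J[of "Suc l"]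
        by (simp add: p'(1) J_def del: vertex.simps)
    qed
    show "simplex_push n \<eta> t l = (\<Sum>a | a \<in> Ob C \<and> r a = l. weight p a)" for l
    proof -
      have "simplex_push n \<eta> t l = (\<Sum>i | i \<le> n \<and> \<eta> i = l \<and> i \<in> J. t i)"
        unfolding simplex_push_def using nonneg
        by (intro sum.mono_neutral_right) (auto simp: J_def order.strict_iff_order)
      also have "{i. i \<le> n \<and> \<eta> i = l \<and> i \<in> J} = {i. i \<le> n \<and> \<kappa> i = l \<and> i \<in> J}"
        using \<rho>_fix by (auto simp: \<eta>_def)
      also have "(\<Sum>i\<in>\<dots>. t i) = (\<Sum>i | i \<le> n \<and> \<kappa> i = l. t i)"
        using nonneg by (intro sum.mono_neutral_left) (auto simp: J_def order.strict_iff_order)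
      also have "\<dots> = (\<Sum>a | a \<in> Ob C \<and> r a = l. weight p a)"
      proof (cases "\<exists>a\<in>Ob C. r a = l")
        case True
        then obtain a where a: "a \<in> Ob C" "r a = l" by blast
        have "{b \<in> Ob C. r b = l} = {a}" using a rank_inj by (auto simp: inj_on_def)
        moreover have "{i. i \<le> n \<and> \<kappa> i = l} = {i. i \<le> n \<and> vertex C x i = a}"
          using a rank_inj vertex_in[OF p'(2)] unfolding \<kappa>_def inj_on_def by blast
        ultimately show ?thesis by (simp add: p'(1) vertex_weight_def del: vertex.simps)
      next
        case False
        then have empty: "{i. i \<le> n \<and> \<kappa> i = l} = {}" "{a \<in> Ob C. r a = l} = {}"
          using vertex_in[OF p'(2)] by (auto simp: \<kappa>_def simp del: vertex.simps)
        show ?thesis unfolding empty by simp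
      qed
      finally show ?thesis .
    qed
  qed
qed

text \<open>
  The normal form is determined by the two invariants: its vertices by \<open>top_vertex_unique\<close>, its arrows by
  \<open>arrows_unique\<close>, and its coordinates by the weights.
\<close>
theorem equivclp_iff_invariants:
  assumes p: "p \<in> points" and q: "q \<in> points"
  shows "equivclp (realization_gen (nerve C)) p q \<longleftrightarrow> arrows p = arrows q \<and> weight p = weight q"
proof
  assume "arrows p = arrows q \<and> weight p = weight q"
  then have pq: "arrows p = arrows q" "weight p = weight q" by auto
  obtain y u where y: "equivclp (realization_gen (nerve C)) p ((N, y), u)"
    "\<And>l. l \<le> N \<Longrightarrow> top_vertex {a\<in>Ob C. Ident C a \<in> arrows p} l (vertex C y l)"
    "\<And>l. l < N \<Longrightarrow> snd y ! l \<in> arrows p \<inter> Hom C (vertex C y l) (vertex C y (Suc l))"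
    "y \<in> simplices (nerve C) N" "\<And>l. u l = (\<Sum>a | a \<in> Ob C \<and> r a = l. weight p a)"
    using point_normal_form[OF p] by blast
  obtain y' u' where y': "equivclp (realization_gen (nerve C)) q ((N, y'), u')"
    "\<And>l. l \<le> N \<Longrightarrow> top_vertex {a\<in>Ob C. Ident C a \<in> arrows q} l (vertex C y' l)"
    "\<And>l. l < N \<Longrightarrow> snd y' ! l \<in> arrows q \<inter> Hom C (vertex C y' l) (vertex C y' (Suc l))"
    "y' \<in> simplices (nerve C) N" "\<And>l. u' l = (\<Sum>a | a \<in> Ob C \<and> r a = l. weight q a)"
    using point_normal_form[OF q] by blast
  have v: "vertex C y l = vertex C y' l" if "l \<le> N" for l
    using top_vertex_unique[of "{a\<in>Ob C. Ident C a \<in> arrows p}" l "vertex C y l" "vertex C y' l"]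
      y(2)[OF that] y'(2)[OF that] pq(1) by (auto simp del: vertex.simps)
  have "fst y = fst y'" using v[of 0] by (metis le0 prod.collapse vertex.simps)
  moreover have "snd y = snd y'"
  proof (rule nth_equalityI)
    show "length (snd y) = length (snd y')" using y(4) y'(4) by (simp add: simplices_nerve)
    fix l assume "l < length (snd y)"
    then have l: "l < N" using y(4) by (simp add: simplices_nerve)
    show "snd y ! l = snd y' ! l"
      using y(3)[OF l] y'(3)[OF l] v[of l] v[of "Suc l"] l pq(1) arrows_unique[OF p]
      by (metis IntE Suc_leI less_imp_le_nat)
  qed
  moreover have "u = u'" using y(5) y'(5) pq(2) by auto
  ultimately have "((N, y), u) = ((N, y'), u')" by (simp add: prod_eq_iff)
  then show "equivclp (realization_gen (nerve C)) p q"
    using y(1) y'(1) by (metis equivclp_sym equivclp_trans)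
qed (use equivclp_invariant in blast)

end

section \<open>Open stars and their contractions\<close>

text \<open>
  A product with a disjoint union is the disjoint union of the products.
\<close>
lemma continuous_map_prod_sum_topology:
  assumes "\<And>i. i \<in> I \<Longrightarrow> continuous_map (prod_topology Z (Y i)) W (\<lambda>(z, y). f (z, (i, y)))"
  shows "continuous_map (prod_topology Z (sum_topology Y I)) W f"
  unfolding continuous_map_def
proof (intro conjI allI impI)
  show "f \<in> topspace (prod_topology Z (sum_topology Y I)) \<rightarrow> topspace W"
    using assms by (fastforce simp: continuous_map_def Pi_iff)
  fix U assume U: "openin W U"
  show "openin (prod_topology Z (sum_topology Y I)) {x \<in> topspace (prod_topology Z (sum_topology Y I)). f x \<in> U}"
    unfolding openin_prod_topology_alt
  proof (intro allI impI)
    fix z p assume zp: "(z, p) \<in> {x \<in> topspace (prod_topology Z (sum_topology Y I)). f x \<in> U}"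
    obtain i y where p: "p = (i, y)" by fastforce
    have i: "i \<in> I" "z \<in> topspace Z" "y \<in> topspace (Y i)" "f (z, (i, y)) \<in> U"
      using zp by (auto simp: p)
    let ?S = "{x \<in> topspace (prod_topology Z (Y i)). (\<lambda>(z, y). f (z, (i, y))) x \<in> U}"
    have "openin (prod_topology Z (Y i)) ?S"
      using assms[OF i(1)] U by (simp add: continuous_map_def)
    moreover have "(z, y) \<in> ?S" using i by simp
    ultimately have "\<exists>A B. openin Z A \<and> openin (Y i) B \<and> z \<in> A \<and> y \<in> B \<and> A \<times> B \<subseteq> ?S"
      unfolding openin_prod_topology_alt[of Z "Y i"] by simp
    then obtain A B where AB: "openin Z A" "openin (Y i) B" "z \<in> A" "y \<in> B" "A \<times> B \<subseteq> ?S"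
      by blast
    have "openin (sum_topology Y I) (Pair i ` B)"
      unfolding openin_sum_topology
    proof (intro conjI ballI)
      show "Pair i ` B \<subseteq> Sigma I (topspace \<circ> Y)" using i AB openin_subset[OF AB(2)] by auto
      fix k assume "k \<in> I"
      have "{x. (k, x) \<in> Pair i ` B} = (if k = i then B else {})" by auto
      then show "openin (Y k) {x. (k, x) \<in> Pair i ` B}" using AB by simp
    qed
    moreover have "A \<times> (Pair i ` B) \<subseteq> {x \<in> topspace (prod_topology Z (sum_topology Y I)). f x \<in> U}"
      using AB(5) i(1) by fastforce
    ultimately show "\<exists>A B. openin Z A \<and> openin (sum_topology Y I) B \<and> z \<in> A \<and> p \<in> B \<and>
        A \<times> B \<subseteq> {x \<in> topspace (prod_topology Z (sum_topology Y I)). f x \<in> U}"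
      using AB p by blast
  qed
qed

lemma openin_powertop_positive:
  assumes "finite I"
  shows "openin (powertop_real UNIV) {t :: 'i \<Rightarrow> real. \<forall>i\<in>I. 0 < t i}"
proof -
  have "{t :: 'i \<Rightarrow> real. \<forall>i\<in>I. 0 < t i} = Pi\<^sub>E UNIV (\<lambda>i. if i \<in> I then {0<..} else UNIV)"
    by (auto simp: PiE_def Pi_iff split: if_splits)
  also have "open \<dots>"
    using assms by (intro open_PiE) (auto intro: finite_subset[of _ I] split: if_splits)
  finally show ?thesis by (simp add: euclidean_product_topology)
qed

context ranked_category
begin

abbreviation point_class :: "('o, 'a) realization_point \<Rightarrow> ('o, 'a) realization_point set" where
  "point_class \<equiv> realization_class (nerve C)"

lemma pointI: "x \<in> simplices (nerve C) n \<Longrightarrow> t \<in> standard_simplex n \<Longrightarrow> ((n, x), t) \<in> points"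
  unfolding realization_points_def by blast

lemma point_class_eq_iff:
  assumes "p \<in> points" "q \<in> points"
  shows "point_class p = point_class q \<longleftrightarrow> arrows p = arrows q \<and> weight p = weight q"
  unfolding equivclp_iff_invariants[OF assms, symmetric]
proof
  assume eq: "point_class p = point_class q"
  have "q \<in> point_class q"
    using assms by (simp add: realization_class_def topspace_simplex_union)
  then have "q \<in> point_class p" unfolding eq .
  then show "equivclp (realization_gen (nerve C)) p q" by (simp only: realization_class_def mem_Collect_eq)
next
  assume pq: "equivclp (realization_gen (nerve C)) p q"
  have "equivclp (realization_gen (nerve C)) p s \<longleftrightarrow> equivclp (realization_gen (nerve C)) q s" for s
    using equivclp_trans[OF pq] equivclp_trans[OF equivclp_sym[OF pq]] by blast
  then show "point_class p = point_class q"
    unfolding realization_class_def by blast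
qed

lemma quotient_map_point_class:
  "quotient_map (simplex_union (nerve C)) (classifying_space C) point_class"
  unfolding classifying_space_def geometric_realization_def by (rule quotient_map_quotient_topology)

lemma topspace_classifying_space: "topspace (classifying_space C) = point_class ` points"
  by (simp add: classifying_space_def geometric_realization_def topspace_simplex_union)

text \<open>
  For the set of arrows of a simplex \<open>\<sigma>\<close> this is the open star of \<open>\<sigma>\<close>.
\<close>
definition star :: "'a set \<Rightarrow> ('o, 'a) realization_point set set" where
  "star F = point_class ` {p \<in> points. F \<subseteq> arrows p}"

lemma point_class_in_star:
  assumes "p \<in> points" shows "point_class p \<in> star F \<longleftrightarrow> F \<subseteq> arrows p"
proof
  assume "point_class p \<in> star F"
  then obtain q where q: "q \<in> points" "F \<subseteq> arrows q" "point_class p = point_class q"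
    unfolding star_def by blast
  then show "F \<subseteq> arrows p" using point_class_eq_iff[OF assms q(1)] by simp
next
  assume "F \<subseteq> arrows p"
  then show "point_class p \<in> star F" unfolding star_def using assms by blast
qed

lemma star_subset: "star F \<subseteq> topspace (classifying_space C)"
  by (auto simp: star_def topspace_classifying_space)

text \<open>
  Having \<open>F\<close> among the arrows only requires enough coordinates to be positive.
\<close>
lemma openin_points_over:
  "openin (simplex_union (nerve C)) {p \<in> points. F \<subseteq> arrows p}"
  unfolding simplex_union_def openin_sum_topology
proof (intro conjI ballI)
  show "{p \<in> points. F \<subseteq> arrows p} \<subseteq> Sigma {(n, x). x \<in> simplices (nerve C) n}
      (topspace \<circ> (\<lambda>(n, x). subtopology (powertop_real UNIV) (standard_simplex n)))"
    by (auto simp: realization_points_def)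
  fix i assume "i \<in> {(n, x). x \<in> simplices (nerve C) n}"
  then obtain n x where i: "i = (n, x)" "x \<in> simplices (nerve C) n" by blast
  let ?good = "{I. I \<subseteq> {..n} \<and> F \<subseteq> {segment C x i j | i j. i \<in> I \<and> j \<in> I \<and> i \<le> j}}"
  have "{t. (i, t) \<in> {p \<in> points. F \<subseteq> arrows p}} =
      (\<Union>I\<in>?good. {t. \<forall>i\<in>I. 0 < t i}) \<inter> standard_simplex n" (is "?L = ?R")
  proof
    show "?L \<subseteq> ?R"
    proof
      fix t assume "t \<in> ?L"
      then have t: "t \<in> standard_simplex n" "F \<subseteq> arrows ((n, x), t)"
        by (auto simp: i realization_points_def)
      have "{k. k \<le> n \<and> 0 < t k} \<in> ?good"
        using t(2) by (fastforce simp: carrier_arrows_def)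
      then show "t \<in> ?R" using t(1) by blast
    qed
    show "?R \<subseteq> ?L"
    proof
      fix t assume "t \<in> ?R"
      then obtain I where I: "I \<in> ?good" "\<forall>i\<in>I. 0 < t i" "t \<in> standard_simplex n" by blast
      then have "F \<subseteq> arrows ((n, x), t)" by (fastforce simp: carrier_arrows_def)
      then show "t \<in> ?L" using pointI[OF i(2) I(3)] i(1) by simp
    qed
  qed
  moreover have "openin (powertop_real UNIV) (\<Union>I\<in>?good. {t :: nat \<Rightarrow> real. \<forall>i\<in>I. 0 < t i})"
    by (intro openin_Union) (auto intro!: openin_powertop_positive intro: finite_subset)
  ultimately show "openin (case i of (n, x) \<Rightarrow> subtopology (powertop_real UNIV) (standard_simplex n))
      {t. (i, t) \<in> {p \<in> points. F \<subseteq> arrows p}}"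
    by (auto simp: i openin_subtopology)
qed

lemma point_class_preimage_star: "{p \<in> points. point_class p \<in> star F} = {p \<in> points. F \<subseteq> arrows p}"
  using point_class_in_star by blast

lemma openin_star: "openin (classifying_space C) (star F)"
  using openin_points_over[of F] star_subset[of F] point_class_preimage_star[of F]
  by (simp add: classifying_space_def geometric_realization_def openin_quotient_topology topspace_simplex_union)

text \<open>
  The straight line from a point \<open>t\<close> to the point with all weight equally distributed over the objects
  of \<open>V\<close>: at \<open>s = 1\<close> the coordinates at an object of \<open>V\<close> are rescaled to total \<open>1 / card V\<close> and all others
  vanish. The factor at a position depends only on its object and on the weight of that object, so
  the formula commutes with the identifications in the realization.
\<close>
definition star_deform :: "'o set \<Rightarrow> real \<Rightarrow> ('o, 'a) realization_point \<Rightarrow> ('o, 'a) realization_point" where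
  "star_deform V s p = (case p of ((n, x), t) \<Rightarrow>
     ((n, x), \<lambda>i. t i * ((1 - s) + s * (if vertex C x i \<in> V
         then inverse (real (card V) * weight p (vertex C x i)) else 0))))"

lemma weight_star_deform:
  assumes "p \<in> points" and V: "finite V" "V \<noteq> {}" "\<And>v. v \<in> V \<Longrightarrow> 0 < weight p v"
  shows "weight (star_deform V s p) a = (1 - s) * weight p a + s * (if a \<in> V then inverse (card V) else 0)"
proof -
  obtain n x t where p: "p = ((n, x), t)" using assms(1) by (rule pointE)
  define c where "c = (1 - s) + s * (if a \<in> V then inverse (real (card V) * weight p a) else 0)"
  have "weight (star_deform V s p) a = (\<Sum>i | i \<le> n \<and> vertex C x i = a. t i * c)"
    by (auto simp: p star_deform_def vertex_weight_def c_def intro!: sum.cong)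
  also have "\<dots> = weight p a * c"
    by (simp add: p vertex_weight_def sum_distrib_right)
  also have "\<dots> = (1 - s) * weight p a + s * (if a \<in> V then inverse (card V) else 0)"
    using V(3)[of a] by (auto simp: c_def field_simps)
  finally show ?thesis .
qed

lemma star_deform_in:
  assumes "p \<in> points" and V: "finite V" "V \<noteq> {}" "\<And>v. v \<in> V \<Longrightarrow> 0 < weight p v"
    and s: "0 \<le> s" "s \<le> 1"
  shows "star_deform V s p \<in> points"
proof -
  obtain n x t where p: "p = ((n, x), t)" "x \<in> simplices (nerve C) n" "t \<in> standard_simplex n"
    using assms(1) by (rule pointE)
  obtain t' where t': "star_deform V s p = ((n, x), t')" by (simp add: p(1) star_deform_def)
  have t'_eq: "t' i = t i * ((1 - s) + s * (if vertex C x i \<in> V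
         then inverse (real (card V) * weight p (vertex C x i)) else 0))" for i
    using t' by (auto simp: p(1) star_deform_def)
  have t: "0 \<le> t i" "i > n \<Longrightarrow> t i = 0" "(\<Sum>i\<le>n. t i) = 1" for i
    using p(3) by (auto simp: standard_simplex_def)
  have nonneg: "0 \<le> t' i" for i
    unfolding t'_eq using V(3) s t(1) by (intro mult_nonneg_nonneg add_nonneg_nonneg) (auto simp: less_imp_le)
  define T where "T = vertex C x ` {..n} \<union> V"
  have T: "finite T" "vertex C x ` {..n} \<subseteq> T" "V \<subseteq> T" using V by (auto simp: T_def)
  \<comment> \<open>Summing coordinates over positions is the same as summing weights over objects.\<close>
  have tot: "(\<Sum>a\<in>T. weight ((n, x), u) a) = (\<Sum>i\<le>n. u i)" for u
  proof -
    have "(\<Sum>a\<in>T. weight ((n, x), u) a) = (\<Sum>a\<in>T. \<Sum>i | i \<in> {..n} \<and> vertex C x i = a. u i)"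
      by (simp add: vertex_weight_def)
    also have "\<dots> = (\<Sum>i\<le>n. u i)" using T by (intro sum.group) auto
    finally show ?thesis .
  qed
  have "(\<Sum>i\<le>n. t' i) = (\<Sum>a\<in>T. (1 - s) * weight p a + s * (if a \<in> V then inverse (card V) else 0))"
    unfolding tot[symmetric] t'[symmetric] using weight_star_deform[OF assms(1) V] by simp
  also have "\<dots> = (1 - s) * (\<Sum>a\<in>T. weight p a) + s * (\<Sum>a\<in>T. if a \<in> V then inverse (card V) else 0)"
    by (simp add: sum.distrib sum_distrib_left)
  also have "(\<Sum>a\<in>T. if a \<in> V then inverse (real (card V)) else 0) = (\<Sum>a\<in>V. inverse (card V))"
    using T by (subst sum.inter_restrict[symmetric]) (auto simp: Int_absorb1)
  also have "\<dots> = 1" using V by simp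
  also have "(\<Sum>a\<in>T. weight p a) = 1" using tot[of t] t(3) p(1) by simp
  finally have sum1: "(\<Sum>i\<le>n. t' i) = 1" by simp
  moreover have zero: "t' i = 0" if "i > n" for i using t(2)[OF that] by (simp add: t'_eq)
  moreover have "t' i \<le> 1" for i
  proof (cases "i \<le> n")
    case True
    then have "t' i \<le> (\<Sum>i\<le>n. t' i)" using nonneg by (intro member_le_sum) auto
    then show ?thesis using sum1 by simp
  qed (simp add: zero)
  ultimately have "t' \<in> standard_simplex n" using nonneg by (simp add: standard_simplex_def)
  then show ?thesis using pointI[OF p(2)] by (simp add: t')
qed

lemma arrows_star_deform:
  assumes "p \<in> points" and V: "finite V" "V \<noteq> {}" "\<And>v. v \<in> V \<Longrightarrow> 0 < weight p v"
    and s: "0 \<le> s" "s \<le> 1"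
  shows "arrows (star_deform V s p) =
    (if s < 1 then arrows p else {f \<in> arrows p. Dom C f \<in> V \<and> Cod C f \<in> V})"
proof -
  obtain n x t where p: "p = ((n, x), t)" "x \<in> simplices (nerve C) n" "t \<in> standard_simplex n"
    using assms(1) by (rule pointE)
  obtain t' where t': "star_deform V s p = ((n, x), t')" by (simp add: p(1) star_deform_def)
  have t'_eq: "t' i = t i * ((1 - s) + s * (if vertex C x i \<in> V
         then inverse (real (card V) * weight p (vertex C x i)) else 0))" for i
    using t' by (auto simp: p(1) star_deform_def)
  have cV: "card V > 0" using V by (simp add: card_gt_0_iff)
  have t: "0 \<le> t i" for i using p(3) by (auto simp: standard_simplex_def)
  have inv: "0 < inverse (real (card V) * weight p v)" if "v \<in> V" for v
    using V(3)[OF that] cV by simp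
  show ?thesis
  proof (cases "s < 1")
    case True
    have pos: "0 < (1 - s) + s * (if vertex C x i \<in> V
         then inverse (real (card V) * weight p (vertex C x i)) else 0)" for i
      using True s inv[of "vertex C x i"] by (intro add_pos_nonneg mult_nonneg_nonneg) (auto simp: less_imp_le simp del: vertex.simps)
    have "0 < t' i \<longleftrightarrow> 0 < t i" for i
      unfolding t'_eq using mult_pos_pos[OF _ pos] zero_less_mult_pos2[OF _ pos] by blast
    then show ?thesis unfolding t' using True by (simp add: p(1) carrier_arrows_def)
  next
    case False
    then have s1: "s = 1" using s by simp
    have pos: "0 < t' i \<longleftrightarrow> 0 < t i \<and> vertex C x i \<in> V" for i
      unfolding t'_eq s1 using inv[of "vertex C x i"] t[of i]
      by (cases "vertex C x i \<in> V") (auto simp: zero_less_mult_iff simp del: vertex.simps)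
    have "f \<in> arrows ((n, x), t') \<longleftrightarrow> f \<in> arrows ((n, x), t) \<and> Dom C f \<in> V \<and> Cod C f \<in> V" for f
    proof
      assume "f \<in> arrows ((n, x), t')"
      then obtain i j where ij: "f = segment C x i j" "i \<le> j" "j \<le> n" "0 < t' i" "0 < t' j"
        by (rule in_arrowsE)
      then show "f \<in> arrows ((n, x), t) \<and> Dom C f \<in> V \<and> Cod C f \<in> V"
        using pos in_arrowsI[of i j n t x] segment_Hom[OF p(2) ij(2,3)] by (simp add: Hom_def)
    next
      assume f: "f \<in> arrows ((n, x), t) \<and> Dom C f \<in> V \<and> Cod C f \<in> V"
      then obtain i j where ij: "f = segment C x i j" "i \<le> j" "j \<le> n" "0 < t i" "0 < t j"
        by (auto elim: in_arrowsE)
      then show "f \<in> arrows ((n, x), t')"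
        using f pos in_arrowsI[of i j n t' x] segment_Hom[OF p(2) ij(2,3)] by (simp add: Hom_def)
    qed
    then show ?thesis unfolding t' using False by (simp add: p(1) set_eq_iff)
  qed
qed

lemma continuous_star_deform:
  assumes Q: "Q \<subseteq> points" and V: "finite V" "V \<noteq> {}" "\<And>p v. p \<in> Q \<Longrightarrow> v \<in> V \<Longrightarrow> 0 < weight p v"
  shows "continuous_map (prod_topology (top_of_set {0..1}) (subtopology (simplex_union (nerve C)) Q))
           (simplex_union (nerve C)) (\<lambda>(s, p). star_deform V s p)"
proof -
  let ?J = "{(n, x). x \<in> simplices (nerve C) n}"
  let ?Y = "\<lambda>(n::nat, x::'o \<times> 'a list). subtopology (powertop_real UNIV) (standard_simplex n)"
  define S where "S i = {t. (i, t) \<in> Q}" for i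
  have QS: "Q = Sigma ?J S" using Q by (auto simp: S_def realization_points_def)
  have "continuous_map (prod_topology (top_of_set {0..1}) (sum_topology (\<lambda>i. subtopology (?Y i) (S i)) ?J))
      (simplex_union (nerve C)) (\<lambda>(s, p). star_deform V s p)"
  proof (rule continuous_map_prod_sum_topology)
    fix i assume iJ: "i \<in> ?J"
    then obtain n x where i: "i = (n, x)" "x \<in> simplices (nerve C) n" by blast
    let ?P = "prod_topology (top_of_set {0..1}) (subtopology (?Y i) (S i))"
    define g where "g z = snd (star_deform V (fst z) (i, snd z))" for z
    have Pz: "fst z \<in> {0..1} \<and> snd z \<in> S i" if "z \<in> topspace ?P" for z
      using that by auto
    have c_snd: "continuous_map ?P euclideanreal (\<lambda>z. snd z k)" for k
    proof -
      have "continuous_map ?P (powertop_real UNIV) snd"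
        using continuous_map_snd[of "top_of_set {0..1}" "subtopology (?Y i) (S i)"]
        by (auto simp: i(1) subtopology_subtopology intro: continuous_map_into_fulltopology)
      then have "continuous_map ?P euclideanreal ((\<lambda>t. t k) \<circ> snd)"
        by (rule continuous_map_compose) (rule continuous_map_product_projection, simp)
      then show ?thesis by (simp add: comp_def)
    qed
    have c_fst: "continuous_map ?P euclideanreal fst"
      using continuous_map_fst continuous_map_into_fulltopology by blast
    have "continuous_map ?P euclideanreal (\<lambda>z. g z k)" for k
    proof -
      let ?w = "\<lambda>z. \<Sum>j | j \<le> n \<and> vertex C x j = vertex C x k. snd z j"
      have w: "continuous_map ?P euclideanreal ?w"
        using c_snd by (intro continuous_map_sum) auto
      have "continuous_map ?P euclideanreal
          (\<lambda>z. if vertex C x k \<in> V then inverse (real (card V) * ?w z) else 0)"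
      proof (cases "vertex C x k \<in> V")
        case True
        have "real (card V) * ?w z \<noteq> 0" if "z \<in> topspace ?P" for z
        proof -
          have "(i, snd z) \<in> Q" using Pz[OF that] by (simp add: S_def)
          then have "0 < weight (i, snd z) (vertex C x k)" using V(3) True by blast
          then show ?thesis using V by (simp add: i(1) vertex_weight_def del: vertex.simps)
        qed
        then have "continuous_map ?P euclideanreal (\<lambda>z. inverse (real (card V) * ?w z))"
          using w by (intro continuous_map_real_inverse continuous_map_real_mult_left) auto
        then show ?thesis using True by simp
      qed simp
      then have "continuous_map ?P euclideanreal
          (\<lambda>z. snd z k * ((1 - fst z) + fst z * (if vertex C x k \<in> V then inverse (real (card V) * ?w z) else 0)))"
        using c_fst c_snd
        by (intro continuous_map_real_mult continuous_map_add continuous_map_diff) auto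
      then show ?thesis
        by (simp add: g_def star_deform_def i(1) vertex_weight_def del: vertex.simps cong: if_cong)
    qed
    then have "continuous_map ?P (powertop_real UNIV) g"
      by (simp add: continuous_map_componentwise_UNIV)
    moreover have "g z \<in> standard_simplex n" if "z \<in> topspace ?P" for z
    proof -
      have "(i, snd z) \<in> Q" "0 \<le> fst z" "fst z \<le> 1" using Pz[OF that] by (auto simp: S_def)
      then have "star_deform V (fst z) (i, snd z) \<in> points"
        using star_deform_in[OF _ V(1,2), of "(i, snd z)" "fst z"] V(3) Q by blast
      then show ?thesis by (auto simp: g_def i(1) star_deform_def realization_points_def)
    qed
    ultimately have "continuous_map ?P (?Y i) g"
      by (auto simp: i(1) continuous_map_in_subtopology)
    moreover have "continuous_map (?Y i) (simplex_union (nerve C)) (Pair i)"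
      unfolding simplex_union_def by (rule continuous_map_component_injection[OF iJ])
    ultimately have "continuous_map ?P (simplex_union (nerve C)) (Pair i \<circ> g)"
      by (rule continuous_map_compose)
    moreover have "Pair i \<circ> g = (\<lambda>(s, t). star_deform V s (i, t))"
      by (auto simp: g_def i(1) star_deform_def)
    ultimately show "continuous_map ?P (simplex_union (nerve C)) (\<lambda>(z, y). case (z, i, y) of (s, p) \<Rightarrow> star_deform V s p)"
      by simp
  qed
  then show ?thesis
    unfolding simplex_union_def[of "nerve C"] QS subtopology_sum_topology .
qed

text \<open>
  The deformation ends in a single point, because its weights are then fixed and its arrows are
  those between objects of \<open>V\<close>, which are exactly the arrows in \<open>F\<close>: by \<open>arrows_total\<close> there is an arrow of
  \<open>F\<close> between any two objects of \<open>V\<close>, and by \<open>arrows_unique\<close> a simplex over \<open>F\<close> has no other. Continuity on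
  the quotient holds since the product of a quotient map with the unit interval is a quotient map.
\<close>
theorem contractible_star:
  assumes p0: "p0 \<in> points"
  shows "contractible_space (subtopology (classifying_space C) (star (arrows p0)))"
proof -
  define F where "F = arrows p0"
  define V where "V = {a \<in> Ob C. Ident C a \<in> F}"
  define Q where "Q = {p \<in> points. F \<subseteq> arrows p}"
  have finV: "finite V"
  proof -
    obtain n x t where p: "p0 = ((n, x), t)" "x \<in> simplices (nerve C) n"
      using p0 by (rule pointE)
    have "V \<subseteq> vertex C x ` {..n}"
      using Ident_in_arrows[OF p] unfolding V_def F_def by (auto simp del: vertex.simps)
    then show ?thesis by (simp add: finite_subset)
  qed
  have neV: "V \<noteq> {}" using arrows_nonempty[OF p0] by (auto simp: V_def F_def)
  have posV: "0 < weight p v" if "p \<in> Q" "v \<in> V" for p v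
    using that weight_pos_iff by (auto simp: Q_def V_def)
  have Qp: "p \<in> points" "F \<subseteq> arrows p" if "p \<in> Q" for p using that by (auto simp: Q_def)
  have FV: "Dom C f \<in> V \<and> Cod C f \<in> V" if f: "f \<in> F" for f
  proof -
    obtain a b where ab: "f \<in> Hom C a b" "Ident C a \<in> F" "Ident C b \<in> F"
      using arrows_Hom[OF p0 f[unfolded F_def]] unfolding F_def by metis
    then show ?thesis using Hom_objects[OF ab(1)] by (simp add: V_def Hom_def)
  qed
  have inner: "{f \<in> arrows p. Dom C f \<in> V \<and> Cod C f \<in> V} = F" if p: "p \<in> Q" for p
  proof
    show "F \<subseteq> {f \<in> arrows p. Dom C f \<in> V \<and> Cod C f \<in> V}" using FV Qp[OF p] by blast
    show "{f \<in> arrows p. Dom C f \<in> V \<and> Cod C f \<in> V} \<subseteq> F"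
    proof
      fix f assume "f \<in> {f \<in> arrows p. Dom C f \<in> V \<and> Cod C f \<in> V}"
      then have f: "f \<in> arrows p" "Dom C f \<in> V" "Cod C f \<in> V" by auto
      have fH: "f \<in> Hom C (Dom C f) (Cod C f)" using f(1) arrows_subset[OF Qp(1)[OF p]] by (auto simp: Hom_def)
      obtain g where g: "g \<in> F" "g \<in> Hom C (Dom C f) (Cod C f) \<or> g \<in> Hom C (Cod C f) (Dom C f)"
        using arrows_total[OF p0] f by (auto simp: V_def F_def)
      have "g \<in> Hom C (Dom C f) (Cod C f)"
      proof (cases "Dom C f = Cod C f")
        case False
        then have "r (Dom C f) < r (Cod C f)" using rank_less[OF fH] by simp
        then show ?thesis using g(2) rank_le by (meson not_less)
      qed (use g in auto)
      then have "f = g" using arrows_unique[OF Qp(1)[OF p] f(1) fH] g(1) Qp(2)[OF p] by blast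
      then show "f \<in> F" using g by simp
    qed
  qed
  have deform_points: "star_deform V s p \<in> points"
    if "p \<in> Q" "0 \<le> s" "s \<le> 1" for p s
    by (rule star_deform_in[OF Qp(1)[OF that(1)] finV neV _ that(2,3)]) (rule posV[OF that(1)])
  have deform_arrows: "arrows (star_deform V s p) =
      (if s < 1 then arrows p else {f \<in> arrows p. Dom C f \<in> V \<and> Cod C f \<in> V})"
    if "p \<in> Q" "0 \<le> s" "s \<le> 1" for p s
    by (rule arrows_star_deform[OF Qp(1)[OF that(1)] finV neV _ that(2,3)]) (rule posV[OF that(1)])
  have deform_weight: "weight (star_deform V s p) a =
      (1 - s) * weight p a + s * (if a \<in> V then inverse (card V) else 0)"
    if "p \<in> Q" for p s a
    by (rule weight_star_deform[OF Qp(1)[OF that(1)] finV neV]) (rule posV[OF that(1)])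
  have deform_in: "star_deform V s p \<in> Q" if "p \<in> Q" "s \<in> {0..1}" for s p
  proof -
    have s: "0 \<le> s" "s \<le> 1" using that(2) by auto
    have "F \<subseteq> arrows (star_deform V s p)"
      unfolding deform_arrows[OF that(1) s]
      using inner[OF that(1)] Qp(2)[OF that(1)] by simp
    then show ?thesis
      using deform_points[OF that(1) s] by (simp add: Q_def)
  qed
  have deform_eq: "point_class (star_deform V s p) = point_class (star_deform V s q)"
    if "p \<in> Q" "q \<in> Q" "s \<in> {0..1}" "point_class p = point_class q \<or> s = 1" for s p q
  proof -
    have s: "0 \<le> s" "s \<le> 1" using that(3) by auto
    have pq: "arrows p = arrows q \<and> weight p = weight q" if "s < 1"
      using that \<open>point_class p = point_class q \<or> s = 1\<close>
        point_class_eq_iff[OF Qp(1)[OF \<open>p \<in> Q\<close>] Qp(1)[OF \<open>q \<in> Q\<close>]] by simp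
    have "arrows (star_deform V s p) = arrows (star_deform V s q)"
      unfolding deform_arrows[OF that(1) s]
        deform_arrows[OF that(2) s]
        inner[OF that(1)] inner[OF that(2)] using pq by simp
    moreover have "weight (star_deform V s p) = weight (star_deform V s q)"
    proof
      fix a
      show "weight (star_deform V s p) a = weight (star_deform V s q) a"
        unfolding deform_weight[OF that(1)]
          deform_weight[OF that(2)]
        using pq s(2) by (cases "s < 1") simp_all
    qed
    ultimately show ?thesis
      using point_class_eq_iff[OF Qp(1)[OF deform_in[OF that(1,3)]] Qp(1)[OF deform_in[OF that(2,3)]]] by simp
  qed
  have deform_0: "star_deform V 0 p = p" for p
    by (simp add: star_deform_def split: prod.splits)
  let ?B = "classifying_space C" and ?X = "simplex_union (nerve C)"
  let ?I = "top_of_set {0..1::real}"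
  let ?star = "subtopology ?B (star F)"
  have quot: "quotient_map (subtopology ?X Q) ?star point_class"
    by (rule quotient_map_restriction[OF quotient_map_point_class])
      (use point_class_preimage_star openin_star in \<open>auto simp: topspace_simplex_union Q_def\<close>)
  have loc: "locally_compact_space ?I"
    by (intro compact_imp_locally_compact_space)
      (auto simp: compact_space_subtopology compactin_euclidean_iff Hausdorff_space_subtopology Hausdorff_space_euclidean)
  have quotI: "quotient_map (prod_topology ?I (subtopology ?X Q)) (prod_topology ?I ?star) (\<lambda>(s, p). (s, point_class p))"
    by (rule quotient_map_prod_right[OF loc _ quot])
      (simp add: Hausdorff_space_subtopology)
  \<comment> \<open>On the quotient the homotopy is defined through a choice of representatives; by \<open>deform_eq\<close> the
    choice does not matter.\<close>
  define pick where "pick c = (SOME p. p \<in> Q \<and> point_class p = c)" for c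
  have pick: "pick (point_class p) \<in> Q \<and> point_class (pick (point_class p)) = point_class p" if "p \<in> Q" for p
    unfolding pick_def by (rule someI[of _ p]) (use that in simp)
  define H where "H z = point_class (star_deform V (fst z) (pick (snd z)))" for z
  have H_eq: "H (s, point_class p) = point_class (star_deform V s p)" if "p \<in> Q" "s \<in> {0..1}" for s p
    unfolding H_def fst_conv snd_conv
    using deform_eq[of "pick (point_class p)" p s] pick[OF that(1)] that by blast
  have topQ: "topspace (subtopology ?X Q) = Q" by (auto simp: topspace_simplex_union Q_def)
  have top_star: "topspace ?star = point_class ` Q"
    using star_subset[of F] by (auto simp: star_def Q_def)
  have cont: "continuous_map (prod_topology ?I ?star) ?star H"
  proof (rule continuous_compose_quotient_map[OF quotI])
    have "continuous_map (prod_topology ?I (subtopology ?X Q)) ?B (point_class \<circ> (\<lambda>(s, p). star_deform V s p))"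
      using continuous_star_deform[OF _ finV neV posV, of Q] quotient_imp_continuous_map[OF quotient_map_point_class]
      by (intro continuous_map_compose) (auto simp: Q_def)
    moreover have dom: "fst z \<in> {0..1} \<and> snd z \<in> Q"
      if "z \<in> topspace (prod_topology ?I (subtopology ?X Q))" for z
      using that unfolding topspace_prod_topology topQ by (simp add: mem_Times_iff)
    moreover have "point_class (star_deform V s p) \<in> star F" if "p \<in> Q" "s \<in> {0..1}" for s p
      using point_class_in_star[OF Qp(1)[OF deform_in[OF that]]] Qp(2)[OF deform_in[OF that]] by simp
    ultimately have "continuous_map (prod_topology ?I (subtopology ?X Q)) ?star (point_class \<circ> (\<lambda>(s, p). star_deform V s p))"
      unfolding continuous_map_in_subtopology comp_def split_beta Pi_iff image_subset_iff by blast
    then show "continuous_map (prod_topology ?I (subtopology ?X Q)) ?star (H \<circ> (\<lambda>(s, p). (s, point_class p)))"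
    proof (rule continuous_map_eq)
      fix z assume "z \<in> topspace (prod_topology ?I (subtopology ?X Q))"
      then have "H (fst z, point_class (snd z)) = point_class (star_deform V (fst z) (snd z))"
        using H_eq dom by blast
      then show "(point_class \<circ> (\<lambda>(s, p). star_deform V s p)) z = (H \<circ> (\<lambda>(s, p). (s, point_class p))) z"
        by (simp add: split_beta)
    qed
  qed
  have p0Q: "p0 \<in> Q" using p0 by (simp add: Q_def F_def)
  have "homotopic_with (\<lambda>x. True) ?star ?star id (\<lambda>c. point_class (star_deform V 1 p0))"
  proof (subst homotopic_with, simp, intro exI[of _ H] conjI ballI)
    show "continuous_map (prod_topology ?I ?star) ?star H" by (rule cont)
    fix c assume "c \<in> topspace ?star"
    then obtain p where p: "p \<in> Q" "c = point_class p" using top_star by blast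
    show "H (0, c) = id c" using H_eq[OF p(1), of 0] p(2) by (simp add: deform_0)
    show "H (1, c) = point_class (star_deform V 1 p0)"
      using H_eq[OF p(1), of 1] p deform_eq[OF p(1) p0Q, of 1] by simp
  qed auto
  then show ?thesis unfolding contractible_space_def F_def by blast
qed

end

section \<open>Adjoining the objects one at a time\<close>

context ranked_category
begin

text \<open>
  The barycentre has full support, so that its arrows are all segments of the string.
\<close>
definition barycentre :: "'o \<times> 'a list \<Rightarrow> ('o, 'a) realization_point" where
  "barycentre x = (let n = length (snd x) in ((n, x), \<lambda>i. if i \<le> n then inverse (real (Suc n)) else 0))"

definition chain_arrows :: "'o \<times> 'a list \<Rightarrow> 'a set" where
  "chain_arrows x = arrows (barycentre x)"

lemma barycentre_in:
  assumes "x \<in> simplices (nerve C) n"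
  shows "barycentre x \<in> points"
proof -
  have n: "n = length (snd x)" using assms by (simp add: simplices_nerve)
  have "(\<lambda>i. if i \<le> n then inverse (real (Suc n)) else 0) \<in> standard_simplex n"
    by (auto simp: standard_simplex_def field_simps)
  from pointI[OF assms this] show ?thesis
    unfolding barycentre_def Let_def n .
qed

lemma chain_arrows_eq:
  assumes "x \<in> simplices (nerve C) n"
  shows "chain_arrows x = {segment C x i j | i j. i \<le> j \<and> j \<le> n}"
proof -
  have n: "n = length (snd x)" using assms by (simp add: simplices_nerve)
  show ?thesis
    by (auto simp: chain_arrows_def barycentre_def carrier_arrows_def n Let_def)
qed

lemma chain_arrows_singleton: "a \<in> Ob C \<Longrightarrow> chain_arrows (a, []) = {Ident C a}"
  using chain_arrows_eq[of "(a, [])" 0] by (simp add: simplices_nerve segment_def)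

text \<open>
  A set of arrows of a point is closed under composition, so extending a string at its start by \<open>g\<close> only
  adds the condition that \<open>g\<close> is present.
\<close>
lemma chain_arrows_Cons:
  assumes x: "(a, fs) \<in> simplices (nerve C) n" and g: "g \<in> Hom C b a" and p: "p \<in> points"
  shows "(b, g # fs) \<in> simplices (nerve C) (Suc n)"
    and "chain_arrows (b, g # fs) \<subseteq> arrows p \<longleftrightarrow> g \<in> arrows p \<and> chain_arrows (a, fs) \<subseteq> arrows p"
proof -
  let ?x = "(a, fs)" and ?y = "(b, g # fs)"
  show y: "?y \<in> simplices (nerve C) (Suc n)"
    using x g Hom_objects[OF g] by (simp add: simplices_nerve Hom_def)
  have S: "ord_map n (Suc n) Suc" by (simp add: ord_map_def)
  have "action (nerve C) n (Suc n) Suc ?y = ?x"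
  proof -
    have "map (\<lambda>i. segment C ?y (Suc i) (Suc (Suc i))) [0..<n] = fs"
      using x segment_Suc[OF y] by (intro nth_equalityI) (auto simp: simplices_nerve)
    moreover have "vertex C ?y (Suc 0) = a" using g by (simp add: Hom_def)
    ultimately show ?thesis by (simp add: action_nerve del: vertex.simps)
  qed
  then have shift: "segment C ?x i j = segment C ?y (Suc i) (Suc j)" if "i \<le> j" "j \<le> n" for i j
    using segment_action[OF S y that] by simp
  have first: "segment C ?y 0 (Suc 0) = g" using segment_Suc[OF y, of 0] by simp
  show "chain_arrows ?y \<subseteq> arrows p \<longleftrightarrow> g \<in> arrows p \<and> chain_arrows ?x \<subseteq> arrows p"
  proof
    assume sub: "chain_arrows ?y \<subseteq> arrows p"
    have "g \<in> chain_arrows ?y" unfolding chain_arrows_eq[OF y] using first by (intro CollectI exI[of _ 0] exI[of _ "Suc 0"]) simp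
    moreover have "chain_arrows ?x \<subseteq> chain_arrows ?y"
      unfolding chain_arrows_eq[OF x] chain_arrows_eq[OF y] using shift by fastforce
    ultimately show "g \<in> arrows p \<and> chain_arrows ?x \<subseteq> arrows p" using sub by blast
  next
    assume gx: "g \<in> arrows p \<and> chain_arrows ?x \<subseteq> arrows p"
    have tail: "segment C ?y (Suc i) (Suc j) \<in> arrows p" if "i \<le> j" "j \<le> n" for i j
    proof -
      have "segment C ?x i j \<in> chain_arrows ?x" unfolding chain_arrows_eq[OF x] using that by blast
      then show ?thesis using gx unfolding shift[OF that] by blast
    qed
    show "chain_arrows ?y \<subseteq> arrows p"
    proof
      fix f assume "f \<in> chain_arrows ?y"
      then obtain i j where ij: "f = segment C ?y i j" "i \<le> j" "j \<le> Suc n"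
        unfolding chain_arrows_eq[OF y] by blast
      consider "i = 0" "j = 0" | j' where "i = 0" "j = Suc j'" | i' j' where "i = Suc i'" "j = Suc j'"
        using ij(2) by (cases i; cases j) auto
      then show "f \<in> arrows p"
      proof cases
        case 1
        obtain c d where "g \<in> Hom C c d" "Ident C c \<in> arrows p"
          using arrows_Hom[OF p] gx by metis
        then show ?thesis using 1 ij g by (simp add: segment_def Hom_def)
      next
        case 2
        have "f = Comp C (segment C ?y (Suc 0) (Suc j')) g"
          using segment_Comp[OF y, of 0 "Suc 0" "Suc j'"] ij 2 first by simp
        moreover have "segment C ?y (Suc 0) (Suc j') \<in> arrows p" using tail[of 0 j'] 2 ij by simp
        moreover have "segment C ?y (Suc 0) (Suc j') \<in> Hom C a (vertex C ?y (Suc j'))"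
          using segment_Hom[OF y, of "Suc 0" "Suc j'"] 2 ij g by (simp add: Hom_def)
        ultimately show ?thesis using arrows_Comp[OF p _ g] gx by metis
      next
        case 3
        then show ?thesis using tail[of i' j'] ij by simp
      qed
    qed
  qed
qed

lemma star_contractible_nonempty:
  assumes x: "x \<in> simplices (nerve C) n"
  shows "contractible_space (subtopology (classifying_space C) (star (chain_arrows x)))"
    and "star (chain_arrows x) \<noteq> {}"
proof -
  have p: "barycentre x \<in> points" using barycentre_in[OF x] .
  show "contractible_space (subtopology (classifying_space C) (star (chain_arrows x)))"
    unfolding chain_arrows_def by (rule contractible_star[OF p])
  show "star (chain_arrows x) \<noteq> {}"
    using p unfolding star_def chain_arrows_def by blast
qed

lemma classifying_space_set_eqI:
  assumes "A \<subseteq> topspace (classifying_space C)" "B \<subseteq> topspace (classifying_space C)"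
    and "\<And>p. p \<in> points \<Longrightarrow> point_class p \<in> A \<longleftrightarrow> point_class p \<in> B"
  shows "A = B"
  using assms unfolding topspace_classifying_space by blast

definition low_objects :: "nat \<Rightarrow> 'o set" where
  "low_objects n = {a \<in> Ob C. r a < n}"

definition low_part :: "nat \<Rightarrow> ('o, 'a) realization_point set set" where
  "low_part n = (\<Union>b\<in>low_objects n. star {Ident C b})"

lemma openin_low_part: "openin (classifying_space C) (low_part n)"
  unfolding low_part_def using openin_star by blast

lemma point_class_in_low_part:
  "p \<in> points \<Longrightarrow> point_class p \<in> low_part n \<longleftrightarrow> (\<exists>b\<in>low_objects n. Ident C b \<in> arrows p)"
  unfolding low_part_def using point_class_in_star by blast

lemma low_objects_Suc:
  "low_objects (Suc n) = low_objects n \<or>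
   (\<exists>b\<in>Ob C. r b = n \<and> low_objects (Suc n) = insert b (low_objects n) \<and> b \<notin> low_objects n)"
proof (cases "\<exists>b\<in>Ob C. r b = n")
  case True
  then obtain b where b: "b \<in> Ob C" "r b = n" by blast
  have "low_objects (Suc n) = insert b (low_objects n)"
    using b rank_inj by (auto simp: low_objects_def less_Suc_eq inj_on_def)
  then show ?thesis using b by (auto simp: low_objects_def)
next
  case False
  then have "low_objects (Suc n) = low_objects n" by (auto simp: low_objects_def less_Suc_eq)
  then show ?thesis ..
qed

context
  fixes k :: "'o \<Rightarrow> rat"
  assumes finOb: "finite (Ob C)" and finArr: "finite (Arr C)" and k: "coweighting C k"
begin

lemma finite_low_objects: "finite (low_objects n)"
  using finOb by (simp add: low_objects_def)

lemma finite_Hom: "finite (Hom C a b)"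
  using finArr by (simp add: Hom_def)

lemma coweighting_low:
  assumes "a \<in> Ob C" "r a < n"
  shows "(\<Sum>b\<in>low_objects n. of_nat (card (Hom C b a)) * k b) = 1"
proof -
  have "Hom C b a = {}" if "b \<in> Ob C - low_objects n" for b
    using rank_le[of _ b a] assms that by (fastforce simp: low_objects_def)
  then have "(\<Sum>b\<in>low_objects n. of_nat (card (Hom C b a)) * k b) = (\<Sum>b\<in>Ob C. of_nat (card (Hom C b a)) * k b)"
    using finOb by (intro sum.mono_neutral_left) (auto simp: low_objects_def)
  then show ?thesis using k assms by (simp add: coweighting_iff)
qed

text \<open>
  The coweighting equation at \<open>b\<close>, solved for the value at \<open>b\<close>: objects of higher rank have no arrows to
  \<open>b\<close>, and the identity is the only endomorphism.
\<close>
lemma coweighting_below: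
  assumes "b \<in> Ob C" "low_objects (Suc (r b)) = insert b (low_objects (r b))" "b \<notin> low_objects (r b)"
  shows "1 - (\<Sum>c\<in>low_objects (r b). of_nat (card (Hom C c b)) * k c) = k b"
proof -
  have "Hom C b b = {Ident C b}" using endo Ident_in[OF assms(1)] by blast
  then show ?thesis
    using coweighting_low[of b "Suc (r b)"] assms finite_low_objects by simp
qed

text \<open>
  Induction over the objects in increasing order, for all strings at once, because the pieces that are
  attached at \<open>b\<close> are the stars of strings that start at \<open>b\<close> instead of \<open>a\<close>.
\<close>
lemma euler_char_star_low_part:
  assumes "(a, fs) \<in> simplices (nerve C) m"
  shows "has_top_euler_char (subtopology (classifying_space C) (star (chain_arrows (a, fs)) \<inter> low_part n)) \<and>
    rat_of_int (top_euler_char (subtopology (classifying_space C) (star (chain_arrows (a, fs)) \<inter> low_part n))) =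
      (\<Sum>b\<in>low_objects n. of_nat (card (Hom C b a)) * k b)"
  using assms
proof (induction n arbitrary: a fs m)
  case 0
  have "low_objects 0 = {}" "low_part 0 = {}" by (auto simp: low_objects_def low_part_def)
  then show ?case
    using euler_char_empty[of "subtopology (classifying_space C) {}"] by simp
next
  case (Suc n)
  let ?B = "classifying_space C" and ?F = "chain_arrows (a, fs)"
  have a: "a \<in> Ob C" using vertex_in[OF Suc.prems, of 0] by simp
  have Ident_a: "Ident C a \<in> ?F"
    unfolding chain_arrows_eq[OF Suc.prems]
    using segment_self[of "(a, fs)" 0] by (intro CollectI exI[of _ 0]) simp
  show ?case
  proof (cases "r a < Suc n")
    case True
    then have "a \<in> low_objects (Suc n)" using a by (simp add: low_objects_def)
    then have "star ?F \<inter> low_part (Suc n) = star ?F"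
      using star_subset Ident_a
      by (intro classifying_space_set_eqI) (auto simp: point_class_in_star point_class_in_low_part)
    moreover have "topspace (subtopology ?B (star ?F)) \<noteq> {}"
      using star_contractible_nonempty(2)[OF Suc.prems] star_subset by (simp add: Int_absorb1)
    ultimately show ?thesis
      using euler_char_contractible[OF star_contractible_nonempty(1)[OF Suc.prems]] coweighting_low[OF a True]
      by simp
  next
    case False
    consider "low_objects (Suc n) = low_objects n"
      | b where "b \<in> Ob C" "r b = n" "low_objects (Suc n) = insert b (low_objects n)" "b \<notin> low_objects n"
      using low_objects_Suc by blast
    then show ?thesis
    proof cases
      case 1
      then show ?thesis using Suc.IH[OF Suc.prems] by (simp add: low_part_def)
    next
      case (2 b)
      define S where "S g = star (chain_arrows (b, g # fs))" for g
      let ?Y = "star ?F \<inter> low_part n"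
      have simp_g: "(b, g # fs) \<in> simplices (nerve C) (Suc m)" if "g \<in> Hom C b a" for g
        using Suc.prems that Hom_objects[OF that] by (simp add: simplices_nerve Hom_def)
      have in_S: "point_class p \<in> S g \<longleftrightarrow> g \<in> arrows p \<and> ?F \<subseteq> arrows p"
        if "g \<in> Hom C b a" "p \<in> points" for g p
        using chain_arrows_Cons(2)[OF Suc.prems that] point_class_in_star[OF that(2)] by (simp add: S_def)
      have S_sub: "S g \<subseteq> topspace ?B" for g using star_subset by (simp add: S_def)
      have Y_sub: "?Y \<subseteq> topspace ?B" using star_subset by blast
      have IH: "has_top_euler_char (subtopology ?B (?Y \<inter> S g)) \<and>
          rat_of_int (top_euler_char (subtopology ?B (?Y \<inter> S g))) =
            (\<Sum>c\<in>low_objects n. of_nat (card (Hom C c b)) * k c)" if g: "g \<in> Hom C b a" for g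
      proof -
        have "?Y \<inter> S g = S g \<inter> low_part n"
        proof (rule classifying_space_set_eqI)
          fix p assume p: "p \<in> points"
          show "point_class p \<in> ?Y \<inter> S g \<longleftrightarrow> point_class p \<in> S g \<inter> low_part n"
            using in_S[OF g p] point_class_in_star[OF p] by blast
        qed (use S_sub in blast)+
        then show ?thesis using Suc.IH[OF simp_g[OF g]] by (simp add: S_def)
      qed
      have split: "star ?F \<inter> low_part (Suc n) = ?Y \<union> (\<Union>g\<in>Hom C b a. S g)"
      proof (rule classifying_space_set_eqI)
        fix p assume p: "p \<in> points"
        \<comment> \<open>A point with vertices \<open>b\<close> and \<open>a\<close> has an arrow between them, and it starts at \<open>b\<close> because
          the rank of \<open>b\<close> is the smaller one.\<close>
        have "\<exists>g\<in>Hom C b a. g \<in> arrows p" if Fb: "?F \<subseteq> arrows p" "Ident C b \<in> arrows p"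
        proof -
          obtain g where g: "g \<in> arrows p" "g \<in> Hom C b a \<or> g \<in> Hom C a b"
            using arrows_total[OF p \<open>b \<in> Ob C\<close> a Fb(2)] Fb(1) Ident_a by blast
          have "Hom C a b = {}" using rank_le[of _ a b] False 2 by fastforce
          with g show ?thesis by blast
        qed
        moreover have "Ident C b \<in> arrows p" if g: "g \<in> arrows p" "g \<in> Hom C b a" for g
        proof -
          obtain c d where "g \<in> Hom C c d" "Ident C c \<in> arrows p"
            using arrows_Hom[OF p g(1)] by metis
          then show ?thesis using g(2) by (simp add: Hom_def)
        qed
        ultimately show "point_class p \<in> star ?F \<inter> low_part (Suc n) \<longleftrightarrow>
            point_class p \<in> ?Y \<union> (\<Union>g\<in>Hom C b a. S g)"
          using in_S[OF _ p] point_class_in_star[OF p] point_class_in_low_part[OF p] 2(3) by auto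
      qed (use star_subset S_sub in blast)+
      have disj: "disjoint_family_on S (Hom C b a)"
        unfolding disjoint_family_on_def
      proof (intro ballI impI)
        fix g h assume gh: "g \<in> Hom C b a" "h \<in> Hom C b a" "g \<noteq> h"
        show "S g \<inter> S h = {}"
        proof (rule classifying_space_set_eqI)
          fix p assume p: "p \<in> points"
          show "point_class p \<in> S g \<inter> S h \<longleftrightarrow> point_class p \<in> {}"
            using in_S[OF gh(1) p] in_S[OF gh(2) p] arrows_unique[OF p] gh by blast
        qed (use S_sub in blast)+
      qed
      have Y: "openin ?B ?Y" using openin_star openin_low_part by blast
      have S: "openin ?B (S g)" "contractible_space (subtopology ?B (S g))" "S g \<noteq> {}"
        if "g \<in> Hom C b a" for g
        using openin_star star_contractible_nonempty[OF simp_g[OF that]] by (simp_all add: S_def)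
      note IHY = Suc.IH[OF Suc.prems]
      note attach = euler_char_attach_contractible[OF finite_Hom Y conjunct1[OF IHY], of b a S]
      have "has_top_euler_char (subtopology ?B (?Y \<union> (\<Union>g\<in>Hom C b a. S g))) \<and>
         top_euler_char (subtopology ?B (?Y \<union> (\<Union>g\<in>Hom C b a. S g))) =
         top_euler_char (subtopology ?B ?Y) + (\<Sum>g\<in>Hom C b a. 1 - top_euler_char (subtopology ?B (?Y \<inter> S g)))"
        by (rule attach) (use S disj IH in blast)+
      moreover have "rat_of_int (\<Sum>g\<in>Hom C b a. 1 - top_euler_char (subtopology ?B (?Y \<inter> S g))) =
          of_nat (card (Hom C b a)) * k b"
      proof -
        have "1 - (\<Sum>c\<in>low_objects n. of_nat (card (Hom C c b)) * k c) = k b"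
          using coweighting_below[of b] 2 by simp
        then show ?thesis using IH by simp
      qed
      ultimately show ?thesis
        unfolding split using IHY 2(3,4) finite_low_objects by simp
    qed
  qed
qed

text \<open>
  The same step without a string: the points that \<open>b\<close> adds to the union lie in the star of the vertex \<open>b\<close>.
\<close>
lemma euler_char_low_part:
  "has_top_euler_char (subtopology (classifying_space C) (low_part n)) \<and>
    rat_of_int (top_euler_char (subtopology (classifying_space C) (low_part n))) = (\<Sum>b\<in>low_objects n. k b)"
proof (induction n)
  case 0
  have "low_objects 0 = {}" "low_part 0 = {}" by (auto simp: low_objects_def low_part_def)
  then show ?case
    using euler_char_empty[of "subtopology (classifying_space C) {}"] by simp
next
  case (Suc n)
  let ?B = "classifying_space C"
  consider "low_objects (Suc n) = low_objects n"
    | b where "b \<in> Ob C" "r b = n" "low_objects (Suc n) = insert b (low_objects n)" "b \<notin> low_objects n"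
    using low_objects_Suc by blast
  then show ?case
  proof cases
    case 1
    then show ?thesis using Suc.IH by (simp add: low_part_def)
  next
    case (2 b)
    define S where "S = star (chain_arrows (b, []))"
    have b: "(b, []) \<in> simplices (nerve C) 0" using 2(1) by (simp add: simplices_nerve)
    have eq: "low_part (Suc n) = low_part n \<union> (\<Union>i\<in>{b}. S)"
      by (auto simp: low_part_def 2(3) S_def chain_arrows_singleton[OF 2(1)])
    have int: "has_top_euler_char (subtopology ?B (low_part n \<inter> S))"
      "rat_of_int (top_euler_char (subtopology ?B (low_part n \<inter> S))) =
         (\<Sum>c\<in>low_objects n. of_nat (card (Hom C c b)) * k c)"
      using euler_char_star_low_part[OF b, of n] by (simp_all add: S_def Int_commute)
    have "has_top_euler_char (subtopology ?B (low_part n \<union> (\<Union>i\<in>{b}. S))) \<and>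
       top_euler_char (subtopology ?B (low_part n \<union> (\<Union>i\<in>{b}. S))) =
       top_euler_char (subtopology ?B (low_part n)) + (\<Sum>i\<in>{b}. 1 - top_euler_char (subtopology ?B (low_part n \<inter> S)))"
      by (rule euler_char_attach_contractible[OF _ openin_low_part conjunct1[OF Suc.IH]])
        (use openin_star star_contractible_nonempty[OF b] int in \<open>auto simp: S_def disjoint_family_on_def\<close>)
    moreover have "rat_of_int (1 - top_euler_char (subtopology ?B (low_part n \<inter> S))) = k b"
      using coweighting_below[of b] 2 int(2) by simp
    ultimately show ?thesis
      unfolding eq using Suc.IH 2(3,4) finite_low_objects by simp
  qed
qed

theorem euler_char_classifying_space:
  "has_top_euler_char (classifying_space C)"
  "rat_of_int (top_euler_char (classifying_space C)) = (\<Sum>a\<in>Ob C. k a)"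
proof -
  have all: "low_objects (Suc N) = Ob C"
    using rank_bound by (auto simp: low_objects_def less_Suc_eq_le)
  have "low_part (Suc N) = topspace (classifying_space C)"
  proof (rule classifying_space_set_eqI)
    fix p assume p: "p \<in> points"
    then show "point_class p \<in> low_part (Suc N) \<longleftrightarrow> point_class p \<in> topspace (classifying_space C)"
      using arrows_nonempty[OF p] by (simp add: point_class_in_low_part all topspace_classifying_space)
  qed (use openin_subset[OF openin_low_part] in auto)
  then show "has_top_euler_char (classifying_space C)"
    "rat_of_int (top_euler_char (classifying_space C)) = (\<Sum>a\<in>Ob C. k a)"
    using euler_char_low_part[of "Suc N"] by (simp_all add: all)
qed

end
end

theorem proposition2p11:
  fixes C :: "('o, 'a) category_data"
  assumes "finite_category C"
    and "skeletal C"
    and "only_identity_endos C"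
  shows "finite (nondegenerate_simplices (nerve C)) \<and>
         has_top_euler_char (classifying_space C) \<and>
         has_cat_euler_char C \<and>
         rat_of_int (top_euler_char (classifying_space C)) = cat_euler_char C"
proof -
  obtain r N where "ranked_category C r N"
    using finite_category_rankable[OF assms] .
  then interpret ranked_category C r N .
  have fin: "finite (Ob C)" "finite (Arr C)" using assms(1) by (simp_all add: finite_category_def)
  have has: "has_cat_euler_char C" using has_cat_euler_char[OF fin] .
  then obtain k where k: "coweighting C k" by (auto simp: has_cat_euler_char_def)
  show ?thesis
    using finite_nondegenerate_simplices[OF fin] euler_char_classifying_space[OF fin k] has
      cat_euler_char_eq(2)[OF has k] by simp
qed

end
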